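(* Let $\Sigma=\{1,\dots,\sigma\}$, let $1\le k\le n$ be integers and $0<\varepsilon<1$. There exists a $(1\pm\varepsilon)$-approximate circular $k$-mismatch sketch ($(\varepsilon,k)$-ACS) for $\Sigma^n$ of size $\tilde{O}(\min(\varepsilon^{-2}\sqrt{k},\varepsilon^{-1.5}\sqrt{n}))$.
   Context: $\mathsf{Ham}(S,T)=|\{i\in[n]: S[i]\ne T[i]\}|$ for $S,T\in\Sigma^n$. $\mathsf{cyc}(S)=S[2]\cdots S[n]S[1]$ and $\mathsf{cyc}^m$ is its $m$-fold iterate, $m\in\mathbb{Z}$. A randomized function is a random variable whose values are functions; a single random draw of the encoding is applied to both strings. "With high probability" means with probability at least $1-n^{-\Omega(1)}$; $\tilde O(\cdot)$ suppresses $\log^{O(1)}n$ factors. An $(\varepsilon,k)$-ACS for $\Pi\subseteq\Sigma^n$ is a pair of randomized functions $\mathtt{sk}:\Pi\to\{0,1\}^*$, $\mathtt{dec}:\{0,1\}^*\times\{0,1\}^*\times\mathbb{Z}\to\mathbb{R}$ such that for all $S_1,S_2\in\Pi$ and $m\in\mathbb{Z}$, with high probability: if $\mathsf{Ham}(S_1,\mathsf{cyc}^m(S_2))\le k$ then $\mathtt{dec}(\mathtt{sk}(S_1),\mathtt{sk}(S_2),m)\in[(1-\varepsilon)h,(1+\varepsilon)h]$ where $h=\mathsf{Ham}(S_1,\mathsf{cyc}^m(S_2))$; otherwise $\mathtt{dec}(\mathtt{sk}(S_1),\mathtt{sk}(S_2),m)>(1-\varepsilon)k$. A sketch for $\Pi$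 has size $s$ if for every $S\in\Pi$, $|\mathtt{sk}(S)|\le s$ with high probability. *)

theory Defs
  imports "HOL-Probability.Probability"
begin

definition strings :: "nat \<Rightarrow> nat \<Rightarrow> nat list set" where
  "strings \<sigma> n = {S. length S = n \<and> set S \<subseteq> {1..\<sigma>}}"

(* Only used for strings of equal length. *)
definition Ham :: "'a list \<Rightarrow> 'a list \<Rightarrow> nat" where
  "Ham S T = card {i. i < length S \<and> S ! i \<noteq> T ! i}"

(* cyc is rotate1, a bijection on lists (bij_rotate1), so that inv rotate1 is its
   two-sided inverse and negative powers are meaningful. *)
definition cyc_pow :: "int \<Rightarrow> 'a list \<Rightarrow> 'a list" where
  "cyc_pow m = (if m \<ge> 0 then rotate1 ^^ nat m else inv rotate1 ^^ nat (- m))"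

lemma cyc_pow_neg_cancel: "cyc_pow (- m) (cyc_pow m S) = S"
proof -
  have b: "bij (rotate1 :: 'a list \<Rightarrow> 'a list)" by (rule bij_rotate1)
  have i: "(inv rotate1 ^^ j) ((rotate1 ^^ j) T) = T" for j and T :: "'a list"
    by (induction j arbitrary: T) (simp_all add: funpow_swap1 inv_f_f[OF bij_is_inj[OF b]])
  have s: "(rotate1 ^^ j) ((inv rotate1 ^^ j) T) = T" for j and T :: "'a list"
    by (induction j arbitrary: T) (simp_all add: funpow_swap1 surj_f_inv_f[OF bij_is_surj[OF b]])
  show ?thesis using i s by (auto simp: cyc_pow_def)
qed

(* The exponent c is the constant hidden in 1 - n^(-Omega(1)). *)
definition whp :: "real \<Rightarrow> nat \<Rightarrow> 'w measure \<Rightarrow> ('w \<Rightarrow> bool) \<Rightarrow> bool" where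
  "whp c n M P \<longleftrightarrow> measure M {\<omega> \<in> space M. P \<omega>} \<ge> 1 - real n powr (- c)"

(* Encoder and decoder are random variables on one probability space M (shared randomness);
   their values are functions, and measurability is required pointwise. *)
definition randomized_pair ::
  "'w measure \<Rightarrow> nat list set \<Rightarrow> ('w \<Rightarrow> nat list \<Rightarrow> bool list)
    \<Rightarrow> ('w \<Rightarrow> bool list \<Rightarrow> bool list \<Rightarrow> int \<Rightarrow> real) \<Rightarrow> bool" where
  "randomized_pair M X sk dec \<longleftrightarrow>
     prob_space M \<and>
     (\<forall>S\<in>X. (\<lambda>\<omega>. sk \<omega> S) \<in> M \<rightarrow>\<^sub>M count_space UNIV) \<and>
     (\<forall>x y m. (\<lambda>\<omega>. dec \<omega> x y m) \<in> borel_measurable M)"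

definition is_ACS ::
  "real \<Rightarrow> nat \<Rightarrow> real \<Rightarrow> nat \<Rightarrow> nat list set \<Rightarrow> 'w measure
    \<Rightarrow> ('w \<Rightarrow> nat list \<Rightarrow> bool list)
    \<Rightarrow> ('w \<Rightarrow> bool list \<Rightarrow> bool list \<Rightarrow> int \<Rightarrow> real) \<Rightarrow> bool" where
  "is_ACS c n \<epsilon> k X M sk dec \<longleftrightarrow>
     randomized_pair M X sk dec \<and>
     (\<forall>S\<^sub>1\<in>X. \<forall>S\<^sub>2\<in>X. \<forall>m::int.
        let h = Ham S\<^sub>1 (cyc_pow m S\<^sub>2) in
        whp c n M (\<lambda>\<omega>.
          if h \<le> k
          then dec \<omega> (sk \<omega> S\<^sub>1) (sk \<omega> S\<^sub>2) m \<in> {(1 - \<epsilon>) * real h .. (1 + \<epsilon>) * real h}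
          else dec \<omega> (sk \<omega> S\<^sub>1) (sk \<omega> S\<^sub>2) m > (1 - \<epsilon>) * real k))"

definition has_size ::
  "real \<Rightarrow> nat \<Rightarrow> nat list set \<Rightarrow> 'w measure \<Rightarrow> ('w \<Rightarrow> nat list \<Rightarrow> bool list) \<Rightarrow> real \<Rightarrow> bool" where
  "has_size c n X M sk s \<longleftrightarrow>
     (\<forall>S\<in>X. whp c n M (\<lambda>\<omega>. real (length (sk \<omega> S)) \<le> s))"

(* Canonical sample space: every pair of randomized functions, on whatever probability space,
   has the same joint distribution as the coordinate maps fst, snd under some probability
   measure on this type, so existential statements lose nothing by fixing it. *)
type_synonym sketch_space =
  "(nat list \<Rightarrow> bool list) \<times> (bool list \<Rightarrow> bool list \<Rightarrow> int \<Rightarrow> real)"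

end

theory Submission
  imports Defs
begin

text \<open>
  Fix a scale \<open>r\<close> and let \<open>G\<close> be the set of near-periods of \<open>S\<close>, the shifts \<open>g\<close> for which \<open>S\<close> and
  \<open>cyc_pow g S\<close> differ in about \<open>r\<close> positions, up to logarithmic factors. Suppose that \<open>S\<close> and \<open>cyc_pow m T\<close> have
  at most \<open>r\<close> mismatches.

  If \<open>G\<close> has only about \<open>r\<close> elements, a locality sensitive predicate selects about \<open>r\<close> rotations of
  either string, mostly consistently, and each party keeps a random fraction \<open>1 / sqrt r\<close> of them. By
  the birthday paradox some kept rotation of \<open>S\<close> is aligned with a kept rotation of \<open>T\<close>, and an
  ordinary \<open>\<epsilon>\<^sup>-\<^sup>2\<close>-size Hamming sketch of both finishes the job.

  If \<open>G\<close> is larger, then at some threshold among logarithmically many the sets of near-periods grow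
  slowly, so they behave like a subgroup: taking at each position the majority symbol over all
  translates by \<open>G\<close> turns \<open>S\<close> and \<open>T\<close> into strings that agree exactly up to the shift \<open>m\<close>, and
  changes only about \<open>r\<close> positions. Agreement is tested on canonical rotations, and the few changed
  positions are compared by sampling them with rate about \<open>1 / (\<epsilon> sqrt r)\<close> on both sides.

  Trying \<open>r = 1, 2, 4, \<dots>\<close> gives size \<open>\<epsilon>\<^sup>-\<^sup>2 sqrt k\<close>. If \<open>k > \<epsilon> n\<close>, the scales above \<open>\<epsilon> n\<close> are
  handled by sampling positions of the strings themselves, at a cost of \<open>\<epsilon>\<^sup>-\<^sup>3\<^sup>/\<^sup>2 sqrt n\<close>.
\<close>

section \<open>Cyclic shifts and Hamming distance\<close>

text \<open>The encoders do not know the shift \<open>m\<close>, so samples of the two strings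
  cannot be lined up in advance: an aligned pair of positions is seen only if both sides keep it,
  which squares every sampling rate \<alpha>. Estimating a sum over N positions then has variance
  about N/\<alpha>^2. For N about r and error \<eta> r the rate is about 1/(\<eta> sqrt r), storing
  sqrt r/\<eta> positions. Sampling raw strings at the same rate stores n/(\<eta> sqrt r) positions,
  and r about \<epsilon> n gives \<epsilon>^(-3/2) sqrt n. The decoder knows neither the distance
  nor the number of near-periods nor the right threshold. Hence schemes may abstain: an answer must
  be reliable on all inputs, while case assumptions only bound the probability of abstaining.
  Schemes can then be tried one after another. Near-periods matter for anchors because nearly equal
  rotations tend to be selected together; their number bounds the size of such clusters, hence the
  second moment in the birthday argument. The size must not depend on \<sigma>, so symbols are
  hashed to an alphabet of size polynomial in n.\<close>

definition cnth :: "'a list \<Rightarrow> int \<Rightarrow> 'a" where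
  "cnth S i = S ! nat (i mod int (length S))"

text \<open>For negative \<open>m\<close>, let \<open>T\<close> be the claimed result. Then
  \<open>cyc_pow (- m) T\<close> is a forward rotation of \<open>S\<close> by a multiple of its
  length, hence \<open>S\<close>, and \<open>cyc_pow_neg_cancel\<close> carries this back, so that
  \<open>inv rotate1\<close> is never computed.\<close>

lemma cyc_pow_conv_rotate: "cyc_pow m S = rotate (nat (m mod int (length S))) S"
proof (cases "m \<ge> 0")
  case True
  then show ?thesis
    by (metis cyc_pow_def nat_int nat_mod_distrib of_nat_0_le_iff rotate_conv_mod rotate_def)
next
  case False
  define T where "T = rotate (nat (m mod int (length S))) S"
  have "cyc_pow (- m) T = rotate (nat (- m)) T"
    using False by (simp add: cyc_pow_def rotate_def)
  also have "\<dots> = rotate (nat (- m) + nat (m mod int (length S))) S"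
    by (simp add: T_def rotate_rotate)
  also have "\<dots> = S"
  proof (cases "S = []")
    case False
    then have "m mod int (length S) \<ge> 0" by simp
    then have "int (nat (- m) + nat (m mod int (length S))) = - m + m mod int (length S)"
      using \<open>\<not> m \<ge> 0\<close> by simp
    also have "\<dots> = int (length S) * (- (m div int (length S)))"
      using mult_div_mod_eq[of "int (length S)" m] unfolding mult_minus_right by linarith
    finally have "int (length S) dvd int (nat (- m) + nat (m mod int (length S)))"
      by (metis dvd_triv_left)
    then have "length S dvd nat (- m) + nat (m mod int (length S))"
      by (simp only: int_dvd_int_iff)
    then have "(nat (- m) + nat (m mod int (length S))) mod length S = 0"
      by (rule dvd_imp_mod_0)
    then show ?thesis by (rule rotate_id)
  qed simp
  finally have "cyc_pow m (cyc_pow (- m) T) = cyc_pow m S" by simp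
  then show ?thesis using cyc_pow_neg_cancel[of "- m" T] T_def by simp
qed

lemma length_cyc_pow [simp]: "length (cyc_pow m S) = length S"
  and set_cyc_pow [simp]: "set (cyc_pow m S) = set S"
  by (simp_all add: cyc_pow_conv_rotate)

lemma cnth_cyc_pow: 
  assumes "S \<noteq> []"
  shows "cnth (cyc_pow m S) i = cnth S (i + m)"
proof -
  let ?n = "int (length S)"
  have n: "?n > 0" using assms by simp
  have "int ((nat (m mod ?n) + nat (i mod ?n)) mod length S) = (m mod ?n + i mod ?n) mod ?n"
    using n by (simp add: zmod_int)
  also have "\<dots> = (i + m) mod ?n" by (simp add: mod_add_eq add.commute)
  finally have "(nat (m mod ?n) + nat (i mod ?n)) mod length S = nat ((i + m) mod ?n)" by linarith
  moreover have "nat (i mod ?n) < length S" using n by (simp add: nat_less_iff)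
  ultimately show ?thesis
    unfolding cnth_def cyc_pow_conv_rotate by (simp add: nth_rotate)
qed

lemma cnth_mod [simp]: "cnth S (i mod int (length S)) = cnth S i"
  by (simp add: cnth_def)

lemma nth_conv_cnth: "i < length S \<Longrightarrow> S ! i = cnth S (int i)"
  by (simp add: cnth_def)

lemma list_eq_iff_cnth:
  assumes "length S = length T"
  shows "S = T \<longleftrightarrow> (\<forall>i\<in>{0..<int (length S)}. cnth S i = cnth T i)"
proof
  assume *: "\<forall>i\<in>{0..<int (length S)}. cnth S i = cnth T i"
  show "S = T"
  proof (rule nth_equalityI)
    fix i assume "i < length S"
    then show "S ! i = T ! i" using *[rule_format, of "int i"] assms by (simp add: nth_conv_cnth)
  qed (rule assms)
qed simp

lemma cnth_in_set: "S \<noteq> [] \<Longrightarrow> cnth S i \<in> set S"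
  by (simp add: cnth_def nat_less_iff)

lemma cyc_pow_Nil [simp]: "cyc_pow m [] = []"
  by (simp add: cyc_pow_conv_rotate)

lemma cyc_pow_add: "cyc_pow a (cyc_pow b S) = cyc_pow (a + b) S"
proof (cases "S = []")
  case False
  then have "cyc_pow b S \<noteq> []" by (metis length_0_conv length_cyc_pow)
  then show ?thesis using False
    by (intro list_eq_iff_cnth[THEN iffD2]) (simp_all add: cnth_cyc_pow add_ac)
qed simp

lemma cyc_pow_0 [simp]: "cyc_pow 0 S = S"
  by (simp add: cyc_pow_def)

lemma cyc_pow_length_mult [simp]: "cyc_pow (int (length S) * j) S = S"
  by (simp add: cyc_pow_conv_rotate)

lemma cyc_pow_mod_length: "cyc_pow (m mod int (length S)) S = cyc_pow m S"
  by (simp add: cyc_pow_conv_rotate)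

lemma bij_betw_add_mod:
  assumes "n > 0"
  shows "bij_betw (\<lambda>i. (i + m) mod int n) {0..<int n} {0..<int n}"
proof (rule bij_betw_byWitness[where f' = "\<lambda>i. (i - m) mod int n"])
  show "\<forall>a\<in>{0..<int n}. ((a + m) mod int n - m) mod int n = a"
    by (simp add: mod_diff_left_eq)
  show "\<forall>a\<in>{0..<int n}. ((a - m) mod int n + m) mod int n = a"
    by (simp add: mod_add_left_eq)
qed (use assms in \<open>simp_all add: image_subset_iff\<close>)

lemma sum_shift_mod:
  assumes "n > 0"
  shows "(\<Sum>i\<in>{0..<int n}. F ((i + m) mod int n)) = (\<Sum>i\<in>{0..<int n}. F i)"
  using sum.reindex_bij_betw[OF bij_betw_add_mod[OF assms, of m], of F] .

section \<open>Mismatch sets and the Hamming metric\<close>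

definition mism :: "'a list \<Rightarrow> 'a list \<Rightarrow> int set" where
  "mism S T = {i\<in>{0..<int (length S)}. cnth S i \<noteq> cnth T i}"

lemma finite_mism [simp]: "finite (mism S T)"
  unfolding mism_def by (rule finite_Collect_conjI) simp

lemma Ham_eq_card_mism: 
  assumes "length S = length T"
  shows "Ham S T = card (mism S T)"
proof -
  have "mism S T = int ` {i. i < length S \<and> S ! i \<noteq> T ! i}"
  proof (intro equalityI subsetI)
    fix i assume i: "i \<in> mism S T"
    then have "i = int (nat i)" "nat i < length S" by (auto simp: mism_def)
    with i assms show "i \<in> int ` {i. i < length S \<and> S ! i \<noteq> T ! i}"
      by (intro image_eqI[of _ _ "nat i"]) (auto simp: mism_def nth_conv_cnth)
  next
    fix i assume "i \<in> int ` {i. i < length S \<and> S ! i \<noteq> T ! i}"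
    then show "i \<in> mism S T" using assms by (auto simp: mism_def cnth_def)
  qed
  then show ?thesis by (simp add: Ham_def card_image)
qed

lemma Ham_le_length:
  assumes "length S = length T"
  shows "Ham S T \<le> length S"
proof -
  have "card (mism S T) \<le> card {0..<int (length S)}"
    by (rule card_mono) (auto simp: mism_def)
  then show ?thesis using assms by (simp add: Ham_eq_card_mism)
qed

lemma Ham_eq_sum:
  assumes "length S = length T"
  shows "Ham S T = (\<Sum>i\<in>{0..<int (length S)}. if cnth S i \<noteq> cnth T i then 1 else 0)"
  unfolding Ham_eq_card_mism[OF assms] mism_def by (simp add: sum.If_cases Int_def)

lemma Ham_cyc_pow_cyc_pow:
  assumes "length S = length T"
  shows "Ham (cyc_pow m S) (cyc_pow m T) = Ham S T"
proof (cases "S = []")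
  case False
  then have n: "length S > 0" and "T \<noteq> []" using assms by auto
  have per: "cnth S (i mod int (length S)) = cnth S i" "cnth T (i mod int (length S)) = cnth T i" for i
    using assms by (simp_all add: cnth_def)
  show ?thesis
    using sum_shift_mod[OF n, of "\<lambda>i. if cnth S i \<noteq> cnth T i then (1::nat) else 0" m, unfolded per]
      assms False \<open>T \<noteq> []\<close>
    by (simp add: Ham_eq_sum cnth_cyc_pow)
qed (use assms in simp)

lemma Ham_comm: "length S = length T \<Longrightarrow> Ham S T = Ham T S"
  unfolding Ham_def by (rule arg_cong[of _ _ card]) auto

lemma Ham_triangle:
  assumes "length S = length T" "length T = length U"
  shows "Ham S U \<le> Ham S T + Ham T U"
proof -
  have "card (mism S U) \<le> card (mism S T \<union> mism T U)"
    using assms by (intro card_mono finite_UnI finite_mism) (auto simp: mism_def)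
  also have "\<dots> \<le> card (mism S T) + card (mism T U)" by (rule card_Un_le)
  finally show ?thesis using assms by (simp add: Ham_eq_card_mism)
qed

lemma strings_cyc_pow [simp]: "cyc_pow m S \<in> strings \<sigma> n \<longleftrightarrow> S \<in> strings \<sigma> n"
  by (simp add: strings_def)

lemma finite_strings [simp]: "finite (strings \<sigma> n)"
  unfolding strings_def using finite_lists_length_eq[of "{1..\<sigma>}" n] by (simp add: conj_commute)

lemma length_strings: "S \<in> strings \<sigma> n \<Longrightarrow> length S = n"
  by (simp add: strings_def)

lemma cnth_strings: "S \<in> strings \<sigma> n \<Longrightarrow> n > 0 \<Longrightarrow> cnth S i \<in> {1..\<sigma>}"
  using cnth_in_set[of S i] by (auto simp: strings_def)

section \<open>Finite probability\<close>

abbreviation pr :: "'w pmf \<Rightarrow> ('w \<Rightarrow> bool) \<Rightarrow> real" where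
  "pr P Q \<equiv> measure_pmf.prob P {w. Q w}"

abbreviation ex :: "'w pmf \<Rightarrow> ('w \<Rightarrow> real) \<Rightarrow> real" where
  "ex P f \<equiv> measure_pmf.expectation P f"

lemma pr_nonneg: "0 \<le> pr P Q"
  by simp

lemma pr_mono: "(\<And>w. w \<in> set_pmf P \<Longrightarrow> Q w \<Longrightarrow> Q' w) \<Longrightarrow> pr P Q \<le> pr P Q'"
  by (rule measure_pmf.finite_measure_mono_AE) (auto simp: AE_measure_pmf_iff)

lemma pr_cong: "(\<And>w. w \<in> set_pmf P \<Longrightarrow> Q w \<longleftrightarrow> Q' w) \<Longrightarrow> pr P Q = pr P Q'"
  by (intro antisym pr_mono) auto

lemma pr_eq_0: "(\<And>w. w \<in> set_pmf P \<Longrightarrow> \<not> Q w) \<Longrightarrow> pr P Q = 0"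
  using pr_cong[of P Q "\<lambda>_. False"] by simp

lemma pr_map: "pr (map_pmf g P) Q = pr P (\<lambda>w. Q (g w))"
  by (simp add: vimage_def)

lemma pr_not: "pr P (\<lambda>w. \<not> Q w) = 1 - pr P Q"
  using measure_pmf.prob_compl[of "{w. Q w}" P] by (simp add: Compl_eq_Diff_UNIV[symmetric] Collect_neg_eq)

lemma pr_disj: "pr P (\<lambda>w. Q w \<or> Q' w) \<le> pr P Q + pr P Q'"
  using measure_Un_le[of "{w. Q w}" "measure_pmf P" "{w. Q' w}"]
  by (simp add: Collect_disj_eq)

lemma pr_Bex:
  assumes "finite J"
  shows "pr P (\<lambda>w. \<exists>i\<in>J. Q i w) \<le> (\<Sum>i\<in>J. pr P (Q i))"
proof -
  have "{w. \<exists>i\<in>J. Q i w} = (\<Union>i\<in>J. {w. Q i w})" by auto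
  then show ?thesis
    using measure_pmf.finite_measure_subadditive_finite[of J "\<lambda>i. {w. Q i w}" P] assms by simp
qed

lemma pr_pair_eq: "pr (pair_pmf P Q) (\<lambda>(a, b). F a b) = ex P (\<lambda>a. pr Q (F a))"
proof -
  let ?E = "{w. case w of (a, b) \<Rightarrow> F a b}"
  have "ennreal (measure_pmf.prob (pair_pmf P Q) ?E) = (\<integral>\<^sup>+w. indicator ?E w \<partial>pair_pmf P Q)"
    by (simp add: measure_pmf.emeasure_eq_measure)
  also have "\<dots> = (\<integral>\<^sup>+a. \<integral>\<^sup>+b. indicator ?E (a, b) \<partial>Q \<partial>P)"
    by (rule nn_integral_pair_pmf')
  also have "\<dots> = (\<integral>\<^sup>+a. \<integral>\<^sup>+b. indicator {b. F a b} b \<partial>Q \<partial>P)"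
    by (intro nn_integral_cong) (simp add: indicator_def)
  also have "\<dots> = (\<integral>\<^sup>+a. ennreal (pr Q (F a)) \<partial>P)"
    by (simp add: measure_pmf.emeasure_eq_measure)
  also have "\<dots> = ennreal (ex P (\<lambda>a. pr Q (F a)))"
    by (intro nn_integral_eq_integral measure_pmf.integrable_const_bound[where B = 1]) auto
  finally show ?thesis by (subst (asm) ennreal_inj) auto
qed

lemma pr_pair_le:
  assumes "\<And>a. a \<in> set_pmf P \<Longrightarrow> pr Q (F a) \<le> \<delta>"
  shows "pr (pair_pmf P Q) (\<lambda>(a, b). F a b) \<le> \<delta>"
  unfolding pr_pair_eq
proof (rule measure_pmf.integral_le_const)
  show "integrable (measure_pmf P) (\<lambda>a. pr Q (F a))"
    by (rule measure_pmf.integrable_const_bound[where B = 1]) auto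
  show "AE a in measure_pmf P. pr Q (F a) \<le> \<delta>" using assms by (simp add: AE_measure_pmf_iff)
qed

lemma pr_pair_fst [simp]: "pr (pair_pmf P Q) (\<lambda>(a, b). F a) = pr P F"
  and pr_pair_snd [simp]: "pr (pair_pmf P Q) (\<lambda>(a, b). G b) = pr Q G"
  using pr_map[of fst "pair_pmf P Q" F] pr_map[of snd "pair_pmf P Q" G]
  by (simp_all add: map_fst_pair_pmf map_snd_pair_pmf split_def)

lemma pr_pair_conj: "pr (pair_pmf P Q) (\<lambda>(a, b). F a \<and> G b) = pr P F * pr Q G"
proof -
  have "pr Q (\<lambda>b. F a \<and> G b) = pr Q G * indicator {a. F a} a" for a
    by (cases "F a") simp_all
  then show ?thesis unfolding pr_pair_eq by simp
qed

lemma pr_Pi_pmf_Ball: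
  assumes "finite U" "J \<subseteq> U"
  shows "pr (Pi_pmf U d p) (\<lambda>f. \<forall>i\<in>J. B i (f i)) = (\<Prod>i\<in>J. pr (p i) (B i))"
proof -
  define B' where "B' i = (if i \<in> J then {a. B i a} else UNIV)" for i
  have "{f. \<forall>i\<in>J. B i (f i)} = Pi U B'" using assms(2) by (auto simp: B'_def Pi_def)
  then have "pr (Pi_pmf U d p) (\<lambda>f. \<forall>i\<in>J. B i (f i)) = (\<Prod>i\<in>U. measure_pmf.prob (p i) (B' i))"
    using measure_Pi_pmf_Pi[OF assms(1)] by simp
  also have "\<dots> = (\<Prod>i\<in>J. measure_pmf.prob (p i) (B' i))"
    using assms by (intro prod.mono_neutral_right) (auto simp: B'_def)
  finally show ?thesis by (simp add: B'_def)
qed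

lemma finite_set_Pi_pmf:
  assumes "finite U" "\<And>i. i \<in> U \<Longrightarrow> finite (set_pmf (p i))"
  shows "finite (set_pmf (Pi_pmf U d p))"
  unfolding set_Pi_pmf[OF assms(1)] using assms by (intro finite_PiE_dflt) auto

lemma ex_indicator: "ex P (\<lambda>w. if Q w then 1 else 0) = pr P Q"
proof -
  have "ex P (\<lambda>w. if Q w then 1 else 0) = ex P (indicator {w. Q w})"
    by (intro Bochner_Integration.integral_cong) (auto simp: indicator_def)
  then show ?thesis by simp
qed

lemma ex_mono:
  assumes "finite (set_pmf P)" "\<And>w. w \<in> set_pmf P \<Longrightarrow> f w \<le> g w"
  shows "ex P f \<le> ex P g"
  using assms by (intro integral_mono_AE integrable_measure_pmf_finite) (auto simp: AE_measure_pmf_iff)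

lemma ex_sum:
  assumes "finite (set_pmf P)"
  shows "ex P (\<lambda>w. \<Sum>i\<in>J. f i w) = (\<Sum>i\<in>J. ex P (f i))"
  using assms by (intro Bochner_Integration.integral_sum integrable_measure_pmf_finite)

section \<open>Moment inequalities\<close>

lemma pr_markov:
  assumes "finite (set_pmf P)" "\<And>w. 0 \<le> f w" "a > 0"
  shows "pr P (\<lambda>w. f w > a) \<le> ex P f / a"
proof -
  have "a * pr P (\<lambda>w. f w > a) = ex P (\<lambda>w. a * (if f w > a then 1 else 0))"
    by (simp add: ex_indicator)
  also have "\<dots> \<le> ex P f" using assms by (intro ex_mono) (auto simp: less_imp_le)
  finally show ?thesis using assms by (simp add: field_simps)
qed

text \<open>A product \<open>c * \<tau>\<^sup>2\<close> in place of a quotient covers \<tau> = 0: in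
  the tug-of-war estimate the tolerance is a multiple of the Hamming distance, and distance 0 must
  be found exactly. A vanishing second moment makes \<open>f\<close> zero almost surely.\<close>

lemma pr_chebyshev:
  assumes "finite (set_pmf P)" "\<tau> \<ge> 0" "ex P (\<lambda>w. (f w)\<^sup>2) \<le> c * \<tau>\<^sup>2" "c \<ge> 0"
  shows "pr P (\<lambda>w. \<bar>f w\<bar> > \<tau>) \<le> c"
proof (cases "\<tau> = 0")
  case True
  then have "ex P (\<lambda>w. (f w)\<^sup>2) \<le> 0" using assms by simp
  then have "ex P (\<lambda>w. (f w)\<^sup>2) = 0" by (intro antisym) auto
  then have "AE w in measure_pmf P. (f w)\<^sup>2 = 0"
    using integral_nonneg_eq_0_iff_AE[of "measure_pmf P" "\<lambda>w. (f w)\<^sup>2"] assms(1)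
    by (simp add: integrable_measure_pmf_finite)
  then show ?thesis using True assms(4) pr_eq_0[of P "\<lambda>w. \<bar>f w\<bar> > \<tau>"]
    by (simp add: AE_measure_pmf_iff)
next
  case False
  then have "\<tau>\<^sup>2 > 0" by simp
  have "pr P (\<lambda>w. \<bar>f w\<bar> > \<tau>) \<le> pr P (\<lambda>w. (f w)\<^sup>2 > \<tau>\<^sup>2)"
    using assms(2) by (intro pr_mono) (metis abs_le_square_iff abs_of_nonneg not_le)
  also have "\<dots> \<le> ex P (\<lambda>w. (f w)\<^sup>2) / \<tau>\<^sup>2"
    using assms \<open>\<tau>\<^sup>2 > 0\<close> by (intro pr_markov) auto
  also have "\<dots> \<le> c" using assms(3) \<open>\<tau>\<^sup>2 > 0\<close> by (simp add: field_simps)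
  finally show ?thesis .
qed

lemma pr_card_markov:
  assumes "finite (set_pmf P)" "finite J" "a > 0"
  shows "pr P (\<lambda>w. real (card {i\<in>J. Q i w}) > a) \<le> (\<Sum>i\<in>J. pr P (Q i)) / a"
proof -
  have "real (card {i\<in>J. Q i w}) = (\<Sum>i\<in>J. if Q i w then 1 else 0)" for w
    using assms(2) by (simp add: sum.If_cases Int_def)
  then show ?thesis
    using pr_markov[OF assms(1), of "\<lambda>w. \<Sum>i\<in>J. if Q i w then 1 else 0" a] assms(3)
    by (simp add: ex_sum[OF assms(1)] ex_indicator sum_nonneg)
qed

text \<open>The pointwise inequality \<open>1 \<ge> 2 c Y - c\<^sup>2 Y\<^sup>2\<close> for the number \<open>Y\<close> of events that occur.\<close>

lemma pr_Bex_second_moment: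
  assumes "finite (set_pmf P)" "finite J"
  shows "pr P (\<lambda>w. \<exists>i\<in>J. Q i w) \<ge>
    2 * c * (\<Sum>i\<in>J. pr P (Q i)) - c\<^sup>2 * (\<Sum>i\<in>J. \<Sum>j\<in>J. pr P (\<lambda>w. Q i w \<and> Q j w))"
proof -
  define Y where "Y w = (\<Sum>i\<in>J. if Q i w then 1 else (0::real))" for w
  have int: "integrable (measure_pmf P) f" for f :: "_ \<Rightarrow> real"
    using assms(1) by (rule integrable_measure_pmf_finite)
  have Y2: "(Y w)\<^sup>2 = (\<Sum>i\<in>J. \<Sum>j\<in>J. if Q i w \<and> Q j w then 1 else 0)" for w
    unfolding Y_def power2_eq_square sum_product by (intro sum.cong refl) auto
  have "ex P Y = (\<Sum>i\<in>J. pr P (Q i))"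
    unfolding Y_def by (simp add: ex_sum[OF assms(1)] ex_indicator)
  moreover have "ex P (\<lambda>w. (Y w)\<^sup>2) = (\<Sum>i\<in>J. \<Sum>j\<in>J. pr P (\<lambda>w. Q i w \<and> Q j w))"
    unfolding Y2 by (simp add: ex_sum[OF assms(1)] ex_indicator)
  ultimately have "2 * c * (\<Sum>i\<in>J. pr P (Q i)) - c\<^sup>2 * (\<Sum>i\<in>J. \<Sum>j\<in>J. pr P (\<lambda>w. Q i w \<and> Q j w))
    = 2 * c * ex P Y - c\<^sup>2 * ex P (\<lambda>w. (Y w)\<^sup>2)"
    by simp
  also have "\<dots> = ex P (\<lambda>w. 2 * c * Y w - c\<^sup>2 * (Y w)\<^sup>2)"
    using int by simp
  also have "\<dots> \<le> ex P (\<lambda>w. if \<exists>i\<in>J. Q i w then 1 else 0)"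
  proof (intro ex_mono[OF assms(1)])
    fix w
    have "0 \<le> (1 - c * Y w)\<^sup>2" by simp
    then have "2 * c * Y w - c\<^sup>2 * (Y w)\<^sup>2 \<le> 1"
      by (simp add: power2_eq_square algebra_simps)
    moreover have "Y w = 0" if "\<not> (\<exists>i\<in>J. Q i w)"
      using that by (auto simp: Y_def intro!: sum.neutral)
    ultimately show "2 * c * Y w - c\<^sup>2 * (Y w)\<^sup>2 \<le> (if \<exists>i\<in>J. Q i w then 1 else 0)" by auto
  qed
  finally show ?thesis by (simp add: ex_indicator)
qed

text \<open>At most 2^L index sets contain at least half of the L copies, and all copies in such a
  set are bad with probability at most (1/16)^(L/2) = (1/4)^L. This is why basic estimators are
  required to have error 1/16.\<close>

lemma pr_majority_bad:
  assumes "\<And>j. j < L \<Longrightarrow> pr P bad \<le> 1/16"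
  shows "pr (Pi_pmf {..<L} d (\<lambda>_. P)) (\<lambda>\<omega>. 2 * card {j. j < L \<and> bad (\<omega> j)} \<ge> L) \<le> (1/2) ^ L"
proof -
  define \<J> where "\<J> = {J. J \<subseteq> {..<L} \<and> 2 * card J \<ge> L}"
  have fin: "finite \<J>" by (rule finite_subset[of _ "Pow {..<L}"]) (auto simp: \<J>_def)
  have "card \<J> \<le> card (Pow {..<L})" by (rule card_mono) (auto simp: \<J>_def)
  then have card: "card \<J> \<le> 2 ^ L" by (simp add: card_Pow)
  have "pr (Pi_pmf {..<L} d (\<lambda>_. P)) (\<lambda>\<omega>. 2 * card {j. j < L \<and> bad (\<omega> j)} \<ge> L)
    \<le> pr (Pi_pmf {..<L} d (\<lambda>_. P)) (\<lambda>\<omega>. \<exists>J\<in>\<J>. \<forall>j\<in>J. bad (\<omega> j))"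
    by (intro pr_mono) (auto simp: \<J>_def intro!: exI[of _ "{j. j < L \<and> bad (_ j)}"])
  also have "\<dots> \<le> (\<Sum>J\<in>\<J>. pr (Pi_pmf {..<L} d (\<lambda>_. P)) (\<lambda>\<omega>. \<forall>j\<in>J. bad (\<omega> j)))"
    by (rule pr_Bex[OF fin])
  also have "\<dots> \<le> (\<Sum>J\<in>\<J>. (1/4) ^ L)"
  proof (rule sum_mono)
    fix J assume J: "J \<in> \<J>"
    then have "pr (Pi_pmf {..<L} d (\<lambda>_. P)) (\<lambda>\<omega>. \<forall>j\<in>J. bad (\<omega> j)) = pr P bad ^ card J"
      by (subst pr_Pi_pmf_Ball) (auto simp: \<J>_def)
    also have "\<dots> \<le> (1/16) ^ card J"
    proof (cases "L = 0")
      case True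
      then have "J = {}" using J by (auto simp: \<J>_def)
      then show ?thesis by simp
    qed (use assms[of 0] in \<open>auto intro!: power_mono\<close>)
    also have "\<dots> = (1/4) ^ (2 * card J)" by (simp add: power_mult power2_eq_square)
    also have "\<dots> \<le> (1/4) ^ L" using J by (intro power_decreasing) (auto simp: \<J>_def)
    finally show "pr (Pi_pmf {..<L} d (\<lambda>_. P)) (\<lambda>\<omega>. \<forall>j\<in>J. bad (\<omega> j)) \<le> (1/4) ^ L" .
  qed
  also have "\<dots> = real (card \<J>) * (1/4) ^ L" by simp
  also have "\<dots> \<le> 2 ^ L * (1/4) ^ L"
    using card by (intro mult_right_mono) (auto simp flip: of_nat_le_iff)
  also have "\<dots> = (1/2) ^ L" by (simp flip: power_mult_distrib)
  finally show ?thesis .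
qed

definition median :: "nat \<Rightarrow> (nat \<Rightarrow> real) \<Rightarrow> real" where
  "median L v = (SOME z. L \<le> 2 * card {j. j < L \<and> v j \<le> z} \<and> L \<le> 2 * card {j. j < L \<and> v j \<ge> z})"

text \<open>With fewer than half of the values outside, neither ray beyond an endpoint contains half
  of them, so every median lies inside. Most of the proof shows that a median exists.\<close>

lemma median_in_interval:
  assumes "2 * card {j. j < L \<and> v j \<notin> {a..b}} < L"
  shows "median L v \<in> {a..b}"
proof -
  define good where "good z \<longleftrightarrow> L \<le> 2 * card {j. j < L \<and> v j \<le> z}" for z
  have L: "L > 0" using assms by auto
  \<comment> \<open>The least sample value with at least half of the values at or below it is a
    median: otherwise more than half would lie strictly below it, and the largest of those would be
    a smaller candidate.\<close>
  define Z where "Z = {z \<in> v ` {..<L}. good z}"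
  have fin: "finite Z" by (simp add: Z_def)
  have "{j. j < L \<and> v j \<le> Max (v ` {..<L})} = {..<L}" by auto
  then have "Max (v ` {..<L}) \<in> Z" using L by (auto simp: Z_def good_def intro!: Max_in)
  then have ne: "Z \<noteq> {}" by auto
  define z where "z = Min Z"
  have z: "z \<in> Z" using Min_in[OF fin ne] z_def by simp
  have "L \<le> 2 * card {j. j < L \<and> v j \<ge> z}"
  proof (rule ccontr)
    assume *: "\<not> ?thesis"
    have "card {j. j < L \<and> v j \<ge> z} + card {j. j < L \<and> v j < z} = card {..<L}"
      by (subst card_Un_disjoint[symmetric]) (auto intro!: arg_cong[of _ "{..<L}" card] simp del: card_lessThan)
    then have c: "2 * card {j. j < L \<and> v j < z} > L" using * by simp
    then have "{j. j < L \<and> v j < z} \<noteq> {}" by (metis card.empty mult_0_right not_less0)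
    then have ne': "v ` {j. j < L \<and> v j < z} \<noteq> {}" by auto
    define y where "y = Max (v ` {j. j < L \<and> v j < z})"
    have y: "y \<in> v ` {j. j < L \<and> v j < z}" using ne' unfolding y_def by (intro Max_in) auto
    have "{j. j < L \<and> v j < z} \<subseteq> {j. j < L \<and> v j \<le> y}" unfolding y_def by (auto intro!: Max_ge)
    then have "card {j. j < L \<and> v j < z} \<le> card {j. j < L \<and> v j \<le> y}" by (intro card_mono) auto
    then have "good y" using c by (simp add: good_def)
    then have "y \<in> Z" "y < z" using y by (auto simp: Z_def)
    then show False using Min_le[OF fin, of y] z_def by simp
  qed
  then have ex: "\<exists>z. L \<le> 2 * card {j. j < L \<and> v j \<le> z} \<and> L \<le> 2 * card {j. j < L \<and> v j \<ge> z}"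
    using z by (auto simp: Z_def good_def)
  have out: "2 * card A < L" if "A \<subseteq> {j. j < L \<and> v j \<notin> {a..b}}" for A
    using card_mono[OF _ that] assms by simp
  have med: "L \<le> 2 * card {j. j < L \<and> v j \<le> median L v}" "L \<le> 2 * card {j. j < L \<and> v j \<ge> median L v}"
    using someI_ex[OF ex] unfolding median_def by auto
  have "\<not> median L v < a"
  proof
    assume "median L v < a"
    then have "{j. j < L \<and> v j \<le> median L v} \<subseteq> {j. j < L \<and> v j \<notin> {a..b}}" by auto
    from out[OF this] med(1) show False by simp
  qed
  moreover have "\<not> median L v > b"
  proof
    assume "median L v > b"
    then have "{j. j < L \<and> v j \<ge> median L v} \<subseteq> {j. j < L \<and> v j \<notin> {a..b}}" by auto
    from out[OF this] med(2) show False by simp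
  qed
  ultimately show ?thesis by simp
qed

section \<open>Sketching schemes with abstention\<close>

type_synonym 'a sketcher = "('a \<Rightarrow> nat) \<times> (nat \<Rightarrow> nat \<Rightarrow> int \<Rightarrow> real option)"

definition answer :: "'a sketcher \<Rightarrow> 'a \<Rightarrow> 'a \<Rightarrow> int \<Rightarrow> real option" where
  "answer w x y m = snd w (fst w x) (fst w y) m"

text \<open>Messages of \<open>b\<close> bits are numbers below \<open>2 ^ b\<close>. The decoder may abstain: an answer is wrong
  (not \<open>ok\<close>) with probability at most \<open>\<delta>\<close>, and under the condition \<open>C\<close> the decoder abstains with
  probability at most \<open>\<phi>\<close>.\<close>

definition realizes :: "'a sketcher pmf \<Rightarrow> 'a set \<Rightarrow> nat \<Rightarrow> ('a \<Rightarrow> 'a \<Rightarrow> int \<Rightarrow> real \<Rightarrow> bool) \<Rightarrow> real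
    \<Rightarrow> ('a \<Rightarrow> 'a \<Rightarrow> int \<Rightarrow> bool) \<Rightarrow> real \<Rightarrow> bool" where
  "realizes P X b ok \<delta> C \<phi> \<longleftrightarrow>
     (\<forall>w\<in>set_pmf P. \<forall>x\<in>X. fst w x < 2 ^ b) \<and>
     (\<forall>x\<in>X. \<forall>y\<in>X. \<forall>m. pr P (\<lambda>w. \<exists>v. answer w x y m = Some v \<and> \<not> ok x y m v) \<le> \<delta>) \<and>
     (\<forall>x\<in>X. \<forall>y\<in>X. \<forall>m. C x y m \<longrightarrow> pr P (\<lambda>w. answer w x y m = None) \<le> \<phi>)"

definition acs :: "'a set \<Rightarrow> nat \<Rightarrow> ('a \<Rightarrow> 'a \<Rightarrow> int \<Rightarrow> real \<Rightarrow> bool) \<Rightarrow> real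
    \<Rightarrow> ('a \<Rightarrow> 'a \<Rightarrow> int \<Rightarrow> bool) \<Rightarrow> real \<Rightarrow> bool" where
  "acs X b ok \<delta> C \<phi> \<longleftrightarrow> (\<exists>P. realizes P X b ok \<delta> C \<phi>)"

lemma realizesD:
  assumes "realizes P X b ok \<delta> C \<phi>"
  shows "\<And>w x. w \<in> set_pmf P \<Longrightarrow> x \<in> X \<Longrightarrow> fst w x < 2 ^ b"
    and "\<And>x y m. x \<in> X \<Longrightarrow> y \<in> X \<Longrightarrow> pr P (\<lambda>w. \<exists>v. answer w x y m = Some v \<and> \<not> ok x y m v) \<le> \<delta>"
    and "\<And>x y m. x \<in> X \<Longrightarrow> y \<in> X \<Longrightarrow> C x y m \<Longrightarrow> pr P (\<lambda>w. answer w x y m = None) \<le> \<phi>"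
  using assms unfolding realizes_def by blast+

text \<open>An estimator is a scheme that never abstains.\<close>

lemma estimatorD:
  assumes "realizes P X b ok \<delta> (\<lambda>_ _ _. True) 0" "x \<in> X" "y \<in> X"
  shows "pr P (\<lambda>w. \<not> ok x y m (the (answer w x y m))) \<le> \<delta>"
proof -
  have "pr P (\<lambda>w. \<not> ok x y m (the (answer w x y m)))
    \<le> pr P (\<lambda>w. (\<exists>v. answer w x y m = Some v \<and> \<not> ok x y m v) \<or> answer w x y m = None)"
    by (intro pr_mono) auto
  also have "\<dots> \<le> pr P (\<lambda>w. \<exists>v. answer w x y m = Some v \<and> \<not> ok x y m v) + pr P (\<lambda>w. answer w x y m = None)"
    by (rule pr_disj)
  also have "\<dots> \<le> \<delta> + 0"
    using realizesD(2)[OF assms(1-3)] realizesD(3)[OF assms(1-3)] by (intro add_mono) auto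
  finally show ?thesis by simp
qed

text \<open>Lets a scheme be described with its own randomness and message type: only the number of
  possible messages counts, since a bijection turns them into numbers.\<close>

lemma acsI:
  fixes f :: "'w \<Rightarrow> 'a \<Rightarrow> 'm" and dec :: "'w \<Rightarrow> 'm \<Rightarrow> 'm \<Rightarrow> int \<Rightarrow> real option"
  assumes V: "finite V" "card V \<le> 2 ^ b"
    and f: "\<And>w x. w \<in> set_pmf P \<Longrightarrow> x \<in> X \<Longrightarrow> f w x \<in> V"
    and val: "\<And>x y m. x \<in> X \<Longrightarrow> y \<in> X \<Longrightarrow>
      pr P (\<lambda>w. \<exists>v. dec w (f w x) (f w y) m = Some v \<and> \<not> ok x y m v) \<le> \<delta>"
    and comp: "\<And>x y m. x \<in> X \<Longrightarrow> y \<in> X \<Longrightarrow> C x y m \<Longrightarrow>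
      pr P (\<lambda>w. dec w (f w x) (f w y) m = None) \<le> \<phi>"
  shows "acs X b ok \<delta> C \<phi>"
proof -
  obtain e where e: "bij_betw e V {0..<card V}" using ex_bij_betw_finite_nat[OF V(1)] by blast
  define g where "g w = (e \<circ> f w, \<lambda>a c m. dec w (inv_into V e a) (inv_into V e c) m)" for w
  have ans: "answer (g w) x y m = dec w (f w x) (f w y) m"
    if "w \<in> set_pmf P" "x \<in> X" "y \<in> X" for w x y m
    using that e f by (simp add: answer_def g_def bij_betw_def)
  show ?thesis unfolding acs_def realizes_def
  proof (intro exI[of _ "map_pmf g P"] conjI ballI allI impI)
    fix w x assume "w \<in> set_pmf (map_pmf g P)" "x \<in> X"
    then obtain w' where "w = g w'" "w' \<in> set_pmf P" by auto
    with \<open>x \<in> X\<close> have "fst w x \<in> {0..<card V}"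
      using e f by (auto simp: g_def bij_betw_def)
    with V(2) show "fst w x < 2 ^ b" by simp
  next
    fix x y m assume xy: "x \<in> X" "y \<in> X"
    have "pr (map_pmf g P) (\<lambda>w. \<exists>v. answer w x y m = Some v \<and> \<not> ok x y m v)
      = pr P (\<lambda>w. \<exists>v. dec w (f w x) (f w y) m = Some v \<and> \<not> ok x y m v)"
      unfolding pr_map using xy ans by (intro pr_cong) auto
    also have "\<dots> \<le> \<delta>" by (rule val[OF xy])
    finally show "pr (map_pmf g P) (\<lambda>w. \<exists>v. answer w x y m = Some v \<and> \<not> ok x y m v) \<le> \<delta>" .
    assume C: "C x y m"
    have "pr (map_pmf g P) (\<lambda>w. answer w x y m = None) = pr P (\<lambda>w. dec w (f w x) (f w y) m = None)"
      unfolding pr_map using xy ans by (intro pr_cong) auto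
    also have "\<dots> \<le> \<phi>" by (rule comp[OF xy C])
    finally show "pr (map_pmf g P) (\<lambda>w. answer w x y m = None) \<le> \<phi>" .
  qed
qed

lemma acs_mono:
  assumes "acs X b ok \<delta> C \<phi>" "b \<le> b'" "\<delta> \<le> \<delta>'" "\<phi> \<le> \<phi>'"
    and "\<And>x y m v. x \<in> X \<Longrightarrow> y \<in> X \<Longrightarrow> ok x y m v \<Longrightarrow> ok' x y m v"
    and "\<And>x y m. x \<in> X \<Longrightarrow> y \<in> X \<Longrightarrow> C' x y m \<Longrightarrow> C x y m"
  shows "acs X b' ok' \<delta>' C' \<phi>'"
proof -
  from assms(1) obtain P where P': "realizes P X b ok \<delta> C \<phi>" unfolding acs_def by blast
  note P = realizesD[OF P']
  show ?thesis unfolding acs_def realizes_def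
  proof (intro exI[of _ P] conjI ballI allI impI)
    fix w x assume "w \<in> set_pmf P" "x \<in> X"
    then have "fst w x < 2 ^ b" by (rule P)
    also have "(2::nat) ^ b \<le> 2 ^ b'" using assms(2) by (intro power_increasing) auto
    finally show "fst w x < 2 ^ b'" .
  next
    fix x y m assume xy: "x \<in> X" "y \<in> X"
    have "pr P (\<lambda>w. \<exists>v. answer w x y m = Some v \<and> \<not> ok' x y m v)
      \<le> pr P (\<lambda>w. \<exists>v. answer w x y m = Some v \<and> \<not> ok x y m v)"
      using assms(5) xy by (intro pr_mono) blast
    also have "\<dots> \<le> \<delta>'" using P(2)[OF xy, of m] assms(3) by linarith
    finally show "pr P (\<lambda>w. \<exists>v. answer w x y m = Some v \<and> \<not> ok' x y m v) \<le> \<delta>'" .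
    show "pr P (\<lambda>w. answer w x y m = None) \<le> \<phi>'" if "C' x y m"
      using P(3)[OF xy, of m] assms(6)[OF xy that] assms(4) by linarith
  qed
qed

text \<open>The second scheme is consulted when the first abstains, with independent randomness, so
  abstention probabilities multiply. On inputs where the first scheme is known to answer, an answer
  of the second may violate \<open>ok\<close>: it is consulted there with probability at most
  \<psi>, which is added to the error. This allows scales to be tried in increasing order.\<close>

lemma acs_orelse:
  assumes "acs X b\<^sub>1 ok\<^sub>1 \<delta>\<^sub>1 C\<^sub>1 \<phi>\<^sub>1" "acs X b\<^sub>2 ok\<^sub>2 \<delta>\<^sub>2 C\<^sub>2 \<phi>\<^sub>2"
    and ok\<^sub>1: "\<And>x y m v. x \<in> X \<Longrightarrow> y \<in> X \<Longrightarrow> ok\<^sub>1 x y m v \<Longrightarrow> ok x y m v"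
    and ok\<^sub>2: "\<And>x y m v. x \<in> X \<Longrightarrow> y \<in> X \<Longrightarrow> ok\<^sub>2 x y m v \<Longrightarrow> ok x y m v \<or> C\<^sub>1 x y m \<and> \<phi>\<^sub>1 \<le> \<psi>"
    and C: "\<And>x y m. x \<in> X \<Longrightarrow> y \<in> X \<Longrightarrow> C x y m \<Longrightarrow>
      C\<^sub>1 x y m \<and> C\<^sub>2 x y m \<and> \<phi>\<^sub>1 * \<phi>\<^sub>2 \<le> \<phi> \<or> C\<^sub>1 x y m \<and> \<phi>\<^sub>1 \<le> \<phi> \<or> C\<^sub>2 x y m \<and> \<phi>\<^sub>2 \<le> \<phi>"
    and "\<psi> \<ge> 0" "\<delta> = \<delta>\<^sub>1 + \<delta>\<^sub>2 + \<psi>"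
  shows "acs X (b\<^sub>1 + b\<^sub>2) ok \<delta> C \<phi>"
proof -
  from assms(1) obtain P where P': "realizes P X b\<^sub>1 ok\<^sub>1 \<delta>\<^sub>1 C\<^sub>1 \<phi>\<^sub>1" unfolding acs_def by blast
  note P = realizesD[OF P']
  from assms(2) obtain Q where Q': "realizes Q X b\<^sub>2 ok\<^sub>2 \<delta>\<^sub>2 C\<^sub>2 \<phi>\<^sub>2" unfolding acs_def by blast
  note Q = realizesD[OF Q']
  define f where "f = (\<lambda>(w :: 'a sketcher, w' :: 'a sketcher) x. (fst w x, fst w' x))"
  define dec where "dec = (\<lambda>(w :: 'a sketcher, w' :: 'a sketcher) (a, a') (c, c') m.
    case snd w a c m of Some v \<Rightarrow> Some v | None \<Rightarrow> snd w' a' c' m)"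
  have ans: "dec w (f w x) (f w y) m =
    (case answer (fst w) x y m of Some v \<Rightarrow> Some v | None \<Rightarrow> answer (snd w) x y m)" for w x y m
    by (auto simp: dec_def f_def answer_def split_def split: option.split)
  show ?thesis
  proof (rule acsI[where P = "pair_pmf P Q" and V = "{..<2 ^ b\<^sub>1} \<times> {..<2 ^ b\<^sub>2}" and f = f and dec = dec])
    show "card ({..<2 ^ b\<^sub>1} \<times> {..<2 ^ b\<^sub>2} :: (nat \<times> nat) set) \<le> 2 ^ (b\<^sub>1 + b\<^sub>2)"
      by (simp add: power_add)
    show "f w x \<in> {..<2 ^ b\<^sub>1} \<times> {..<2 ^ b\<^sub>2}" if "w \<in> set_pmf (pair_pmf P Q)" "x \<in> X" for w x
      using that P(1) Q(1) by (auto simp: f_def)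
  next
    fix x y m assume xy: "x \<in> X" "y \<in> X"
    define bad\<^sub>1 where "bad\<^sub>1 w \<longleftrightarrow> (\<exists>v. answer w x y m = Some v \<and> \<not> ok\<^sub>1 x y m v)" for w
    define bad\<^sub>2 where "bad\<^sub>2 w \<longleftrightarrow> (\<exists>v. answer w x y m = Some v \<and> \<not> ok\<^sub>2 x y m v)" for w
    define none where "none w \<longleftrightarrow> answer w x y m = None \<and> C\<^sub>1 x y m \<and> \<phi>\<^sub>1 \<le> \<psi>" for w
    have none: "pr P none \<le> \<psi>"
      using P(3)[OF xy, of m] assms(6) by (cases "C\<^sub>1 x y m \<and> \<phi>\<^sub>1 \<le> \<psi>") (auto simp: none_def)
    have "pr (pair_pmf P Q) (\<lambda>w. \<exists>v. dec w (f w x) (f w y) m = Some v \<and> \<not> ok x y m v)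
      \<le> pr (pair_pmf P Q) (\<lambda>w. (case w of (w, w') \<Rightarrow> bad\<^sub>1 w) \<or> (case w of (w, w') \<Rightarrow> bad\<^sub>2 w')
          \<or> (case w of (w, w') \<Rightarrow> none w))"
      using ok\<^sub>1[OF xy] ok\<^sub>2[OF xy] unfolding ans
      by (intro pr_mono) (fastforce simp: bad\<^sub>1_def bad\<^sub>2_def none_def split: option.splits)
    also have "\<dots> \<le> pr (pair_pmf P Q) (\<lambda>w. case w of (w, w') \<Rightarrow> bad\<^sub>1 w)
      + (pr (pair_pmf P Q) (\<lambda>w. case w of (w, w') \<Rightarrow> bad\<^sub>2 w')
      + pr (pair_pmf P Q) (\<lambda>w. case w of (w, w') \<Rightarrow> none w))"
      by (rule order_trans[OF pr_disj add_left_mono[OF pr_disj]])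
    also have "\<dots> = pr P bad\<^sub>1 + (pr Q bad\<^sub>2 + pr P none)"
      by (simp only: pr_pair_fst pr_pair_snd)
    also have "\<dots> \<le> \<delta>"
      using P(2)[OF xy, of m] Q(2)[OF xy, of m] none assms(7) by (simp add: bad\<^sub>1_def bad\<^sub>2_def)
    finally show "pr (pair_pmf P Q) (\<lambda>w. \<exists>v. dec w (f w x) (f w y) m = Some v \<and> \<not> ok x y m v) \<le> \<delta>" .
  next
    fix x y m assume xy: "x \<in> X" "y \<in> X" and Cxy: "C x y m"
    have "pr (pair_pmf P Q) (\<lambda>w. dec w (f w x) (f w y) m = None)
      = pr (pair_pmf P Q) (\<lambda>(w, w'). answer w x y m = None \<and> answer w' x y m = None)"
      unfolding ans by (intro pr_cong) (auto split: option.splits)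
    also have "\<dots> = pr P (\<lambda>w. answer w x y m = None) * pr Q (\<lambda>w. answer w x y m = None)"
      (is "_ = ?p * ?q") by (rule pr_pair_conj)
    also have "\<dots> \<le> \<phi>"
      using C[OF xy Cxy]
    proof (elim disjE conjE)
      assume c: "C\<^sub>1 x y m" "C\<^sub>2 x y m" "\<phi>\<^sub>1 * \<phi>\<^sub>2 \<le> \<phi>"
      have "?p \<le> \<phi>\<^sub>1" "?q \<le> \<phi>\<^sub>2" using P(3)[OF xy c(1)] Q(3)[OF xy c(2)] by auto
      then have "?p * ?q \<le> \<phi>\<^sub>1 * \<phi>\<^sub>2" by (intro mult_mono) (auto intro: order_trans[OF pr_nonneg])
      with c(3) show ?thesis by simp
    next
      assume c: "C\<^sub>1 x y m" "\<phi>\<^sub>1 \<le> \<phi>"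
      have "?p * ?q \<le> ?p * 1" by (intro mult_left_mono) auto
      then show ?thesis using P(3)[OF xy c(1)] c(2) by simp
    next
      assume c: "C\<^sub>2 x y m" "\<phi>\<^sub>2 \<le> \<phi>"
      have "?p * ?q \<le> 1 * ?q" by (intro mult_right_mono) auto
      then show ?thesis using Q(3)[OF xy c(1)] c(2) by simp
    qed
    finally show "pr (pair_pmf P Q) (\<lambda>w. dec w (f w x) (f w y) m = None) \<le> \<phi>" .
  qed simp
qed

lemma acs_abstain:
  assumes "\<And>x y m. x \<in> X \<Longrightarrow> y \<in> X \<Longrightarrow> C x y m \<Longrightarrow> 1 \<le> \<phi>"
  shows "acs X 0 ok 0 C \<phi>"
  by (rule acsI[where P = "return_pmf ()" and V = "{()}" and f = "\<lambda>_ _. ()" and dec = "\<lambda>_ _ _ _. None"])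
     (use assms in auto)

lemma acs_repeat:
  assumes "acs X b ok \<delta> C \<phi>"
  shows "acs X (N * b) ok (real N * \<delta>) C (\<phi> ^ N)"
proof (induction N)
  case (Suc N)
  have "acs X (b + N * b) ok (real (Suc N) * \<delta>) C (\<phi> ^ Suc N)"
    by (rule acs_orelse[OF assms Suc, where \<psi> = 0]) (auto simp: algebra_simps)
  then show ?case by simp
qed (simp add: acs_abstain)

text \<open>The decoder does not know which condition holds. One member that answers suffices, so
  errors and sizes add up while the abstention probability stays the same.\<close>

lemma acs_family:
  assumes "\<And>j. j < N \<Longrightarrow> acs X b ok \<delta> (C j) \<phi>"
  shows "acs X (N * b) ok (real N * \<delta>) (\<lambda>x y m. \<exists>j<N. C j x y m) \<phi>"
  using assms
proof (induction N)
  case 0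
  show ?case by (simp add: acs_abstain)
next
  case (Suc N)
  have "acs X (b + N * b) ok (real (Suc N) * \<delta>) (\<lambda>x y m. \<exists>j<Suc N. C j x y m) \<phi>"
    by (rule acs_orelse[OF Suc.prems[of N] Suc.IH, where \<psi> = 0])
       (use Suc.prems in \<open>auto simp: algebra_simps less_Suc_eq\<close>)
  then show ?case by simp
qed

lemma acs_median:
  assumes "acs X b (\<lambda>x y m v. v \<in> {lo x y m..hi x y m}) (1/16) (\<lambda>_ _ _. True) 0"
  shows "acs X (L * b) (\<lambda>x y m v. v \<in> {lo x y m..hi x y m}) ((1/2) ^ L) (\<lambda>_ _ _. True) 0"
proof -
  from assms obtain P where P': "realizes P X b (\<lambda>x y m v. v \<in> {lo x y m..hi x y m}) (1/16) (\<lambda>_ _ _. True) 0" unfolding acs_def by blast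
  note P = realizesD[OF P']
  define f where "f \<omega> x = map (\<lambda>j. fst (\<omega> j) x) [0..<L]" for \<omega> :: "nat \<Rightarrow> 'a sketcher" and x
  define dec where "dec \<omega> xs ys m = Some (median L (\<lambda>j. the (snd (\<omega> j) (xs ! j) (ys ! j) m)))"
    for \<omega> :: "nat \<Rightarrow> 'a sketcher" and xs ys m
  let ?V = "{xs. set xs \<subseteq> {..<2 ^ b :: nat} \<and> length xs = L}"
  show ?thesis
  proof (rule acsI[where P = "Pi_pmf {..<L} undefined (\<lambda>_. P)" and V = ?V and f = f and dec = dec])
    show "finite ?V" by (rule finite_lists_length_eq) simp
    show "card ?V \<le> 2 ^ (L * b)" 
      by (simp add: card_lists_length_eq power_mult mult.commute[of L b])
    show "f \<omega> x \<in> ?V" if "\<omega> \<in> set_pmf (Pi_pmf {..<L} undefined (\<lambda>_. P))" "x \<in> X" for \<omega> x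
      using that by (force simp: f_def set_Pi_pmf PiE_dflt_def intro: P(1))
  next
    fix x y m assume xy: "x \<in> X" "y \<in> X"
    define bad where "bad w \<longleftrightarrow> the (answer w x y m) \<notin> {lo x y m..hi x y m}" for w
    have bad: "pr P bad \<le> 1/16" unfolding bad_def by (rule estimatorD[OF P' xy])
    have "pr (Pi_pmf {..<L} undefined (\<lambda>_. P))
        (\<lambda>\<omega>. \<exists>v. dec \<omega> (f \<omega> x) (f \<omega> y) m = Some v \<and> v \<notin> {lo x y m..hi x y m})
      \<le> pr (Pi_pmf {..<L} undefined (\<lambda>_. P)) (\<lambda>\<omega>. 2 * card {j. j < L \<and> bad (\<omega> j)} \<ge> L)"
    proof (rule pr_mono, rule ccontr)
      fix \<omega> assume *: "\<exists>v. dec \<omega> (f \<omega> x) (f \<omega> y) m = Some v \<and> v \<notin> {lo x y m..hi x y m}"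
        "\<not> L \<le> 2 * card {j. j < L \<and> bad (\<omega> j)}"
      define v where "v j = the (snd (\<omega> j) (f \<omega> x ! j) (f \<omega> y ! j) m)" for j
      have "v j = the (answer (\<omega> j) x y m)" if "j < L" for j
        using that by (simp add: v_def f_def answer_def)
      then have "{j. j < L \<and> v j \<notin> {lo x y m..hi x y m}} = {j. j < L \<and> bad (\<omega> j)}"
        by (auto simp: bad_def)
      then have "median L v \<in> {lo x y m..hi x y m}"
        using *(2) by (intro median_in_interval) simp
      moreover have "dec \<omega> (f \<omega> x) (f \<omega> y) m = Some (median L v)"
        by (simp add: dec_def v_def[abs_def])
      ultimately show False using *(1) by auto
    qed
    also have "\<dots> \<le> (1/2) ^ L" by (rule pr_majority_bad[OF bad])
    finally show "pr (Pi_pmf {..<L} undefined (\<lambda>_. P))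
      (\<lambda>\<omega>. \<exists>v. dec \<omega> (f \<omega> x) (f \<omega> y) m = Some v \<and> v \<notin> {lo x y m..hi x y m}) \<le> (1/2) ^ L" .
  next
    fix x y m
    show "pr (Pi_pmf {..<L} undefined (\<lambda>_. P)) (\<lambda>w. dec w (f w x) (f w y) m = None) \<le> 0"
      by (simp add: dec_def)
  qed
qed

text \<open>A small set is read off a list of length \<open>w\<close> padded with
  \<open>None\<close>. This prices a sample: each of its entries costs the logarithm of
  \<open>card U + 1\<close> in bits.\<close>

lemma card_subsets_card_le:
  assumes "finite U"
  shows "finite {A. A \<subseteq> U \<and> card A \<le> w}" "card {A. A \<subseteq> U \<and> card A \<le> w} \<le> (card U + 1) ^ w"
proof -
  let ?L = "{xs. set xs \<subseteq> insert None (Some ` U) \<and> length xs = w}"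
  have fin: "finite ?L" using assms by (intro finite_lists_length_eq) simp
  have "{A. A \<subseteq> U \<and> card A \<le> w} \<subseteq> (\<lambda>xs. {a. Some a \<in> set xs}) ` ?L"
  proof
    fix A assume A: "A \<in> {A. A \<subseteq> U \<and> card A \<le> w}"
    then have "finite A" using assms finite_subset by auto
    then obtain ys where ys: "set ys = A" "distinct ys" using finite_distinct_list by blast
    then have len: "length ys \<le> w" using A distinct_card[OF ys(2)] by simp
    then show "A \<in> (\<lambda>xs. {a. Some a \<in> set xs}) ` ?L"
      using A ys by (intro image_eqI[of _ _ "map Some ys @ replicate (w - length ys) None"]) auto
  qed
  note sub = this
  show "finite {A. A \<subseteq> U \<and> card A \<le> w}" by (rule finite_surj[OF fin sub])
  have "card {A. A \<subseteq> U \<and> card A \<le> w} \<le> card ?L" by (rule surj_card_le[OF fin sub])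
  also have "\<dots> = (card U + 1) ^ w" using assms by (simp add: card_lists_length_eq card_image)
  finally show "card {A. A \<subseteq> U \<and> card A \<le> w} \<le> (card U + 1) ^ w" .
qed

section \<open>Estimating the Hamming distance of aligned strings\<close>

lemma ex_pair:
  assumes "finite (set_pmf P)" "finite (set_pmf Q)"
  shows "ex (pair_pmf P Q) f = ex P (\<lambda>a. ex Q (\<lambda>b. f (a, b)))"
proof -
  have "ex (pair_pmf P Q) f = (\<Sum>a\<in>set_pmf P. pmf P a *\<^sub>R ex (map_pmf (Pair a) Q) f)"
    unfolding pair_pmf_def map_pmf_def[symmetric]
    using assms by (intro pmf_expectation_bind) auto
  also have "\<dots> = ex P (\<lambda>a. ex Q (\<lambda>b. f (a, b)))"
    using assms by (subst integral_measure_pmf_real[of "set_pmf P"]) (auto simp: mult.commute)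
  finally show ?thesis .
qed

text \<open>A new coordinate is centred and independent of the earlier sum, so cross terms vanish
  and second moments add.\<close>

lemma ex_sum_squared_independent:
  assumes P: "finite (set_pmf P)" "ex P F = 0"
  shows "ex (Pi_pmf {..<q} d (\<lambda>_. P)) (\<lambda>\<omega>. (\<Sum>j<q. F (\<omega> j))\<^sup>2) = real q * ex P (\<lambda>w. (F w)\<^sup>2)"
proof (induction q)
  case (Suc q)
  let ?Q = "Pi_pmf {..<q} d (\<lambda>_. P)"
  have Q: "finite (set_pmf ?Q)" by (intro finite_set_Pi_pmf P) simp
  have int: "integrable (measure_pmf ?Q) g" "integrable (measure_pmf P) h"
    for g :: "_ \<Rightarrow> real" and h :: "_ \<Rightarrow> real"
    using P(1) Q by (simp_all add: integrable_measure_pmf_finite)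
  have "ex (Pi_pmf {..<Suc q} d (\<lambda>_. P)) (\<lambda>\<omega>. (\<Sum>j<Suc q. F (\<omega> j))\<^sup>2)
    = ex (pair_pmf P ?Q) (\<lambda>(a, \<omega>). (F a + (\<Sum>j<q. F (\<omega> j)))\<^sup>2)"
    by (simp add: lessThan_Suc Pi_pmf_insert split_def)
  also have "\<dots> = ex P (\<lambda>a. ex ?Q (\<lambda>\<omega>. (F a + (\<Sum>j<q. F (\<omega> j)))\<^sup>2))"
    by (simp add: ex_pair[OF P(1) Q])
  also have "\<dots> = ex P (\<lambda>a. (F a)\<^sup>2 + 2 * ex ?Q (\<lambda>\<omega>. \<Sum>j<q. F (\<omega> j)) * F a + real q * ex P (\<lambda>w. (F w)\<^sup>2))"
  proof (intro Bochner_Integration.integral_cong refl)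
    fix a
    have "ex ?Q (\<lambda>\<omega>. (F a + (\<Sum>j<q. F (\<omega> j)))\<^sup>2)
      = ex ?Q (\<lambda>\<omega>. (F a)\<^sup>2 + 2 * F a * (\<Sum>j<q. F (\<omega> j)) + (\<Sum>j<q. F (\<omega> j))\<^sup>2)"
      by (simp add: power2_sum algebra_simps)
    also have "\<dots> = (F a)\<^sup>2 + 2 * F a * ex ?Q (\<lambda>\<omega>. \<Sum>j<q. F (\<omega> j)) + ex ?Q (\<lambda>\<omega>. (\<Sum>j<q. F (\<omega> j))\<^sup>2)"
      by (simp add: int)
    finally show "ex ?Q (\<lambda>\<omega>. (F a + (\<Sum>j<q. F (\<omega> j)))\<^sup>2)
      = (F a)\<^sup>2 + 2 * ex ?Q (\<lambda>\<omega>. \<Sum>j<q. F (\<omega> j)) * F a + real q * ex P (\<lambda>w. (F w)\<^sup>2)"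
      using Suc.IH by (simp add: algebra_simps)
  qed
  also have "\<dots> = real (Suc q) * ex P (\<lambda>w. (F w)\<^sup>2)"
    by (simp add: int P(2) algebra_simps)
  finally show ?case .
qed simp

definition sg :: "bool \<Rightarrow> real" where "sg s = (if s then 1 else - 1)"

text \<open>A new sign turns the sum x into x + c or x - c with equal probability. Averaging the
  fourth powers gives x^4 + 6 x^2 + 1, and 3 k^2 + 6 k + 1 is at most 3 (k + 1)^2.\<close>

lemma rademacher_moments:
  assumes U: "finite U" and E: "E \<subseteq> U" and c: "\<And>e. e \<in> E \<Longrightarrow> (c e)\<^sup>2 = (1::real)"
  defines "P \<equiv> Pi_pmf U False (\<lambda>_. bernoulli_pmf (1/2))"
  shows "ex P (\<lambda>\<omega>. (\<Sum>e\<in>E. c e * sg (\<omega> e))\<^sup>2) = real (card E)"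
    and "ex P (\<lambda>\<omega>. (\<Sum>e\<in>E. c e * sg (\<omega> e)) ^ 4) \<le> 3 * (real (card E))\<^sup>2"
proof -
  let ?Q = "\<lambda>E. Pi_pmf E False (\<lambda>_. bernoulli_pmf (1/2))"
  let ?S = "\<lambda>E \<omega>. \<Sum>e\<in>E. c e * sg (\<omega> e)"
  have fE: "finite E" using U E finite_subset by blast
  have "ex (?Q E) (\<lambda>\<omega>. (?S E \<omega>)\<^sup>2) = real (card E) \<and>
        ex (?Q E) (\<lambda>\<omega>. (?S E \<omega>) ^ 4) \<le> 3 * (real (card E))\<^sup>2"
    using fE c
  proof (induction E rule: finite_induct)
    case (insert e E)
    let ?k = "real (card E)"
    have Q: "finite (set_pmf (?Q E))" using insert.hyps by (intro finite_set_Pi_pmf) auto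
    have int: "integrable (measure_pmf (?Q E)) g" for g :: "_ \<Rightarrow> real"
      using Q by (simp add: integrable_measure_pmf_finite)
    have ce: "(c e)\<^sup>2 = 1" using insert.prems by simp
    have ce4: "(c e) ^ 4 = 1" using ce by (metis numeral_Bit0 power_add power2_eq_square mult_1 power_one power_even_eq power_mult)
    have upd: "?S (insert e E) (fun_upd \<omega> e y) = c e * sg y + ?S E \<omega>" for \<omega> y
    proof -
      have "?S E (fun_upd \<omega> e y) = ?S E \<omega>" using insert.hyps by (intro sum.cong) auto
      then show ?thesis using insert.hyps by simp
    qed
    have avg: "ex (?Q (insert e E)) (\<lambda>\<omega>. (?S (insert e E) \<omega>) ^ j)
      = (ex (?Q E) (\<lambda>\<omega>. (?S E \<omega> + c e) ^ j) + ex (?Q E) (\<lambda>\<omega>. (?S E \<omega> - c e) ^ j)) / 2" for j :: nat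
    proof -
      have "ex (?Q (insert e E)) (\<lambda>\<omega>. (?S (insert e E) \<omega>) ^ j)
        = ex (pair_pmf (bernoulli_pmf (1/2)) (?Q E)) (\<lambda>(y, \<omega>). (c e * sg y + ?S E \<omega>) ^ j)"
        using insert.hyps by (simp only: Pi_pmf_insert[OF insert.hyps] integral_map_pmf split_def upd)
      also have "\<dots> = (ex (?Q E) (\<lambda>\<omega>. (c e + ?S E \<omega>) ^ j) + ex (?Q E) (\<lambda>\<omega>. (- c e + ?S E \<omega>) ^ j)) / 2"
        by (simp add: ex_pair[OF _ Q] sg_def)
      finally show ?thesis by (simp add: add.commute)
    qed
    have IH: "ex (?Q E) (\<lambda>\<omega>. (?S E \<omega>)\<^sup>2) = ?k" "ex (?Q E) (\<lambda>\<omega>. (?S E \<omega>) ^ 4) \<le> 3 * ?k\<^sup>2"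
      using insert.IH insert.prems by auto
    have "ex (?Q (insert e E)) (\<lambda>\<omega>. (?S (insert e E) \<omega>)\<^sup>2)
      = ex (?Q E) (\<lambda>\<omega>. ((?S E \<omega> + c e)\<^sup>2 + (?S E \<omega> - c e)\<^sup>2) / 2)"
      unfolding avg by (simp add: int add_divide_distrib)
    also have "\<dots> = ex (?Q E) (\<lambda>\<omega>. (?S E \<omega>)\<^sup>2 + 1)"
    proof (intro Bochner_Integration.integral_cong refl)
      fix \<omega>
      have "((?S E \<omega> + c e)\<^sup>2 + (?S E \<omega> - c e)\<^sup>2) / 2 = (?S E \<omega>)\<^sup>2 + (c e)\<^sup>2"
        by (simp add: power2_eq_square field_simps)
      then show "((?S E \<omega> + c e)\<^sup>2 + (?S E \<omega> - c e)\<^sup>2) / 2 = (?S E \<omega>)\<^sup>2 + 1" using ce by simp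
    qed
    also have "\<dots> = ?k + 1" using IH by (simp add: int)
    finally have 1: "ex (?Q (insert e E)) (\<lambda>\<omega>. (?S (insert e E) \<omega>)\<^sup>2) = real (card (insert e E))"
      using insert.hyps by simp
    have "ex (?Q (insert e E)) (\<lambda>\<omega>. (?S (insert e E) \<omega>) ^ 4)
      = ex (?Q E) (\<lambda>\<omega>. ((?S E \<omega> + c e) ^ 4 + (?S E \<omega> - c e) ^ 4) / 2)"
      unfolding avg by (simp add: int add_divide_distrib)
    also have "\<dots> = ex (?Q E) (\<lambda>\<omega>. (?S E \<omega>) ^ 4 + 6 * (?S E \<omega>)\<^sup>2 + 1)"
    proof (intro Bochner_Integration.integral_cong refl)
      fix \<omega>
      have "((?S E \<omega> + c e) ^ 4 + (?S E \<omega> - c e) ^ 4) / 2 = (?S E \<omega>) ^ 4 + 6 * (?S E \<omega>)\<^sup>2 * (c e)\<^sup>2 + (c e) ^ 4"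
        by (simp add: power4_eq_xxxx power2_eq_square field_simps)
      then show "((?S E \<omega> + c e) ^ 4 + (?S E \<omega> - c e) ^ 4) / 2 = (?S E \<omega>) ^ 4 + 6 * (?S E \<omega>)\<^sup>2 + 1"
        using ce ce4 by simp
    qed
    also have "\<dots> = ex (?Q E) (\<lambda>\<omega>. (?S E \<omega>) ^ 4) + 6 * ?k + 1" using IH by (simp add: int)
    also have "\<dots> \<le> 3 * (?k + 1)\<^sup>2" using IH by (simp add: power2_eq_square algebra_simps)
    finally show ?case using 1 insert.hyps by (simp add: add.commute)
  qed simp
  moreover have "ex (?Q E) (\<lambda>\<omega>. (?S E \<omega>) ^ j) = ex P (\<lambda>\<omega>. (?S E \<omega>) ^ j)" for j :: nat
    unfolding P_def Pi_pmf_subset[OF U E] by simp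
  ultimately show "ex P (\<lambda>\<omega>. (?S E \<omega>)\<^sup>2) = real (card E)" "ex P (\<lambda>\<omega>. (?S E \<omega>) ^ 4) \<le> 3 * (real (card E))\<^sup>2"
    by auto
qed

text \<open>The tug-of-war estimator of Alon, Matias and Szegedy: the difference of the random sign sums
  of two strings is a Rademacher sum with two terms per mismatch.\<close>

lemma tug_of_war_moments:
  assumes n: "n > 0" and S: "S \<in> strings \<sigma> n" and T: "T \<in> strings \<sigma> n"
  defines "P \<equiv> Pi_pmf ({0..<int n} \<times> {1..\<sigma>}) False (\<lambda>_. bernoulli_pmf (1/2))"
    and "Z \<equiv> \<lambda>\<omega> S. \<Sum>i\<in>{0..<int n}. sg (\<omega> (i, cnth S i))"
  shows "ex P (\<lambda>\<omega>. (Z \<omega> S - Z \<omega> T)\<^sup>2 / 2 - real (Ham S T)) = 0"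
    and "ex P (\<lambda>\<omega>. ((Z \<omega> S - Z \<omega> T)\<^sup>2 / 2 - real (Ham S T))\<^sup>2) \<le> 2 * (real (Ham S T))\<^sup>2"
proof -
  let ?U = "{0..<int n} \<times> {1..\<sigma>}"
  let ?h = "real (Ham S T)"
  have len: "length S = n" "length T = n" using S T by (auto simp: strings_def)
  define D where "D = mism S T"
  have D: "D \<subseteq> {0..<int n}" "finite D" using finite_mism[of S T] by (auto simp: D_def mism_def len)
  have h: "?h = real (card D)" by (simp add: D_def Ham_eq_card_mism len)
  \<comment> \<open>There is one random sign per pair of position and symbol: a mismatch contributes
    two distinct signs, with coefficients 1 and -1, and agreeing positions cancel.\<close>
  define E where "E = (\<lambda>i. (i, cnth S i)) ` D \<union> (\<lambda>i. (i, cnth T i)) ` D"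
  define c where "c e = (if snd e = cnth S (fst e) then 1 else - 1 :: real)" for e
  have disj: "(\<lambda>i. (i, cnth S i)) ` D \<inter> (\<lambda>i. (i, cnth T i)) ` D = {}"
    by (auto simp: D_def mism_def)
  have inj: "inj_on (\<lambda>i. (i, cnth S i)) D" "inj_on (\<lambda>i. (i, cnth T i)) D"
    by (auto simp: inj_on_def)
  have EU: "E \<subseteq> ?U" using D cnth_strings[OF S n] cnth_strings[OF T n] by (auto simp: E_def)
  have cE: "card E = 2 * card D"
    unfolding E_def using D disj inj by (subst card_Un_disjoint) (auto simp: card_image)
  have diff: "Z \<omega> S - Z \<omega> T = (\<Sum>e\<in>E. c e * sg (\<omega> e))" for \<omega>
  proof -
    have "Z \<omega> S - Z \<omega> T = (\<Sum>i\<in>{0..<int n}. sg (\<omega> (i, cnth S i)) - sg (\<omega> (i, cnth T i)))"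
      by (simp add: Z_def sum_subtractf)
    also have "\<dots> = (\<Sum>i\<in>D. sg (\<omega> (i, cnth S i)) - sg (\<omega> (i, cnth T i)))"
      using D by (intro sum.mono_neutral_right) (auto simp: D_def mism_def len)
    also have "\<dots> = (\<Sum>i\<in>D. c (i, cnth S i) * sg (\<omega> (i, cnth S i))) + (\<Sum>i\<in>D. c (i, cnth T i) * sg (\<omega> (i, cnth T i)))"
      unfolding sum.distrib[symmetric] by (intro sum.cong) (auto simp: c_def D_def mism_def)
    also have "\<dots> = (\<Sum>e\<in>E. c e * sg (\<omega> e))"
      unfolding E_def using D disj inj by (subst sum.union_disjoint) (auto simp: sum.reindex)
    finally show ?thesis .
  qed
  have c2: "(c e)\<^sup>2 = 1" for e by (simp add: c_def)
  have fU: "finite ?U" by simp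
  have fin: "finite (set_pmf P)" unfolding P_def by (intro finite_set_Pi_pmf) auto
  have int: "integrable (measure_pmf P) g" for g :: "_ \<Rightarrow> real"
    using fin by (simp add: integrable_measure_pmf_finite)
  have m2: "ex P (\<lambda>\<omega>. (Z \<omega> S - Z \<omega> T)\<^sup>2) = 2 * ?h"
    unfolding diff P_def using rademacher_moments(1)[OF fU EU c2] cE h by simp
  have m4: "ex P (\<lambda>\<omega>. (Z \<omega> S - Z \<omega> T) ^ 4) \<le> 12 * ?h\<^sup>2"
    unfolding diff P_def using rademacher_moments(2)[OF fU EU c2] cE h by (simp add: power_mult_distrib)
  show "ex P (\<lambda>\<omega>. (Z \<omega> S - Z \<omega> T)\<^sup>2 / 2 - ?h) = 0" using m2 by (simp add: int)
  \<comment> \<open>A sum of 2 h signs has fourth moment at most 3 (2 h)^2 = 12 h^2, so the variance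
    is at most (12/4 - 2 + 1) h^2.\<close>
  have "ex P (\<lambda>\<omega>. ((Z \<omega> S - Z \<omega> T)\<^sup>2 / 2 - ?h)\<^sup>2)
    = ex P (\<lambda>\<omega>. (Z \<omega> S - Z \<omega> T) ^ 4 / 4 - ?h * (Z \<omega> S - Z \<omega> T)\<^sup>2 + ?h\<^sup>2)"
    by (intro Bochner_Integration.integral_cong refl)
       (simp add: power2_eq_square power4_eq_xxxx field_simps)
  also have "\<dots> = ex P (\<lambda>\<omega>. (Z \<omega> S - Z \<omega> T) ^ 4) / 4 - ?h * (2 * ?h) + ?h\<^sup>2"
    by (simp add: int m2)
  also have "\<dots> \<le> 2 * ?h\<^sup>2" using m4 by (simp add: power2_eq_square)
  finally show "ex P (\<lambda>\<omega>. ((Z \<omega> S - Z \<omega> T)\<^sup>2 / 2 - ?h)\<^sup>2) \<le> 2 * ?h\<^sup>2" .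
qed

text \<open>Averaging \<open>q\<close> copies lowers the variance to at most 2 h^2/q, and
  32/\<eta>^2 copies make this \<eta>^2 h^2/16. Each stored sum is an integer between -n and n,
  which gives 2 n + 1 values. The strings are compared without shift; \<open>acs_anchor\<close>
  supplies rotations that are already aligned.\<close>

lemma acs_tug_of_war:
  assumes n: "n > 0" and \<eta>: "\<eta> > 0" "32 / \<eta>\<^sup>2 \<le> real q" and lam: "2 * n + 1 \<le> 2 ^ l"
  shows "acs (strings \<sigma> n) (L * (q * l))
    (\<lambda>S T m v. v \<in> {(1 - \<eta>) * real (Ham S T)..(1 + \<eta>) * real (Ham S T)}) ((1/2) ^ L) (\<lambda>_ _ _. True) 0"
proof (rule acs_median)
  define P where "P = Pi_pmf ({0..<int n} \<times> {1..\<sigma>}) False (\<lambda>_. bernoulli_pmf (1/2))"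
  define Z :: "(int \<times> nat \<Rightarrow> bool) \<Rightarrow> nat list \<Rightarrow> real"
    where "Z \<omega> S = (\<Sum>i\<in>{0..<int n}. sg (\<omega> (i, cnth S i)))" for \<omega> S
  have q: "real q > 0" using \<eta> by (metis divide_pos_pos less_le_trans zero_less_numeral zero_less_power)
  have fin: "finite (set_pmf P)" unfolding P_def by (intro finite_set_Pi_pmf) auto
  let ?Q = "Pi_pmf {..<q} undefined (\<lambda>_. P)"
  have finQ: "finite (set_pmf ?Q)" using fin by (intro finite_set_Pi_pmf) auto
  let ?R = "real_of_int ` {- int n..int n}"
  have ZR: "Z \<omega> S \<in> ?R" for \<omega> S
  proof
    let ?z = "\<Sum>i\<in>{0..<int n}. if \<omega> (i, cnth S i) then 1 else - 1 :: int"
    show "Z \<omega> S = real_of_int ?z" by (simp add: Z_def sg_def if_distrib cong: if_cong)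
    have "\<bar>?z\<bar> \<le> (\<Sum>i\<in>{0..<int n}. \<bar>if \<omega> (i, cnth S i) then 1 else - 1\<bar>)" by (rule sum_abs)
    also have "\<dots> \<le> (\<Sum>i\<in>{0..<int n}. 1)" by (intro sum_mono) auto
    finally have "\<bar>?z\<bar> \<le> int n" by simp
    then show "?z \<in> {- int n..int n}" by (metis abs_le_iff atLeastAtMost_iff minus_le_iff)
  qed
  have cR: "card ?R = 2 * n + 1" by (subst card_image) (auto simp: inj_on_def)
  define f where "f \<omega> S = map (\<lambda>j. Z (\<omega> j) S) [0..<q]" for \<omega> and S
  define dec where "dec \<omega> xs ys m = Some ((\<Sum>j<q. (xs ! j - ys ! j)\<^sup>2 / 2) / real q)"
    for \<omega> :: "nat \<Rightarrow> int \<times> nat \<Rightarrow> bool" and xs ys :: "real list" and m :: int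
  let ?V = "{xs. set xs \<subseteq> ?R \<and> length xs = q}"
  show "acs (strings \<sigma> n) (q * l)
    (\<lambda>S T m v. v \<in> {(1 - \<eta>) * real (Ham S T)..(1 + \<eta>) * real (Ham S T)}) (1/16) (\<lambda>_ _ _. True) 0"
  proof (rule acsI[where P = ?Q and V = ?V and f = f and dec = dec])
    show "finite ?V" by (rule finite_lists_length_eq) simp
    have "card ?V = (2 * n + 1) ^ q" using cR by (subst card_lists_length_eq) auto
    also have "\<dots> \<le> (2 ^ l) ^ q" by (intro power_mono lam) simp
    finally show "card ?V \<le> 2 ^ (q * l)" by (simp add: power_mult[symmetric] mult.commute)
    show "f \<omega> S \<in> ?V" for \<omega> S using ZR by (auto simp: f_def)
  next
    fix S T m assume ST: "S \<in> strings \<sigma> n" "T \<in> strings \<sigma> n"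
    let ?h = "real (Ham S T)"
    define F where "F \<omega> = (Z \<omega> S - Z \<omega> T)\<^sup>2 / 2 - ?h" for \<omega>
    have F: "ex P F = 0" "ex P (\<lambda>\<omega>. (F \<omega>)\<^sup>2) \<le> 2 * ?h\<^sup>2"
      using tug_of_war_moments[OF n ST] unfolding F_def P_def Z_def by auto
    have dec: "dec \<omega> (f \<omega> S) (f \<omega> T) m = Some (?h + (\<Sum>j<q. F (\<omega> j)) / real q)" for \<omega>
      using q by (simp add: dec_def f_def F_def sum_subtractf diff_divide_distrib)
    have "pr ?Q (\<lambda>\<omega>. \<exists>v. dec \<omega> (f \<omega> S) (f \<omega> T) m = Some v \<and> v \<notin> {(1 - \<eta>) * ?h..(1 + \<eta>) * ?h})
      \<le> pr ?Q (\<lambda>\<omega>. \<bar>\<Sum>j<q. F (\<omega> j)\<bar> > real q * \<eta> * ?h)"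
    proof (rule pr_mono, rule ccontr)
      fix \<omega> assume *: "\<exists>v. dec \<omega> (f \<omega> S) (f \<omega> T) m = Some v \<and> v \<notin> {(1 - \<eta>) * ?h..(1 + \<eta>) * ?h}"
        "\<not> real q * \<eta> * ?h < \<bar>\<Sum>j<q. F (\<omega> j)\<bar>"
      then have "\<bar>(\<Sum>j<q. F (\<omega> j)) / real q\<bar> \<le> \<eta> * ?h" using q by (simp add: field_simps)
      then have "?h + (\<Sum>j<q. F (\<omega> j)) / real q \<in> {(1 - \<eta>) * ?h..(1 + \<eta>) * ?h}"
        unfolding abs_le_iff atLeastAtMost_iff left_diff_distrib distrib_right by linarith
      with *(1) show False unfolding dec by blast
    qed
    also have "\<dots> \<le> 1/16"
    proof (rule pr_chebyshev[OF finQ])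
      have "ex ?Q (\<lambda>\<omega>. (\<Sum>j<q. F (\<omega> j))\<^sup>2) \<le> real q * (2 * ?h\<^sup>2)"
        unfolding ex_sum_squared_independent[OF fin F(1)] using F(2) by (intro mult_left_mono) auto
      also have "\<dots> \<le> real q * ((1/16) * (real q * \<eta>\<^sup>2) * ?h\<^sup>2)"
        using \<eta> by (intro mult_left_mono mult_right_mono) (auto simp: field_simps)
      also have "\<dots> = 1/16 * (real q * \<eta> * ?h)\<^sup>2" by (simp add: power2_eq_square)
      finally show "ex ?Q (\<lambda>\<omega>. (\<Sum>j<q. F (\<omega> j))\<^sup>2) \<le> 1/16 * (real q * \<eta> * ?h)\<^sup>2" .
    qed (use \<eta> in auto)
    finally show "pr ?Q (\<lambda>\<omega>. \<exists>v. dec \<omega> (f \<omega> S) (f \<omega> T) m = Some v \<and> v \<notin> {(1 - \<eta>) * ?h..(1 + \<eta>) * ?h}) \<le> 1/16" .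
  next
    fix S T m
    show "pr ?Q (\<lambda>w. dec w (f w S) (f w T) m = None) \<le> 0" by (simp add: dec_def)
  qed
qed

section \<open>Position sampling\<close>

text \<open>The variance of the Horvitz-Thompson estimator: weighting each observed term by
  1/\<beta> makes the estimate unbiased, and pairwise independence removes the cross terms.\<close>

lemma ex_pairwise_independent_events:
  assumes P: "finite (set_pmf P)" and J: "finite J" and \<beta>: "\<beta> > 0"
    and Q: "\<And>i. i \<in> J \<Longrightarrow> pr P (Q i) = \<beta>"
    and QQ: "\<And>i j. i \<in> J \<Longrightarrow> j \<in> J \<Longrightarrow> i \<noteq> j \<Longrightarrow> pr P (\<lambda>w. Q i w \<and> Q j w) = \<beta>\<^sup>2"
  shows "ex P (\<lambda>w. (\<Sum>i\<in>J. a i * ((if Q i w then 1 else 0) / \<beta> - 1))\<^sup>2) = (\<Sum>i\<in>J. (a i)\<^sup>2) * (1 / \<beta> - 1)"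
proof -
  define z where "z i w = (if Q i w then 1 else 0) / \<beta> - (1::real)" for i w
  have int: "integrable (measure_pmf P) g" for g :: "_ \<Rightarrow> real"
    using P by (simp add: integrable_measure_pmf_finite)
  have zz: "ex P (\<lambda>w. z i w * z j w) = (if i = j then 1 / \<beta> - 1 else 0)" if "i \<in> J" "j \<in> J" for i j
  proof -
    have "ex P (\<lambda>w. z i w * z j w) = ex P (\<lambda>w. (if Q i w \<and> Q j w then 1 else 0) / \<beta>\<^sup>2
        - (if Q i w then 1 else 0) / \<beta> - (if Q j w then 1 else 0) / \<beta> + 1)"
      using \<beta> by (intro Bochner_Integration.integral_cong refl)
        (simp add: z_def field_simps power2_eq_square)
    also have "\<dots> = ex P (\<lambda>w. if Q i w \<and> Q j w then 1 else 0) / \<beta>\<^sup>2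
        - ex P (\<lambda>w. if Q i w then 1 else 0) / \<beta> - ex P (\<lambda>w. if Q j w then 1 else 0) / \<beta> + 1"
      by (simp add: int)
    also have "\<dots> = pr P (\<lambda>w. Q i w \<and> Q j w) / \<beta>\<^sup>2 - 1 / \<beta> * \<beta> - 1 / \<beta> * \<beta> + 1"
      by (simp add: ex_indicator Q that)
    also have "\<dots> = (if i = j then 1 / \<beta> - 1 else 0)"
      using \<beta> that by (cases "i = j") (simp_all add: Q QQ power2_eq_square)
    finally show ?thesis .
  qed
  have "ex P (\<lambda>w. (\<Sum>i\<in>J. a i * z i w)\<^sup>2) = ex P (\<lambda>w. \<Sum>i\<in>J. \<Sum>j\<in>J. a i * a j * (z i w * z j w))"
    by (intro Bochner_Integration.integral_cong refl)
       (simp add: power2_eq_square sum_product mult_ac)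
  also have "\<dots> = (\<Sum>i\<in>J. \<Sum>j\<in>J. a i * a j * ex P (\<lambda>w. z i w * z j w))"
    by (simp add: ex_sum[OF P])
  also have "\<dots> = (\<Sum>i\<in>J. \<Sum>j\<in>J. if i = j then (a i)\<^sup>2 * (1 / \<beta> - 1) else 0)"
    by (intro sum.cong refl) (auto simp: zz power2_eq_square)
  also have "\<dots> = (\<Sum>i\<in>J. (a i)\<^sup>2) * (1 / \<beta> - 1)"
    using J by (simp add: sum_distrib_right)
  finally show ?thesis unfolding z_def .
qed

definition rsub :: "nat \<Rightarrow> real \<Rightarrow> (int \<Rightarrow> bool) pmf" where
  "rsub n \<alpha> = Pi_pmf {0..<int n} False (\<lambda>_. bernoulli_pmf \<alpha>)"

lemma finite_rsub [simp]: "finite (set_pmf (rsub n \<alpha>))"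
  unfolding rsub_def by (intro finite_set_Pi_pmf) (auto intro: finite_subset[OF subset_UNIV])

lemma pr_bernoulli_True: "0 \<le> p \<Longrightarrow> p \<le> 1 \<Longrightarrow> pr (bernoulli_pmf p) (\<lambda>b. b) = p"
  and pr_bernoulli_False: "0 \<le> p \<Longrightarrow> p \<le> 1 \<Longrightarrow> pr (bernoulli_pmf p) (\<lambda>b. \<not> b) = 1 - p"
proof -
  have "{b. b} = {True}" "{b. \<not> b} = {False}" by auto
  then show "0 \<le> p \<Longrightarrow> p \<le> 1 \<Longrightarrow> pr (bernoulli_pmf p) (\<lambda>b. b) = p"
    "0 \<le> p \<Longrightarrow> p \<le> 1 \<Longrightarrow> pr (bernoulli_pmf p) (\<lambda>b. \<not> b) = 1 - p"
    by (simp_all add: measure_pmf_single)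
qed

lemma pr_rsub_Ball:
  assumes "0 \<le> \<alpha>" "\<alpha> \<le> 1" "J \<subseteq> {0..<int n}"
  shows "pr (rsub n \<alpha>) (\<lambda>A. \<forall>i\<in>J. A i) = \<alpha> ^ card J"
    and "pr (rsub n \<alpha>) (\<lambda>A. \<forall>i\<in>J. \<not> A i) = (1 - \<alpha>) ^ card J"
  unfolding rsub_def using assms
  by (simp_all add: pr_Pi_pmf_Ball[where B = "\<lambda>_ b. b"] pr_Pi_pmf_Ball[where B = "\<lambda>_ b. \<not> b"]
      pr_bernoulli_True pr_bernoulli_False)

lemma pr_rsub_single:
  assumes "0 \<le> \<alpha>" "\<alpha> \<le> 1" "i \<in> {0..<int n}"
  shows "pr (rsub n \<alpha>) (\<lambda>A. A i) = \<alpha>"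
  using pr_rsub_Ball(1)[OF assms(1,2), of "{i}" n] assms(3) by simp

lemma pr_rsub_double:
  assumes "0 \<le> \<alpha>" "\<alpha> \<le> 1" "i \<in> {0..<int n}" "j \<in> {0..<int n}" "i \<noteq> j"
  shows "pr (rsub n \<alpha>) (\<lambda>A. A i \<and> A j) = \<alpha>\<^sup>2"
  using pr_rsub_Ball(1)[OF assms(1,2), of "{i, j}" n] assms(3-5) by (simp add: power2_eq_square)

text \<open>Distinct \<open>i\<close> use distinct coordinates of \<open>A\<close> and, since the
  shift is injective, of \<open>B\<close>. With one set in the role of both, the events for
  \<open>i\<close> and \<open>i + m\<close> would share a coordinate.\<close>

lemma pr_aligned:
  fixes m :: int
  assumes n: "n > 0" and \<alpha>: "0 \<le> \<alpha>" "\<alpha> \<le> 1"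
  defines "hit \<equiv> \<lambda>i (A, B). A i \<and> B ((i + m) mod int n)"
  shows "i \<in> {0..<int n} \<Longrightarrow> pr (pair_pmf (rsub n \<alpha>) (rsub n \<alpha>)) (hit i) = \<alpha>\<^sup>2"
    and "i \<in> {0..<int n} \<Longrightarrow> j \<in> {0..<int n} \<Longrightarrow> i \<noteq> j \<Longrightarrow>
      pr (pair_pmf (rsub n \<alpha>) (rsub n \<alpha>)) (\<lambda>w. hit i w \<and> hit j w) = (\<alpha>\<^sup>2)\<^sup>2"
proof -
  let ?\<pi> = "\<lambda>i. (i + m) mod int n"
  have \<pi>: "?\<pi> i \<in> {0..<int n}" for i using n by simp
  show "pr (pair_pmf (rsub n \<alpha>) (rsub n \<alpha>)) (hit i) = \<alpha>\<^sup>2" if "i \<in> {0..<int n}"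
    unfolding hit_def pr_pair_conj pr_rsub_single[OF \<alpha> that] pr_rsub_single[OF \<alpha> \<pi>]
    by (rule power2_eq_square[symmetric])
  assume ij: "i \<in> {0..<int n}" "j \<in> {0..<int n}" "i \<noteq> j"
  then have "?\<pi> i \<noteq> ?\<pi> j"
    using inj_onD[OF bij_betw_imp_inj_on[OF bij_betw_add_mod[OF n, of m]], of i j] by blast
  have "pr (pair_pmf (rsub n \<alpha>) (rsub n \<alpha>)) (\<lambda>w. hit i w \<and> hit j w)
    = pr (pair_pmf (rsub n \<alpha>) (rsub n \<alpha>)) (\<lambda>(A, B). (A i \<and> A j) \<and> (B (?\<pi> i) \<and> B (?\<pi> j)))"
    by (intro pr_cong) (auto simp: hit_def)
  also have "\<dots> = \<alpha>\<^sup>2 * \<alpha>\<^sup>2"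
    unfolding pr_pair_conj pr_rsub_double[OF \<alpha> ij] pr_rsub_double[OF \<alpha> \<pi> \<pi> \<open>?\<pi> i \<noteq> ?\<pi> j\<close>] ..
  finally show "pr (pair_pmf (rsub n \<alpha>) (rsub n \<alpha>)) (\<lambda>w. hit i w \<and> hit j w) = (\<alpha>\<^sup>2)\<^sup>2"
    by (simp add: power2_eq_square)
qed

section \<open>Partial words and their sampled overlaps\<close>

definition overlap :: "nat \<Rightarrow> (int \<Rightarrow> nat option) \<Rightarrow> (int \<Rightarrow> nat option) \<Rightarrow> int \<Rightarrow> int set" where
  "overlap n u v m = {i\<in>{0..<int n}. i \<in> dom u \<and> (i + m) mod int n \<in> dom v}"

text \<open>The weight is a parameter because two sums are needed: the Hamming distance of whole
  strings and the correction \<open>wt_excess\<close> for residuals.\<close>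

definition wsum :: "nat \<Rightarrow> (nat \<Rightarrow> nat \<Rightarrow> real) \<Rightarrow> (int \<Rightarrow> nat option) \<Rightarrow> (int \<Rightarrow> nat option) \<Rightarrow> int \<Rightarrow> real" where
  "wsum n wt u v m = (\<Sum>i\<in>overlap n u v m. wt (the (u i)) (the (v ((i + m) mod int n))))"

definition sparse :: "nat \<Rightarrow> nat \<Rightarrow> nat \<Rightarrow> (int \<Rightarrow> nat option) set" where
  "sparse n \<sigma> N = {u. dom u \<subseteq> {0..<int n} \<and> ran u \<subseteq> {1..\<sigma>} \<and> card (dom u) \<le> N}"

text \<open>A string may later be the first or the second argument, so its message contains both an
  \<open>A\<close>-sample and a \<open>B\<close>-sample. The error 1/16 is 1/32 from Chebyshev's
  inequality plus 1/64 for each of the two samples that may outgrow \<open>W\<close>, which is at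
  least 64 times the expected size.\<close>

lemma acs_sparse:
  assumes n: "n > 0" and \<alpha>: "0 < \<alpha>" "\<alpha> \<le> 1" and W: "W > 0" "64 * \<alpha> * real N \<le> real W"
    and X: "X \<subseteq> sparse n \<sigma> N" and b: "n * \<sigma> + 1 \<le> 2 ^ b"
    and \<tau>: "\<And>u v m. u \<in> X \<Longrightarrow> v \<in> X \<Longrightarrow> 0 \<le> \<tau> u v m"
      "\<And>u v m. u \<in> X \<Longrightarrow> v \<in> X \<Longrightarrow>
        wsum n (\<lambda>c d. (wt c d)\<^sup>2) u v m * (1 / \<alpha>\<^sup>2 - 1) \<le> (\<tau> u v m)\<^sup>2 / 32"
  shows "acs X (L * (2 * (b * W)))
    (\<lambda>u v m z. z \<in> {wsum n wt u v m - \<tau> u v m..wsum n wt u v m + \<tau> u v m}) ((1/2) ^ L) (\<lambda>_ _ _. True) 0"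
proof (rule acs_median)
  let ?I = "{0..<int n}" and ?R = "rsub n \<alpha>"
  let ?P = "pair_pmf ?R ?R"
  let ?K = "{E. E \<subseteq> ?I \<times> {1..\<sigma>} \<and> card E \<le> W}"
  define smp where "smp A u = {(i, c). A i \<and> u i = Some c}" for A :: "int \<Rightarrow> bool" and u :: "int \<Rightarrow> nat option"
  \<comment> \<open>Discarding an oversized sample makes the size bound hold for every draw.\<close>
  define trunc where "trunc E = (if card E \<le> W then E else {})" for E :: "(int \<times> nat) set"
  define f where "f = (\<lambda>(A, B) u. (trunc (smp A u), trunc (smp B u)))"
  define dec where "dec w p p' m = Some (\<Sum>((i, c), (j, d))\<in>{((i, c), (j, d)). (i, c) \<in> fst p \<and> (j, d) \<in> snd p' \<and> j = (i + m) mod int n}.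
      wt c d / \<alpha>\<^sup>2)"
    for w :: "(int \<Rightarrow> bool) \<times> (int \<Rightarrow> bool)" and p p' :: "(int \<times> nat) set \<times> (int \<times> nat) set" and m
  have fin: "finite (set_pmf ?P)" by simp
  have K: "finite ?K" "card ?K \<le> 2 ^ (b * W)"
  proof -
    show "finite ?K" by (rule card_subsets_card_le(1)) simp
    have "card ?K \<le> (card (?I \<times> {1..\<sigma>}) + 1) ^ W" by (rule card_subsets_card_le(2)) simp
    also have "\<dots> \<le> (2 ^ b) ^ W" using b by (intro power_mono) simp_all
    finally show "card ?K \<le> 2 ^ (b * W)" by (simp add: power_mult)
  qed
  show "acs X (2 * (b * W))
    (\<lambda>u v m z. z \<in> {wsum n wt u v m - \<tau> u v m..wsum n wt u v m + \<tau> u v m}) (1/16) (\<lambda>_ _ _. True) 0"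
  proof (rule acsI[where P = ?P and V = "?K \<times> ?K" and f = f and dec = dec])
    show "finite (?K \<times> ?K)" using K by simp
    have "card (?K \<times> ?K) \<le> 2 ^ (b * W) * 2 ^ (b * W)"
      unfolding card_cartesian_product using K by (intro mult_mono) auto
    then show "card (?K \<times> ?K) \<le> 2 ^ (2 * (b * W))" by (simp add: power_add[symmetric] mult_2)
    have "trunc (smp A u) \<in> ?K" if "u \<in> X" for A u
      using that X by (auto simp: trunc_def smp_def sparse_def ran_def split: if_splits)
    then show "f w u \<in> ?K \<times> ?K" if "u \<in> X" for w u
      using that by (auto simp: f_def split_def)
  next
    fix u v m assume uv: "u \<in> X" "v \<in> X"
    let ?\<pi> = "\<lambda>i. (i + m) mod int n" and ?J = "overlap n u v m"
    let ?a = "\<lambda>i. wt (the (u i)) (the (v (?\<pi> i)))"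
    define hit where "hit = (\<lambda>i (A, B). A i \<and> B (?\<pi> i))"
    have J': "?J \<subseteq> ?I" by (auto simp: overlap_def)
    have J: "finite ?J" "?J \<subseteq> ?I" using finite_subset[OF J'] J' by simp_all
    define err where "err w = (\<Sum>i\<in>?J. ?a i * ((if hit i w then 1 else 0) / \<alpha>\<^sup>2 - 1))" for w
    define over where "over u A \<longleftrightarrow> real (card {i\<in>dom u. A i}) > real W" for u :: "int \<Rightarrow> nat option" and A
    have over: "pr ?R (over x) \<le> 1/64" if "x \<in> X" for x
    proof -
      have x: "dom x \<subseteq> ?I" "card (dom x) \<le> N" using that X by (auto simp: sparse_def)
      have "pr ?R (over x) \<le> (\<Sum>i\<in>dom x. pr ?R (\<lambda>A. A i)) / real W"
        unfolding over_def using x(1) W finite_subset[OF x(1)] by (intro pr_card_markov) auto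
      also have "(\<Sum>i\<in>dom x. pr ?R (\<lambda>A. A i)) = (\<Sum>i\<in>dom x. \<alpha>)"
        using x(1) \<alpha> by (intro sum.cong refl pr_rsub_single) auto
      also have "\<dots> / real W \<le> 1/64"
      proof -
        have "64 * \<alpha> * real (card (dom x)) \<le> 64 * \<alpha> * real N" using x(2) \<alpha> by (intro mult_left_mono) auto
        then show ?thesis using W by (simp add: field_simps)
      qed
      finally show ?thesis .
    qed
    have ht: "pr ?P (\<lambda>w. \<bar>err w\<bar> > \<tau> u v m) \<le> 1/32"
    proof (rule pr_chebyshev[OF fin])
      have "ex ?P (\<lambda>w. (err w)\<^sup>2) = (\<Sum>i\<in>?J. (?a i)\<^sup>2) * (1 / \<alpha>\<^sup>2 - 1)"
        unfolding err_def
      proof (rule ex_pairwise_independent_events[OF fin J(1)])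
        show "pr ?P (hit i) = \<alpha>\<^sup>2" if "i \<in> ?J" for i
          unfolding hit_def by (rule pr_aligned(1)[OF n]) (use \<alpha> J(2) that in auto)
        show "pr ?P (\<lambda>w. hit i w \<and> hit j w) = (\<alpha>\<^sup>2)\<^sup>2" if "i \<in> ?J" "j \<in> ?J" "i \<noteq> j" for i j
          unfolding hit_def by (rule pr_aligned(2)[OF n]) (use \<alpha> J(2) that in auto)
      qed (use \<alpha> in simp)
      then show "ex ?P (\<lambda>w. (err w)\<^sup>2) \<le> 1/32 * (\<tau> u v m)\<^sup>2"
        using \<tau>(2)[OF uv, of m] by (simp add: wsum_def)
    qed (use \<tau>(1)[OF uv] in auto)
    have cs: "trunc (smp A x) = smp A x" if "\<not> over x A" for A x
    proof -
      have "smp A x = (\<lambda>i. (i, the (x i))) ` {i\<in>dom x. A i}" by (force simp: smp_def)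
      then have "card (smp A x) = card {i\<in>dom x. A i}" by (simp add: card_image inj_on_def)
      then show ?thesis using that by (simp add: over_def trunc_def)
    qed
    have est: "dec w (f w u) (f w v) m = Some (wsum n wt u v m + err w)"
      if "\<not> over u (fst w)" "\<not> over v (snd w)" for w
    proof -
      obtain A B where w: "w = (A, B)" by (cases w)
      let ?T = "{((i, c), (j, d)). (i, c) \<in> smp A u \<and> (j, d) \<in> smp B v \<and> j = ?\<pi> i}"
      let ?H = "{i\<in>?J. hit i w}"
      have T: "?T = (\<lambda>i. ((i, the (u i)), (?\<pi> i, the (v (?\<pi> i))))) ` ?H"
      proof (intro equalityI subsetI)
        fix t assume "t \<in> ?T"
        then obtain i c d where t: "t = ((i, c), (?\<pi> i, d))" "A i" "u i = Some c" "B (?\<pi> i)" "v (?\<pi> i) = Some d"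
          by (auto simp: smp_def)
        moreover have "i \<in> ?I" using domI[of u i c, OF t(3)] subsetD[OF X uv(1)] unfolding sparse_def by blast
        ultimately show "t \<in> (\<lambda>i. ((i, the (u i)), (?\<pi> i, the (v (?\<pi> i))))) ` ?H"
          by (intro image_eqI[of _ _ i]) (auto simp: overlap_def hit_def w)
      next
        fix t assume "t \<in> (\<lambda>i. ((i, the (u i)), (?\<pi> i, the (v (?\<pi> i))))) ` ?H"
        then obtain i where t: "t = ((i, the (u i)), (?\<pi> i, the (v (?\<pi> i))))" "i \<in> ?J" "hit i w" by blast
        then have "u i \<noteq> None" "v (?\<pi> i) \<noteq> None" "A i" "B (?\<pi> i)"
          by (auto simp: overlap_def hit_def w)
        then show "t \<in> ?T" unfolding t(1) smp_def by simp
      qed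
      have inj: "inj_on (\<lambda>i. ((i, the (u i)), (?\<pi> i, the (v (?\<pi> i))))) ?H" by (rule inj_onI) simp
      have "(\<Sum>((i, c), (j, d))\<in>?T. wt c d / \<alpha>\<^sup>2) = (\<Sum>i\<in>?H. ?a i / \<alpha>\<^sup>2)"
        unfolding T sum.reindex[OF inj] by simp
      also have "\<dots> = (\<Sum>i\<in>?J. ?a i * ((if hit i w then 1 else 0) / \<alpha>\<^sup>2))"
        unfolding sum.inter_filter[OF J(1)] by (intro sum.cong) auto
      also have "\<dots> = wsum n wt u v m + err w"
        by (simp add: err_def wsum_def right_diff_distrib sum_subtractf)
      finally show ?thesis using that by (simp add: dec_def f_def w cs)
    qed
    have "pr ?P (\<lambda>w. \<exists>z. dec w (f w u) (f w v) m = Some z \<and> z \<notin> {wsum n wt u v m - \<tau> u v m..wsum n wt u v m + \<tau> u v m})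
      \<le> pr ?P (\<lambda>w. \<bar>err w\<bar> > \<tau> u v m \<or> (case w of (A, B) \<Rightarrow> over u A) \<or> (case w of (A, B) \<Rightarrow> over v B))"
    proof (rule pr_mono, rule ccontr)
      fix w assume *: "\<exists>z. dec w (f w u) (f w v) m = Some z \<and> z \<notin> {wsum n wt u v m - \<tau> u v m..wsum n wt u v m + \<tau> u v m}"
        "\<not> (\<bar>err w\<bar> > \<tau> u v m \<or> (case w of (A, B) \<Rightarrow> over u A) \<or> (case w of (A, B) \<Rightarrow> over v B))"
      then have "dec w (f w u) (f w v) m = Some (wsum n wt u v m + err w)"
        by (intro est) (auto simp: split_def)
      moreover have "wsum n wt u v m + err w \<in> {wsum n wt u v m - \<tau> u v m..wsum n wt u v m + \<tau> u v m}"
        using *(2) by (simp only: de_Morgan_disj atLeastAtMost_iff) linarith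
      ultimately show False using *(1) by auto
    qed
    also have "\<dots> \<le> pr ?P (\<lambda>w. \<bar>err w\<bar> > \<tau> u v m)
      + (pr ?P (\<lambda>w. case w of (A, B) \<Rightarrow> over u A) + pr ?P (\<lambda>w. case w of (A, B) \<Rightarrow> over v B))"
      by (rule order_trans[OF pr_disj add_left_mono[OF pr_disj]])
    also have "\<dots> \<le> 1/16" unfolding pr_pair_fst pr_pair_snd using ht over[OF uv(1)] over[OF uv(2)] by simp
    finally show "pr ?P (\<lambda>w. \<exists>z. dec w (f w u) (f w v) m = Some z \<and>
      z \<notin> {wsum n wt u v m - \<tau> u v m..wsum n wt u v m + \<tau> u v m}) \<le> 1/16" .
  next
    fix u v m
    show "pr ?P (\<lambda>w. dec w (f w u) (f w v) m = None) \<le> 0" by (simp add: dec_def)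
  qed
qed

lemma pr_random_function_collision:
  assumes "finite U" "a \<in> U" "c \<in> U" "a \<noteq> c" "finite V" "V \<noteq> {}"
  shows "pr (Pi_pmf U d (\<lambda>_. pmf_of_set V)) (\<lambda>F. F a = F c) \<le> 1 / real (card V)"
proof -
  let ?P = "Pi_pmf U d (\<lambda>_. pmf_of_set V)"
  have "pr ?P (\<lambda>F. F a = F c) \<le> pr ?P (\<lambda>F. \<exists>v\<in>V. \<forall>i\<in>{a, c}. F i = v)"
    using assms by (intro pr_mono) (auto simp: set_Pi_pmf PiE_dflt_def)
  also have "\<dots> \<le> (\<Sum>v\<in>V. pr ?P (\<lambda>F. \<forall>i\<in>{a, c}. F i = v))" by (rule pr_Bex[OF assms(5)])
  also have "\<dots> = (\<Sum>v\<in>V. (1 / real (card V)) * (1 / real (card V)))"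
  proof (intro sum.cong refl)
    fix v assume "v \<in> V"
    then have "pr (pmf_of_set V) (\<lambda>x. x = v) = 1 / real (card V)"
      using assms by (simp add: measure_pmf_single)
    then show "pr ?P (\<lambda>F. \<forall>i\<in>{a, c}. F i = v) = (1 / real (card V)) * (1 / real (card V))"
      using assms by (subst pr_Pi_pmf_Ball) auto
  qed
  also have "\<dots> = 1 / real (card V)" using assms by simp
  finally show ?thesis .
qed

section \<open>Testing cyclic equality\<close>

definition period :: "'a list \<Rightarrow> nat" where
  "period T = (LEAST p. p > 0 \<and> cyc_pow (int p) T = T)"

lemma period_props:
  assumes "T \<noteq> []"
  shows period_pos: "period T > 0" and period_le: "period T \<le> length T"
    and cyc_pow_fixes_iff: "cyc_pow g T = T \<longleftrightarrow> int (period T) dvd g"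
proof -
  let ?Q = "\<lambda>p. p > 0 \<and> cyc_pow (int p) T = T"
  have n: "?Q (length T)" using assms cyc_pow_length_mult[of T 1] by simp
  have p: "?Q (period T)" unfolding period_def by (rule LeastI[of ?Q, OF n])
  then show "period T > 0" by simp
  show "period T \<le> length T" unfolding period_def by (rule Least_le[of ?Q, OF n])
  have nat_mult: "cyc_pow (int (period T) * int k) T = T" for k
  proof (induction k)
    case (Suc k)
    have "cyc_pow (int (period T) * int (Suc k)) T = cyc_pow (int (period T)) (cyc_pow (int (period T) * int k) T)"
      by (simp add: cyc_pow_add algebra_simps)
    then show ?case using Suc p by simp
  qed simp
  have mult: "cyc_pow (int (period T) * k) T = T" for k
  proof (cases "k \<ge> 0")
    case True
    then show ?thesis using nat_mult[of "nat k"] by simp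
  next
    case False
    have "cyc_pow (int (period T) * k) (cyc_pow (int (period T) * int (nat (- k))) T) = T"
      using False by (simp add: cyc_pow_add)
    then show ?thesis unfolding nat_mult .
  qed
  show "cyc_pow g T = T \<longleftrightarrow> int (period T) dvd g"
  proof
    assume g: "cyc_pow g T = T"
    let ?r = "g mod int (period T)"
    have "cyc_pow ?r T = cyc_pow ?r (cyc_pow (int (period T) * (g div int (period T))) T)"
      by (simp add: mult)
    also have "\<dots> = T" using g unfolding cyc_pow_add by (simp add: add.commute)
    finally have r: "cyc_pow (int (nat ?r)) T = T" using p by simp
    have "nat ?r < period T" using p by (simp add: nat_less_iff)
    then have "\<not> ?Q (nat ?r)" using not_less_Least[of "nat ?r" ?Q] by (simp add: period_def)
    then have "nat ?r = 0" using r by (metis gr0I)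
    moreover have "?r \<ge> 0" using p by simp
    ultimately have "?r = 0" by linarith
    then show "int (period T) dvd g" by (simp add: dvd_eq_mod_eq_0)
  qed (auto simp: mult)
qed

text \<open>A string is given by a representative of its orbit under rotation and an offset, and the
  offset matters only modulo the period. Only the representative is hashed; offset and period are
  sent exactly, in \<open>l\<close> bits each. Errors thus come only from hash collisions between
  different orbits, and strings equal up to the shift are never rejected.\<close>

lemma acs_cyclic_equality:
  assumes n: "n > 0" and Y: "finite Y" "\<And>T. T \<in> Y \<Longrightarrow> length T = n" and l: "n \<le> 2 ^ l"
  shows "acs Y (\<mu> + (l + l)) (\<lambda>T\<^sub>1 T\<^sub>2 m v. T\<^sub>1 = cyc_pow m T\<^sub>2) ((1/2) ^ \<mu>) (\<lambda>T\<^sub>1 T\<^sub>2 m. T\<^sub>1 = cyc_pow m T\<^sub>2) 0"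
proof -
  define orbit :: "'a list \<Rightarrow> 'a list set" where "orbit T = range (\<lambda>m. cyc_pow m T)" for T
  \<comment> \<open>The choice depends only on the orbit as a set, so all rotations of a string get
    the same representative.\<close>
  define rep where "rep T = (SOME W. W \<in> orbit T)" for T
  define off where "off T = (SOME a. a \<in> {0..<int n} \<and> T = cyc_pow a (rep T))" for T
  have orb: "T \<in> orbit T" for T unfolding orbit_def by (rule range_eqI[of _ _ 0]) simp
  have rep: "rep T \<in> orbit T" for T unfolding rep_def by (rule someI[of "\<lambda>W. W \<in> orbit T", OF orb])
  have len: "length (rep T) = length T" for T using rep[of T] by (auto simp: orbit_def)
  have off: "off T \<in> {0..<int n} \<and> T = cyc_pow (off T) (rep T)" if "T \<in> Y" for T
  proof -
    obtain g where g: "rep T = cyc_pow g T" using rep[of T] by (auto simp: orbit_def)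
    have "T = cyc_pow (- g) (rep T)" unfolding g by (simp add: cyc_pow_add)
    then have "T = cyc_pow ((- g) mod int n) (rep T)"
      using cyc_pow_mod_length[of "- g" "rep T"] Y(2)[OF that] len by simp
    moreover have "(- g) mod int n \<in> {0..<int n}" using n by simp
    ultimately have "\<exists>a. a \<in> {0..<int n} \<and> T = cyc_pow a (rep T)" by (intro exI conjI)
    then show ?thesis unfolding off_def by (rule someI_ex)
  qed
  have rep_cong: "rep T\<^sub>1 = rep T\<^sub>2" if "T\<^sub>1 = cyc_pow m T\<^sub>2" for T\<^sub>1 T\<^sub>2 m
  proof -
    have "orbit T\<^sub>1 = orbit T\<^sub>2"
    proof (intro equalityI subsetI)
      fix W assume "W \<in> orbit T\<^sub>1"
      then show "W \<in> orbit T\<^sub>2" unfolding orbit_def that by (auto simp: cyc_pow_add)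
    next
      fix W assume "W \<in> orbit T\<^sub>2"
      then obtain g where "W = cyc_pow g T\<^sub>2" by (auto simp: orbit_def)
      then have "W = cyc_pow (g - m) T\<^sub>1" by (simp add: that cyc_pow_add)
      then show "W \<in> orbit T\<^sub>1" by (auto simp: orbit_def)
    qed
    then show ?thesis by (simp add: rep_def)
  qed
  have eq_iff: "T\<^sub>1 = cyc_pow m T\<^sub>2 \<longleftrightarrow> int (period T\<^sub>1) dvd off T\<^sub>1 - off T\<^sub>2 - m"
    if Ts: "T\<^sub>1 \<in> Y" "T\<^sub>2 \<in> Y" and W: "rep T\<^sub>1 = rep T\<^sub>2" for T\<^sub>1 T\<^sub>2 m
  proof -
    have ne: "T\<^sub>1 \<noteq> []" using Y(2)[OF Ts(1)] n by auto
    let ?W = "rep T\<^sub>1"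
    have 1: "T\<^sub>1 = cyc_pow (off T\<^sub>1) ?W" and 2: "T\<^sub>2 = cyc_pow (off T\<^sub>2) ?W"
      using off[OF Ts(1)] off[OF Ts(2)] W by auto
    have "cyc_pow (m + off T\<^sub>2 - off T\<^sub>1) T\<^sub>1 = cyc_pow (m + off T\<^sub>2 - off T\<^sub>1) (cyc_pow (off T\<^sub>1) ?W)"
      using 1 by simp
    also have "\<dots> = cyc_pow m (cyc_pow (off T\<^sub>2) ?W)" by (simp add: cyc_pow_add)
    also have "\<dots> = cyc_pow m T\<^sub>2" using 2 by simp
    finally have "T\<^sub>1 = cyc_pow m T\<^sub>2 \<longleftrightarrow> cyc_pow (m + off T\<^sub>2 - off T\<^sub>1) T\<^sub>1 = T\<^sub>1" by auto
    also have "\<dots> \<longleftrightarrow> int (period T\<^sub>1) dvd m + off T\<^sub>2 - off T\<^sub>1" by (rule cyc_pow_fixes_iff[OF ne])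
    also have "\<dots> \<longleftrightarrow> int (period T\<^sub>1) dvd off T\<^sub>1 - off T\<^sub>2 - m"
      by (subst dvd_minus_iff[symmetric]) (simp add: algebra_simps)
    finally show ?thesis .
  qed
  let ?P = "Pi_pmf (rep ` Y) 0 (\<lambda>_. pmf_of_set {..<2 ^ \<mu> :: nat})"
  let ?V = "{..<2 ^ \<mu> :: nat} \<times> {0..<int n} \<times> {1..n}"
  define f where "f F T = (F (rep T), off T, period T)" for F :: "'a list \<Rightarrow> nat" and T
  \<comment> \<open>Answering is what certifies the equality; 0 is a placeholder value.\<close>
  define dec where "dec F p p' m =
    (if fst p = fst p' \<and> int (snd (snd p)) dvd fst (snd p) - fst (snd p') - m then Some (0::real) else None)"
    for F :: "'a list \<Rightarrow> nat" and p p' :: "nat \<times> int \<times> nat" and m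
  have U: "finite (rep ` Y)" "finite {..<2 ^ \<mu> :: nat}" "{..<2 ^ \<mu> :: nat} \<noteq> {}"
    using Y by (auto simp: lessThan_empty_iff)
  show ?thesis
  proof (rule acsI[where P = ?P and V = ?V and f = f and dec = dec])
    have "card ?V = 2 ^ \<mu> * (n * n)" by (simp add: card_cartesian_product)
    also have "\<dots> \<le> 2 ^ \<mu> * (2 ^ l * 2 ^ l)" using l by (intro mult_mono) auto
    finally show "card ?V \<le> 2 ^ (\<mu> + (l + l))" by (simp add: power_add)
    show "f F T \<in> ?V" if "F \<in> set_pmf ?P" "T \<in> Y" for F T
    proof -
      have "T \<noteq> []" using Y(2)[OF that(2)] n by auto
      then have "period T \<in> {1..n}" using period_pos[of T] period_le[of T] Y(2)[OF that(2)] by auto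
      moreover have "F (rep T) \<in> {..<2 ^ \<mu>}"
        using that U by (auto simp: set_Pi_pmf PiE_dflt_def set_pmf_of_set[OF U(3,2)])
      ultimately show ?thesis using off[OF that(2)] by (simp add: f_def)
    qed
  next
    fix T\<^sub>1 T\<^sub>2 m assume Ts: "T\<^sub>1 \<in> Y" "T\<^sub>2 \<in> Y"
    show "pr ?P (\<lambda>F. \<exists>v. dec F (f F T\<^sub>1) (f F T\<^sub>2) m = Some v \<and> T\<^sub>1 \<noteq> cyc_pow m T\<^sub>2) \<le> (1/2) ^ \<mu>"
    proof (cases "rep T\<^sub>1 = rep T\<^sub>2")
      case True
      then have "pr ?P (\<lambda>F. \<exists>v. dec F (f F T\<^sub>1) (f F T\<^sub>2) m = Some v \<and> T\<^sub>1 \<noteq> cyc_pow m T\<^sub>2) = 0"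
        using eq_iff[OF Ts] by (intro pr_eq_0) (auto simp: dec_def f_def)
      then show ?thesis by simp
    next
      case False
      have "pr ?P (\<lambda>F. \<exists>v. dec F (f F T\<^sub>1) (f F T\<^sub>2) m = Some v \<and> T\<^sub>1 \<noteq> cyc_pow m T\<^sub>2)
        \<le> pr ?P (\<lambda>F. F (rep T\<^sub>1) = F (rep T\<^sub>2))"
        by (intro pr_mono) (auto simp: dec_def f_def split: if_splits)
      also have "\<dots> \<le> 1 / real (card {..<2 ^ \<mu> :: nat})"
        using Ts False U by (intro pr_random_function_collision) auto
      finally show ?thesis by (simp add: power_one_over)
    qed
  next
    fix T\<^sub>1 T\<^sub>2 m assume Ts: "T\<^sub>1 \<in> Y" "T\<^sub>2 \<in> Y" and eq: "T\<^sub>1 = cyc_pow m T\<^sub>2"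
    have "int (period T\<^sub>1) dvd off T\<^sub>1 - off T\<^sub>2 - m" using eq_iff[OF Ts rep_cong[OF eq], of m] eq by simp
    then have "pr ?P (\<lambda>F. dec F (f F T\<^sub>1) (f F T\<^sub>2) m = None) = 0"
      using rep_cong[OF eq] by (intro pr_eq_0) (simp add: dec_def f_def)
    then show "pr ?P (\<lambda>F. dec F (f F T\<^sub>1) (f F T\<^sub>2) m = None) \<le> 0" by simp
  qed simp
qed

section \<open>Content-defined anchors\<close>

definition masked :: "(int \<Rightarrow> bool) \<Rightarrow> 'a list \<Rightarrow> 'a option list" where
  "masked O' S = map (\<lambda>j. if O' (int j) then Some (S ! j) else None) [0..<length S]"

lemma masked_eq_iff:
  assumes "length S = length T"
  shows "masked O' S = masked O' T \<longleftrightarrow> (\<forall>i\<in>mism S T. \<not> O' i)"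
proof -
  have len: "length (masked O' U) = length U" for U :: "'a list" by (simp add: masked_def)
  have nth: "masked O' S ! j = masked O' T ! j \<longleftrightarrow> (O' (int j) \<longrightarrow> S ! j = T ! j)" if "j < length S" for j
    using that assms by (simp add: masked_def)
  have "masked O' S = masked O' T \<longleftrightarrow> (\<forall>j<length S. O' (int j) \<longrightarrow> S ! j = T ! j)"
    unfolding list_eq_iff_nth_eq len using assms nth by metis
  also have "\<dots> \<longleftrightarrow> (\<forall>i\<in>{0..<int (length S)}. O' i \<longrightarrow> cnth S i = cnth T i)"
  proof (intro iffI ballI allI impI)
    fix i assume *: "\<forall>j<length S. O' (int j) \<longrightarrow> S ! j = T ! j" "i \<in> {0..<int (length S)}" "O' i"
    then have "S ! nat i = T ! nat i" using *(1)[rule_format, of "nat i"] by auto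
    then show "cnth S i = cnth T i" using *(2) assms by (simp add: cnth_def)
  next
    fix j assume *: "\<forall>i\<in>{0..<int (length S)}. O' i \<longrightarrow> cnth S i = cnth T i" "j < length S" "O' (int j)"
    then have "cnth S (int j) = cnth T (int j)" by simp
    then show "S ! j = T ! j" using *(2) assms by (simp add: nth_conv_cnth)
  qed
  also have "\<dots> \<longleftrightarrow> (\<forall>i\<in>mism S T. \<not> O' i)" by (auto simp: mism_def)
  finally show ?thesis .
qed

definition key_pmf :: "nat \<Rightarrow> nat \<Rightarrow> real \<Rightarrow> real \<Rightarrow> ((int \<Rightarrow> bool) \<times> (nat option list \<Rightarrow> bool)) pmf" where
  "key_pmf n \<sigma> q p = pair_pmf (rsub n q)
    (Pi_pmf {xs. set xs \<subseteq> insert None (Some ` {1..\<sigma>}) \<and> length xs = n} False (\<lambda>_. bernoulli_pmf p))"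

definition key :: "(int \<Rightarrow> bool) \<times> (nat option list \<Rightarrow> bool) \<Rightarrow> nat list \<Rightarrow> bool" where
  "key ke S = snd ke (masked (fst ke) S)"

lemma finite_key_pmf [simp]: "finite (set_pmf (key_pmf n \<sigma> q p))"
  unfolding key_pmf_def set_pair_pmf
  by (intro finite_cartesian_product finite_rsub finite_set_Pi_pmf finite_lists_length_eq)
     (auto intro: finite_subset[OF subset_UNIV])

text \<open>Hashing only the symbols at random positions makes the predicate locality sensitive.\<close>

lemma pr_key_key:
  assumes S: "S \<in> strings \<sigma> n" and T: "T \<in> strings \<sigma> n"
    and q: "0 \<le> q" "q \<le> 1" and p: "0 \<le> p" "p \<le> 1"
  shows "pr (key_pmf n \<sigma> q p) (\<lambda>ke. key ke S \<and> key ke T) = p\<^sup>2 + (p - p\<^sup>2) * (1 - q) ^ Ham S T"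
proof -
  let ?C = "{xs. set xs \<subseteq> insert None (Some ` {1..\<sigma>}) \<and> length xs = n}"
  let ?K = "Pi_pmf ?C False (\<lambda>_. bernoulli_pmf p)"
  have len: "length S = n" "length T = n" using S T by (auto simp: strings_def)
  have C: "finite ?C" by (rule finite_lists_length_eq) simp
  have mC: "masked O' U \<in> ?C" if "U \<in> strings \<sigma> n" for O' U
  proof -
    have U: "set U \<subseteq> {1..\<sigma>}" "length U = n" using that by (auto simp: strings_def)
    then have "U ! j \<in> {1..\<sigma>}" if "j < n" for j using that nth_mem by blast
    then show ?thesis using U by (auto simp: masked_def simp del: atLeastAtMost_iff)
  qed
  \<comment> \<open>For fixed \<open>O'\<close>, the two keys are the same random bit if the masked
    strings coincide, with joint probability \<open>p\<close>, and independent bits otherwise, with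
    joint probability \<open>p\<^sup>2\<close>.\<close>
  have inner: "pr ?K (\<lambda>\<kappa>. \<kappa> (masked O' S) \<and> \<kappa> (masked O' T))
    = p\<^sup>2 + (p - p\<^sup>2) * (if \<forall>i\<in>mism S T. \<not> O' i then 1 else 0)" for O'
  proof -
    have "pr ?K (\<lambda>\<kappa>. \<kappa> (masked O' S) \<and> \<kappa> (masked O' T)) = pr ?K (\<lambda>\<kappa>. \<forall>xs\<in>{masked O' S, masked O' T}. \<kappa> xs)"
      by simp
    also have "\<dots> = p ^ card {masked O' S, masked O' T}"
      using mC[OF S] mC[OF T]
      by (subst pr_Pi_pmf_Ball[OF C]) (simp_all add: pr_bernoulli_True[OF p])
    finally show ?thesis
      unfolding masked_eq_iff[OF trans[OF len(1) len(2)[symmetric]], symmetric]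
      by (cases "masked O' S = masked O' T") (simp_all add: power2_eq_square)
  qed
  have "pr (key_pmf n \<sigma> q p) (\<lambda>ke. key ke S \<and> key ke T)
    = pr (pair_pmf (rsub n q) ?K) (\<lambda>(O', \<kappa>). \<kappa> (masked O' S) \<and> \<kappa> (masked O' T))"
    unfolding key_pmf_def by (intro pr_cong) (auto simp: key_def)
  also have "\<dots> = ex (rsub n q) (\<lambda>O'. p\<^sup>2 + (p - p\<^sup>2) * (if \<forall>i\<in>mism S T. \<not> O' i then 1 else 0))"
    unfolding pr_pair_eq inner ..
  also have "\<dots> = p\<^sup>2 + (p - p\<^sup>2) * pr (rsub n q) (\<lambda>O'. \<forall>i\<in>mism S T. \<not> O' i)"
    by (simp add: integrable_measure_pmf_finite ex_indicator)
  also have "pr (rsub n q) (\<lambda>O'. \<forall>i\<in>mism S T. \<not> O' i) = (1 - q) ^ Ham S T"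
    unfolding Ham_eq_card_mism[OF trans[OF len(1) len(2)[symmetric]]]
    by (rule pr_rsub_Ball(2)[OF q]) (auto simp: mism_def len)
  finally show ?thesis .
qed

lemma pr_key:
  assumes "S \<in> strings \<sigma> n" "0 \<le> q" "q \<le> 1" "0 \<le> p" "p \<le> 1"
  shows "pr (key_pmf n \<sigma> q p) (\<lambda>ke. key ke S) = p"
proof -
  have "Ham S S = 0" by (simp add: Ham_def)
  then show ?thesis using pr_key_key[OF assms(1,1,2-)] by simp
qed

section \<open>Near-periods and the birthday argument for anchors\<close>

definition near_periods :: "nat \<Rightarrow> 'a list \<Rightarrow> int set" where
  "near_periods R S = {g\<in>{0..<int (length S)}. Ham S (cyc_pow g S) \<le> R}"

lemma finite_near_periods [simp]: "finite (near_periods R S)"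
  unfolding near_periods_def by (rule finite_Collect_conjI) simp

text \<open>A second-moment bound for the number of aligned pairs of kept rotations. On average
  \<open>t\<close> rotations of \<open>S\<close> have the key, the aligned rotation of
  \<open>T\<close> shares it with probability at least (1 - 1/(4 r))^r >= 3/4, and a pair survives
  both samplings with probability 1/t; so the mean is at least 3/4. The keys of two rotations of
  \<open>S\<close> are strongly correlated only if their difference is a near-period, at most
  \<open>t\<close> cases for each rotation, and the assumption on \<open>R\<close> makes each
  remaining correlation at most 1/n.\<close>

lemma pr_anchor:
  assumes n: "n > 0" and S: "S \<in> strings \<sigma> n" and T: "T \<in> strings \<sigma> n"
    and r: "r \<ge> 1" "Ham S (cyc_pow m T) \<le> r" and t: "1 \<le> t" "t \<le> n" "card (near_periods R S) \<le> t"
    and R: "(1 - 1 / (4 * real r)) ^ (R + 1) \<le> 1 / real n"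
  defines "P \<equiv> pair_pmf (key_pmf n \<sigma> (1 / (4 * real r)) (real t / real n))
      (pair_pmf (rsub n (1 / sqrt t)) (rsub n (1 / sqrt t)))"
  shows "pr P (\<lambda>(ke, A, B). \<exists>i\<in>{0..<int n}. key ke (cyc_pow i S) \<and> key ke (cyc_pow (i + m) T)
      \<and> A i \<and> B ((i + m) mod int n)) \<ge> 9/64"
proof -
  let ?I = "{0..<int n}"
  define q where "q = 1 / (4 * real r)"
  define p where "p = real t / real n"
  define \<alpha> where "\<alpha> = 1 / sqrt t"
  define K where "K = key_pmf n \<sigma> q p"
  have q: "0 \<le> q" "q \<le> 1" using r by (auto simp: q_def)
  have p: "0 \<le> p" "p \<le> 1" using t n by (auto simp: p_def)
  have \<alpha>: "0 \<le> \<alpha>" "\<alpha> \<le> 1" "\<alpha>\<^sup>2 = 1 / real t" using t by (auto simp: \<alpha>_def power_divide)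
  have np: "real n * p = real t" using n by (simp add: p_def)
  have P: "P = pair_pmf K (pair_pmf (rsub n \<alpha>) (rsub n \<alpha>))"
    by (simp add: P_def K_def q_def p_def \<alpha>_def)
  have fin: "finite (set_pmf P)" by (simp add: P K_def)
  have len: "length S = n" using S by (simp add: strings_def)
  define x where "x i = cyc_pow i S" for i
  define y where "y i = cyc_pow (i + m) T" for i
  have xy: "x i \<in> strings \<sigma> n" "y i \<in> strings \<sigma> n" for i using S T by (auto simp: x_def y_def)
  define hit where "hit = (\<lambda>i (A, B). A i \<and> B ((i + m) mod int n))"
  define F where "F i = (\<lambda>(ke, ab). (key ke (x i) \<and> key ke (y i)) \<and> hit i ab)" for i
  have Ham_xy: "Ham (x i) (y i) = Ham S (cyc_pow m T)" for i
    using Ham_cyc_pow_cyc_pow[of S "cyc_pow m T" i] S T by (simp add: x_def y_def cyc_pow_add strings_def)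
  have one: "pr P (F i) \<ge> 3/4 * p / real t" "pr P (F i) \<le> p / real t" if "i \<in> ?I" for i
  proof -
    let ?z = "(1 - q) ^ Ham (x i) (y i)"
    have F: "pr P (F i) = pr K (\<lambda>ke. key ke (x i) \<and> key ke (y i)) * \<alpha>\<^sup>2"
      unfolding F_def P pr_pair_conj using pr_aligned(1)[OF n \<alpha>(1,2) that, of m] by (simp add: hit_def)
    have "1 - real (Ham (x i) (y i)) * q \<le> ?z"
      using Bernoulli_inequality[of "- q" "Ham (x i) (y i)"] q by simp
    moreover have "real (Ham (x i) (y i)) * q \<le> real r * q"
      using r(2) q unfolding Ham_xy by (intro mult_right_mono) auto
    moreover have "real r * q = 1/4" using r by (simp add: q_def)
    ultimately have z: "3/4 \<le> ?z" by linarith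
    have z1: "?z \<le> 1" using q by (intro power_le_one) auto
    have eq: "pr K (\<lambda>ke. key ke (x i) \<and> key ke (y i)) = p\<^sup>2 + (p - p\<^sup>2) * ?z"
      unfolding K_def by (rule pr_key_key[OF xy q p])
    also have "\<dots> = p * ?z + p\<^sup>2 * (1 - ?z)" by (simp add: algebra_simps)
    also have "\<dots> \<ge> p * ?z + 0" using z1 by (intro add_left_mono mult_nonneg_nonneg) auto
    finally have "p * (3/4) \<le> pr K (\<lambda>ke. key ke (x i) \<and> key ke (y i))"
      using mult_left_mono[OF z p(1)] by linarith
    then show "pr P (F i) \<ge> 3/4 * p / real t" unfolding F \<alpha>(3)
      using t by (simp add: field_simps)
    have "pr K (\<lambda>ke. key ke (x i) \<and> key ke (y i)) \<le> pr K (\<lambda>ke. key ke (x i))" by (intro pr_mono) auto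
    also have "\<dots> = p" unfolding K_def by (rule pr_key[OF xy(1) q p])
    finally show "pr P (F i) \<le> p / real t" unfolding F \<alpha>(3)
      using t by (simp add: field_simps)
  qed
  define z where "z i j = (1 - q) ^ Ham (x i) (x j)" for i j
  have z: "0 \<le> z i j" "z i j \<le> 1" for i j using q by (auto simp: z_def intro: power_le_one)
  have two: "pr P (\<lambda>w. F i w \<and> F j w) \<le> (if i = j then p / real t else 0) + (p\<^sup>2 + p * z i j) / (real t)\<^sup>2"
    if ij: "i \<in> ?I" "j \<in> ?I" for i j
  proof (cases "i = j")
    case True
    have "0 \<le> (p\<^sup>2 + p * z i j) / (real t)\<^sup>2" using p z by simp
    then show ?thesis using True one(2)[OF ij(1)] by simp
  next
    case False
    \<comment> \<open>Dropping the keys of \<open>T\<close> costs only a constant factor in the end;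
      the sampling factor 1/t^2 is kept.\<close>
    have "pr P (\<lambda>w. F i w \<and> F j w) \<le> pr P (\<lambda>(ke, ab). (key ke (x i) \<and> key ke (x j)) \<and> (hit i ab \<and> hit j ab))"
      by (intro pr_mono) (auto simp: F_def)
    also have "\<dots> = (p\<^sup>2 + (p - p\<^sup>2) * z i j) * (\<alpha>\<^sup>2)\<^sup>2"
      unfolding P pr_pair_conj K_def pr_key_key[OF xy(1) xy(1) q p] z_def
      using pr_aligned(2)[OF n \<alpha>(1,2) ij False, of m] by (simp add: hit_def)
    also have "\<dots> \<le> (p\<^sup>2 + p * z i j) * (\<alpha>\<^sup>2)\<^sup>2"
      using z[of i j] by (intro mult_right_mono add_left_mono mult_right_mono) auto
    finally show ?thesis using False by (simp add: \<alpha>(3) power_divide)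
  qed
  have zsum: "(\<Sum>j\<in>?I. z i j) \<le> real t + 1" if i: "i \<in> ?I" for i
  proof -
    have z': "z i j \<le> (if (j - i) mod int n \<in> near_periods R S then 1 else 0) + 1 / real n" for j
    proof (cases "(j - i) mod int n \<in> near_periods R S")
      case True
      then show ?thesis using z(2)[of i j] by (simp add: add_increasing2)
    next
      case False
      have "Ham (x i) (x j) = Ham (cyc_pow i S) (cyc_pow i (cyc_pow (j - i) S))"
        by (simp add: x_def cyc_pow_add)
      also have "\<dots> = Ham S (cyc_pow ((j - i) mod int n) S)"
        using cyc_pow_mod_length[of "j - i" S] len by (simp add: Ham_cyc_pow_cyc_pow)
      finally have "Ham (x i) (x j) > R" using False n by (simp add: near_periods_def len)
      then have "z i j \<le> (1 - q) ^ (R + 1)" using q unfolding z_def by (intro power_decreasing) auto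
      then show ?thesis using R False by (simp add: q_def)
    qed
    have "(\<Sum>j\<in>?I. z i j) \<le> (\<Sum>j\<in>?I. (if (j - i) mod int n \<in> near_periods R S then 1 else 0) + 1 / real n)"
      by (intro sum_mono z')
    also have "\<dots> = (\<Sum>j\<in>?I. if (j + (- i)) mod int n \<in> near_periods R S then 1 else 0) + 1"
      using n by (simp add: sum.distrib)
    also have "(\<Sum>j\<in>?I. if (j + (- i)) mod int n \<in> near_periods R S then 1 else (0::real))
      = (\<Sum>j\<in>?I. if j \<in> near_periods R S then 1 else 0)"
      by (rule sum_shift_mod[OF n, of "\<lambda>j. if j \<in> near_periods R S then 1 else 0"])
    also have "\<dots> = real (card (near_periods R S))"
    proof -
      have "?I \<inter> near_periods R S = near_periods R S" by (auto simp: near_periods_def len)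
      then show ?thesis by (simp add: sum.If_cases)
    qed
    finally show ?thesis using t(3) by simp
  qed
  have "(\<Sum>i\<in>?I. pr P (F i)) \<ge> (\<Sum>i\<in>?I. 3/4 * p / real t)" by (intro sum_mono one)
  moreover have "(\<Sum>i\<in>?I. 3/4 * p / real t) = 3/4 * ((real n * p) / real t)" by simp
  ultimately have E1: "(\<Sum>i\<in>?I. pr P (F i)) \<ge> 3/4" using t by (simp only: np) simp
  have "(\<Sum>i\<in>?I. \<Sum>j\<in>?I. pr P (\<lambda>w. F i w \<and> F j w))
    \<le> (\<Sum>i\<in>?I. \<Sum>j\<in>?I. (if i = j then p / real t else 0) + (p\<^sup>2 + p * z i j) / (real t)\<^sup>2)"
    by (intro sum_mono two)
  also have "\<dots> = (\<Sum>i\<in>?I. p / real t + (real n * p\<^sup>2 + p * (\<Sum>j\<in>?I. z i j)) / (real t)\<^sup>2)"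
    by (intro sum.cong refl) (simp add: sum.distrib sum_divide_distrib[symmetric] sum_distrib_left[symmetric])
  also have "\<dots> \<le> (\<Sum>i\<in>?I. p / real t + (real n * p\<^sup>2 + p * (real t + 1)) / (real t)\<^sup>2)"
    using p zsum by (intro sum_mono add_left_mono divide_right_mono mult_left_mono) auto
  also have "\<dots> = real n * p / real t + ((real n * p)\<^sup>2 + (real n * p) * (real t + 1)) / (real t)\<^sup>2"
    by (simp add: power2_eq_square algebra_simps add_divide_distrib)
  also have "\<dots> = 1 + (real t + (real t + 1)) / real t"
    unfolding np using t by (simp add: power2_eq_square field_simps)
  also have "\<dots> \<le> 4" using t by (simp add: field_simps)
  finally have E2: "(\<Sum>i\<in>?I. \<Sum>j\<in>?I. pr P (\<lambda>w. F i w \<and> F j w)) \<le> 4" .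
  \<comment> \<open>The factor 3/16 is the ratio of the bounds 3/4 and 4 on the first and second
    moments, the best choice, with value (3/4)^2/4 = 9/64.\<close>
  have "9/64 \<le> 2 * (3/16) * (\<Sum>i\<in>?I. pr P (F i)) - (3/16)\<^sup>2 * (\<Sum>i\<in>?I. \<Sum>j\<in>?I. pr P (\<lambda>w. F i w \<and> F j w))"
    using E1 E2 by (simp add: power2_eq_square)
  also have "\<dots> \<le> pr P (\<lambda>w. \<exists>i\<in>?I. F i w)" by (rule pr_Bex_second_moment[OF fin]) simp
  also have "\<dots> \<le> pr P (\<lambda>(ke, A, B). \<exists>i\<in>?I. key ke (cyc_pow i S) \<and> key ke (cyc_pow (i + m) T)
      \<and> A i \<and> B ((i + m) mod int n))"
    by (intro pr_mono) (auto simp: F_def hit_def x_def y_def)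
  finally show ?thesis .
qed

text \<open>A kept rotation is stored as its index together with a Hamming sketch. Pairs are aligned
  by index, and every aligned pair has exactly the distance of \<open>S\<close> and
  \<open>cyc_pow m T\<close>, so answers are reliable whether or not the condition holds. The
  decoded pair may depend on the sketches, hence a union bound over all \<open>n\<close> pairs. The
  abstention bound is 1 - 9/64 for finding no pair plus 1/64 for each of two samples outgrowing
  \<open>W\<close>, at least 64 times their mean size sqrt t.\<close>

lemma acs_anchor:
  assumes n: "n > 0"
    and est: "acs (strings \<sigma> n) b\<^sub>0 (\<lambda>S T m v. v \<in> {(1 - \<eta>) * real (Ham S T)..(1 + \<eta>) * real (Ham S T)}) \<delta>
      (\<lambda>_ _ _. True) 0"
    and r: "r \<ge> 1" and t: "1 \<le> t" "t \<le> n" and W: "64 * sqrt t \<le> real W"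
    and R: "(1 - 1 / (4 * real r)) ^ (R + 1) \<le> 1 / real n" and b: "n * 2 ^ b\<^sub>0 + 1 \<le> 2 ^ b"
  shows "acs (strings \<sigma> n) (2 * (b * W))
    (\<lambda>S T m v. v \<in> {(1 - \<eta>) * real (Ham S (cyc_pow m T))..(1 + \<eta>) * real (Ham S (cyc_pow m T))}) (real n * \<delta>)
    (\<lambda>S T m. Ham S (cyc_pow m T) \<le> r \<and> card (near_periods R S) \<le> t) (57/64)"
proof -
  let ?I = "{0..<int n}" and ?X = "strings \<sigma> n"
  from est obtain Q where Q': "realizes Q ?X b\<^sub>0 (\<lambda>S T m v. v \<in> {(1 - \<eta>) * real (Ham S T)..(1 + \<eta>) * real (Ham S T)}) \<delta> (\<lambda>_ _ _. True) 0" unfolding acs_def by blast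
  note Q = realizesD[OF Q']
  define p where "p = real t / real n"
  define \<alpha> where "\<alpha> = 1 / sqrt t"
  define q where "q = 1 / (4 * real r)"
  have q: "0 \<le> q" "q \<le> 1" using r by (auto simp: q_def)
  have p: "0 \<le> p" "p \<le> 1" using t n by (auto simp: p_def)
  have \<alpha>: "0 \<le> \<alpha>" "\<alpha> \<le> 1" using t by (auto simp: \<alpha>_def)
  have W0: "W > 0" using W t by (auto intro!: Nat.gr0I)
  define K where "K = key_pmf n \<sigma> q p"
  let ?R = "rsub n \<alpha>"
  define P where "P = pair_pmf K (pair_pmf ?R ?R)"
  let ?K = "{E. E \<subseteq> ?I \<times> {..<2 ^ b\<^sub>0 :: nat} \<and> card E \<le> W}"
  define sel where "sel ke A S = {i\<in>?I. key ke (cyc_pow i S) \<and> A i}" for ke A S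
  define smp where "smp ke A w S = (\<lambda>i. (i, fst w (cyc_pow i S))) ` sel ke A S"
    for ke A and w :: "nat list sketcher" and S
  define trunc where "trunc E = (if card E \<le> W then E else {})" for E :: "(int \<times> nat) set"
  define f where "f = (\<lambda>((ke, A, B), w) S. (trunc (smp ke A w S), trunc (smp ke B w S)))"
  define cand where "cand E E' m = {(a, c). \<exists>i. (i, a) \<in> E \<and> ((i + m) mod int n, c) \<in> E'}"
    for E E' :: "(int \<times> nat) set" and m
  define dec where "dec z e e' m = (if cand (fst e) (snd e') m = {} then None
      else Some (the (snd (snd z) (fst (SOME a. a \<in> cand (fst e) (snd e') m)) (snd (SOME a. a \<in> cand (fst e) (snd e') m)) 0)))"
    for z :: "(((int \<Rightarrow> bool) \<times> (nat option list \<Rightarrow> bool)) \<times> (int \<Rightarrow> bool) \<times> (int \<Rightarrow> bool)) \<times> nat list sketcher"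
      and e e' :: "(int \<times> nat) set \<times> (int \<times> nat) set" and m
  have finsel: "finite (sel ke A S)" for ke A S
    unfolding sel_def by (rule finite_Collect_conjI) simp
  have csmp: "card (smp ke A w S) = card (sel ke A S)" for ke A w S
    unfolding smp_def by (rule card_image) (simp add: inj_on_def)
  have K: "finite ?K" "card ?K \<le> 2 ^ (b * W)"
  proof -
    show "finite ?K" by (rule card_subsets_card_le(1)) simp
    have "card ?K \<le> (card (?I \<times> {..<2 ^ b\<^sub>0 :: nat}) + 1) ^ W" by (rule card_subsets_card_le(2)) simp
    also have "\<dots> \<le> (2 ^ b) ^ W" using b by (intro power_mono) simp_all
    finally show "card ?K \<le> 2 ^ (b * W)" by (simp add: power_mult)
  qed
  show ?thesis
  proof (rule acsI[where P = "pair_pmf P Q" and V = "?K \<times> ?K" and f = f and dec = dec])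
    show "finite (?K \<times> ?K)" using K by simp
    have "card (?K \<times> ?K) \<le> 2 ^ (b * W) * 2 ^ (b * W)"
      unfolding card_cartesian_product using K by (intro mult_mono) auto
    then show "card (?K \<times> ?K) \<le> 2 ^ (2 * (b * W))" by (simp add: power_add[symmetric] mult_2)
    have "trunc (smp ke A w S) \<in> ?K" if "S \<in> ?X" "w \<in> set_pmf Q" for ke A w S
    proof -
      have "smp ke A w S \<subseteq> ?I \<times> {..<2 ^ b\<^sub>0}"
        using Q(1)[OF that(2)] that(1) by (auto simp: smp_def sel_def)
      then show ?thesis by (simp add: trunc_def)
    qed
    then show "f z S \<in> ?K \<times> ?K" if "z \<in> set_pmf (pair_pmf P Q)" "S \<in> ?X" for z S
      using that by (cases z) (auto simp: f_def split_def)
  next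
    fix S T m assume ST: "S \<in> ?X" "T \<in> ?X"
    let ?h = "real (Ham S (cyc_pow m T))"
    let ?G = "{(1 - \<eta>) * ?h..(1 + \<eta>) * ?h}"
    let ?ans = "\<lambda>w i. answer w (cyc_pow i S) (cyc_pow ((i + m) mod int n) T) 0"
    have len: "length S = n" "length T = n" using ST by (auto simp: strings_def)
    have h: "Ham (cyc_pow i S) (cyc_pow ((i + m) mod int n) T) = Ham S (cyc_pow m T)" for i
      using cyc_pow_mod_length[of "i + m" T] Ham_cyc_pow_cyc_pow[of S "cyc_pow m T" i] len
      by (simp add: cyc_pow_add)
    have bad: "pr Q (\<lambda>w. the (?ans w i) \<notin> ?G) \<le> \<delta>" for i
      using estimatorD[OF Q', of "cyc_pow i S" "cyc_pow ((i + m) mod int n) T" 0] ST by (simp add: h)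
    have "pr (pair_pmf P Q) (\<lambda>z. \<exists>v. dec z (f z S) (f z T) m = Some v \<and> v \<notin> ?G)
      \<le> pr (pair_pmf P Q) (\<lambda>(u, w). \<exists>i\<in>?I. the (?ans w i) \<notin> ?G)"
    proof (rule pr_mono)
      fix z assume *: "\<exists>v. dec z (f z S) (f z T) m = Some v \<and> v \<notin> ?G"
      obtain ke A B w where z: "z = ((ke, A, B), w)" by (cases z) auto
      let ?C = "cand (fst (f z S)) (snd (f z T)) m"
      define a where "a = (SOME a. a \<in> ?C)"
      have ne: "?C \<noteq> {}" and v: "the (snd w (fst a) (snd a) 0) \<notin> ?G"
        using * by (auto simp: dec_def a_def z split: if_splits)
      obtain a' where "a' \<in> ?C" using ne by blast
      then have "a \<in> ?C" unfolding a_def by (rule someI)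
      then obtain i where i: "(i, fst a) \<in> trunc (smp ke A w S)" "((i + m) mod int n, snd a) \<in> trunc (smp ke B w T)"
        by (auto simp: cand_def f_def z split_def)
      then have "i \<in> ?I" "fst a = fst w (cyc_pow i S)" "snd a = fst w (cyc_pow ((i + m) mod int n) T)"
        by (auto simp: trunc_def smp_def sel_def split: if_splits)
      then show "case z of (u, w) \<Rightarrow> \<exists>i\<in>?I. the (?ans w i) \<notin> ?G"
        using v by (auto simp: z answer_def)
    qed
    also have "\<dots> = pr Q (\<lambda>w. \<exists>i\<in>?I. the (?ans w i) \<notin> ?G)" by (rule pr_pair_snd)
    also have "\<dots> \<le> (\<Sum>i\<in>?I. pr Q (\<lambda>w. the (?ans w i) \<notin> ?G))" by (rule pr_Bex) simp
    also have "\<dots> \<le> (\<Sum>i\<in>?I. \<delta>)" by (intro sum_mono bad)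
    finally show "pr (pair_pmf P Q) (\<lambda>z. \<exists>v. dec z (f z S) (f z T) m = Some v \<and> v \<notin> ?G) \<le> real n * \<delta>"
      by simp
  next
    fix S T m assume ST: "S \<in> ?X" "T \<in> ?X" and C: "Ham S (cyc_pow m T) \<le> r \<and> card (near_periods R S) \<le> t"
    have fin: "finite (set_pmf P)" by (simp add: P_def K_def)
    have Ti: "cyc_pow ((i + m) mod int n) T = cyc_pow (i + m) T" for i
      using cyc_pow_mod_length[of "i + m" T] ST by (simp add: strings_def)
    define found where "found = (\<lambda>(ke, A, B). \<exists>i\<in>?I. key ke (cyc_pow i S) \<and> key ke (cyc_pow (i + m) T)
      \<and> A i \<and> B ((i + m) mod int n))"
    define over\<^sub>1 where "over\<^sub>1 = (\<lambda>(ke, A, B :: int \<Rightarrow> bool). real (card (sel ke A S)) > real W)"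
    define over\<^sub>2 where "over\<^sub>2 = (\<lambda>(ke, A :: int \<Rightarrow> bool, B). real (card (sel ke B T)) > real W)"
    have found: "pr P found \<ge> 9/64"
      unfolding found_def P_def K_def q_def p_def \<alpha>_def
      by (rule pr_anchor[OF n ST r _ t _ R]) (use C in auto)
    have mean: "(\<Sum>i\<in>?I. p * \<alpha>) / real W \<le> 1/64"
    proof -
      have "(\<Sum>i\<in>?I. p * \<alpha>) = real t / sqrt t" using n by (simp add: p_def \<alpha>_def)
      also have "\<dots> = sqrt t" by (simp add: real_div_sqrt)
      finally show ?thesis using W W0 by (simp add: field_simps)
    qed
    \<comment> \<open>Used with \<open>fst\<close> and \<open>snd\<close> for \<open>pick\<close>,
      for the two samples.\<close>
    have over: "pr P (\<lambda>z. real (card (sel (fst z) (pick (snd z)) U)) > real W) \<le> 1/64"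
      if "U \<in> ?X" "map_pmf pick (pair_pmf ?R ?R) = ?R" for pick U
    proof -
      have "pr P (\<lambda>z. real (card (sel (fst z) (pick (snd z)) U)) > real W)
        = pr P (\<lambda>z. real (card {i\<in>?I. case z of (ke, ab) \<Rightarrow> key ke (cyc_pow i U) \<and> pick ab i}) > real W)"
        by (intro pr_cong) (simp add: sel_def split_def)
      also have "\<dots> \<le> (\<Sum>i\<in>?I. pr P (\<lambda>z. case z of (ke, ab) \<Rightarrow> key ke (cyc_pow i U) \<and> pick ab i)) / real W"
        using fin W0 by (intro pr_card_markov) auto
      also have "(\<Sum>i\<in>?I. pr P (\<lambda>z. case z of (ke, ab) \<Rightarrow> key ke (cyc_pow i U) \<and> pick ab i)) = (\<Sum>i\<in>?I. p * \<alpha>)"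
      proof (intro sum.cong refl)
        fix i assume i: "i \<in> ?I"
        have "pr (pair_pmf ?R ?R) (\<lambda>ab. pick ab i) = \<alpha>"
          using pr_map[of pick "pair_pmf ?R ?R" "\<lambda>A. A i"] pr_rsub_single[OF \<alpha> i] unfolding that(2) by simp
        then show "pr P (\<lambda>z. case z of (ke, ab) \<Rightarrow> key ke (cyc_pow i U) \<and> pick ab i) = p * \<alpha>"
          unfolding P_def pr_pair_conj K_def using pr_key[OF _ q p, of "cyc_pow i U" \<sigma> n] that(1) by simp
      qed
      also note mean
      finally show ?thesis .
    qed
    have o1: "pr P over\<^sub>1 \<le> 1/64"
      using over[OF ST(1) map_fst_pair_pmf] by (simp add: over\<^sub>1_def split_def)
    have o2: "pr P over\<^sub>2 \<le> 1/64"
      using over[OF ST(2) map_snd_pair_pmf] by (simp add: over\<^sub>2_def split_def)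
    have "pr (pair_pmf P Q) (\<lambda>z. dec z (f z S) (f z T) m = None)
      \<le> pr (pair_pmf P Q) (\<lambda>(u, w). \<not> found u \<or> over\<^sub>1 u \<or> over\<^sub>2 u)"
    proof (rule pr_mono, rule ccontr)
      fix z assume *: "dec z (f z S) (f z T) m = None" "\<not> (case z of (u, w) \<Rightarrow> \<not> found u \<or> over\<^sub>1 u \<or> over\<^sub>2 u)"
      obtain ke A B w where z: "z = ((ke, A, B), w)" by (cases z) auto
      have no: "\<not> over\<^sub>1 (ke, A, B)" "\<not> over\<^sub>2 (ke, A, B)" "found (ke, A, B)" using *(2) by (auto simp: z)
      then have f: "f z S = (smp ke A w S, snd (f z S))" "f z T = (fst (f z T), smp ke B w T)"
        by (auto simp: f_def z trunc_def csmp over\<^sub>1_def over\<^sub>2_def)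
      obtain i where i: "i \<in> ?I" "key ke (cyc_pow i S)" "key ke (cyc_pow (i + m) T)" "A i" "B ((i + m) mod int n)"
        using no(3) unfolding found_def by auto
      have "(i, fst w (cyc_pow i S)) \<in> smp ke A w S" using i by (auto simp: smp_def sel_def)
      moreover have "((i + m) mod int n, fst w (cyc_pow ((i + m) mod int n) T)) \<in> smp ke B w T"
        unfolding smp_def using i n by (intro imageI) (simp add: sel_def Ti)
      ultimately have "cand (smp ke A w S) (smp ke B w T) m \<noteq> {}" unfolding cand_def by blast
      then have "dec z (f z S) (f z T) m \<noteq> None"
        by (subst f(1), subst f(2)) (simp add: dec_def)
      then show False using *(1) by simp
    qed
    also have "\<dots> = pr P (\<lambda>u. \<not> found u \<or> over\<^sub>1 u \<or> over\<^sub>2 u)" by (rule pr_pair_fst)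
    also have "\<dots> \<le> pr P (\<lambda>u. \<not> found u) + (pr P over\<^sub>1 + pr P over\<^sub>2)"
      by (rule order_trans[OF pr_disj add_left_mono[OF pr_disj]])
    also have "\<dots> \<le> 57/64" using found o1 o2 unfolding pr_not by simp
    finally show "pr (pair_pmf P Q) (\<lambda>z. dec z (f z S) (f z T) m = None) \<le> 57/64" .
  qed
qed

section \<open>Denoising strings with many near-periods\<close>

lemma near_periods_mono: "R \<le> R' \<Longrightarrow> near_periods R S \<subseteq> near_periods R' S"
  by (auto simp: near_periods_def)

lemma near_periods_subset: "near_periods R S \<subseteq> {0..<int (length S)}"
  by (auto simp: near_periods_def)

lemma zero_in_near_periods: "S \<noteq> [] \<Longrightarrow> 0 \<in> near_periods R S"
  by (simp add: near_periods_def Ham_def)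

lemma card_near_periods_le: "card (near_periods R S) \<le> length S"
  using card_mono[OF _ near_periods_subset, of S R] by simp

lemma near_periods_add:
  assumes "a \<in> near_periods R S" "b \<in> near_periods R' S"
  shows "(a + b) mod int (length S) \<in> near_periods (R' + R) S"
proof -
  have "S \<noteq> []" using assms(1) by (auto simp: near_periods_def)
  have "Ham S (cyc_pow (a + b) S) \<le> Ham S (cyc_pow a S) + Ham (cyc_pow a S) (cyc_pow (a + b) S)"
    by (rule Ham_triangle) simp_all
  also have "Ham (cyc_pow a S) (cyc_pow (a + b) S) = Ham S (cyc_pow b S)"
    using Ham_cyc_pow_cyc_pow[of S "cyc_pow b S" a] by (simp add: cyc_pow_add)
  finally show ?thesis
    using assms \<open>S \<noteq> []\<close> by (simp add: near_periods_def cyc_pow_mod_length)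
qed

lemma near_periods_cyc_pow: "near_periods R (cyc_pow m S) = near_periods R S"
proof -
  have "Ham (cyc_pow m S) (cyc_pow g (cyc_pow m S)) = Ham S (cyc_pow g S)" for g
    using Ham_cyc_pow_cyc_pow[of S "cyc_pow g S" m] by (simp add: cyc_pow_add add.commute)
  then show ?thesis by (simp add: near_periods_def)
qed

lemma near_periods_close:
  assumes "length S = length T" "Ham S T \<le> r" "R + 2 * r \<le> R'"
  shows "near_periods R S \<subseteq> near_periods R' T"
proof
  fix g assume g: "g \<in> near_periods R S"
  have "Ham T (cyc_pow g T) \<le> Ham T S + Ham S (cyc_pow g T)"
    by (rule Ham_triangle) (simp_all add: assms)
  also have "Ham S (cyc_pow g T) \<le> Ham S (cyc_pow g S) + Ham (cyc_pow g S) (cyc_pow g T)"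
    by (rule Ham_triangle) (simp_all add: assms)
  finally have "Ham T (cyc_pow g T) \<le> Ham S T + (Ham S (cyc_pow g S) + Ham S T)"
    using assms(1) by (simp add: Ham_cyc_pow_cyc_pow Ham_comm[of T S])
  then show "g \<in> near_periods R' T" using g assms by (simp add: near_periods_def)
qed

text \<open>Double counting of pairs of a position and a near-period: each near-period causes at
  most \<open>R\<close> disagreements.\<close>

lemma sum_disagreements:
  assumes "S \<noteq> []"
  shows "(\<Sum>i\<in>{0..<int (length S)}. card {g\<in>near_periods R S. cnth S (i + g) \<noteq> cnth S i})
    \<le> card (near_periods R S) * R"
proof -
  let ?I = "{0..<int (length S)}" and ?G = "near_periods R S"
  have "(\<Sum>i\<in>?I. card {g\<in>?G. cnth S (i + g) \<noteq> cnth S i})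
    = (\<Sum>i\<in>?I. \<Sum>g\<in>?G. if cnth S i \<noteq> cnth S (i + g) then 1 else 0)"
    by (intro sum.cong refl) (auto simp: sum.If_cases Int_def intro!: arg_cong[of _ _ card])
  also have "\<dots> = (\<Sum>g\<in>?G. \<Sum>i\<in>?I. if cnth S i \<noteq> cnth S (i + g) then 1 else 0)"
    by (rule sum.swap)
  also have "\<dots> = (\<Sum>g\<in>?G. Ham S (cyc_pow g S))"
    using assms by (intro sum.cong refl) (simp add: Ham_eq_sum cnth_cyc_pow)
  also have "\<dots> \<le> (\<Sum>g\<in>?G. R)" by (intro sum_mono) (simp add: near_periods_def)
  finally show ?thesis by simp
qed

section \<open>Majority voting over near-periods\<close>

definition votes :: "int set \<Rightarrow> 'a list \<Rightarrow> int \<Rightarrow> 'a \<Rightarrow> nat" where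
  "votes G S i c = card {g\<in>G. cnth S (i + g) = c}"

text \<open>Two strict majorities would overlap, so the choice is unambiguous. The default is the
  symbol at shift 0, so the value depends only on \<open>G\<close> and the function
  \<open>\<lambda>g. cnth S (i + g)\<close>; this makes denoising commute with rotation.\<close>

definition majority :: "int set \<Rightarrow> 'a list \<Rightarrow> int \<Rightarrow> 'a" where
  "majority G S i = (if \<exists>c. 2 * votes G S i c > card G then SOME c. 2 * votes G S i c > card G else cnth S i)"

lemma majority_eqI:
  assumes "finite G" "2 * votes G S i c > card G"
  shows "majority G S i = c"
proof -
  have uniq: "c' = c" if "2 * votes G S i c' > card G" for c'
  proof (rule ccontr)
    assume "c' \<noteq> c"
    then have "card ({g\<in>G. cnth S (i + g) = c'} \<union> {g\<in>G. cnth S (i + g) = c}) = votes G S i c' + votes G S i c"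
      unfolding votes_def using assms(1) by (intro card_Un_disjoint) auto
    moreover have "card ({g\<in>G. cnth S (i + g) = c'} \<union> {g\<in>G. cnth S (i + g) = c}) \<le> card G"
      using assms(1) by (intro card_mono) auto
    ultimately show False using that assms(2) by simp
  qed
  have "2 * votes G S i (SOME c. 2 * votes G S i c > card G) > card G"
    by (rule someI[of "\<lambda>c. 2 * votes G S i c > card G", OF assms(2)])
  then show ?thesis using uniq assms(2) by (auto simp: majority_def)
qed

text \<open>If the sets of near-periods grow slowly from threshold \<open>R\<close> to \<open>R + R\<^sub>0\<close>, then every position
  has a clear majority: a position without one would pass this defect on to all its
  translates by near-periods at threshold \<open>R\<^sub>0\<close>, which are too many.\<close>

lemma clear_majority:
  assumes S: "S \<noteq> []" and grow: "8 * card (near_periods (R + R\<^sub>0) S) \<le> 9 * card (near_periods R S)"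
    and many: "card (near_periods R\<^sub>0 S) > 8 * R"
  shows "\<exists>c. 4 * votes (near_periods R S) S i c \<ge> 3 * card (near_periods R S)"
proof (rule ccontr)
  let ?n = "int (length S)"
  let ?I = "{0..<?n}"
  define G where "G = near_periods R S"
  define G' where "G' = near_periods (R + R\<^sub>0) S"
  define B where "B = near_periods R\<^sub>0 S"
  define dis where "dis u = card {g\<in>G. cnth S (u + g) \<noteq> cnth S u}" for u
  assume "\<not> ?thesis"
  then have low: "4 * votes G S i c < 3 * card G" for c by (auto simp: G_def not_le)
  have fin: "finite G" "finite G'" "finite B" by (simp_all add: G_def G'_def B_def)
  have GG: "G \<subseteq> G'" unfolding G_def G'_def by (rule near_periods_mono) simp
  have n: "length S > 0" using S by simp
  have per: "cnth S (a mod ?n) = cnth S a" for a by simp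
  \<comment> \<open>The votes at \<open>u = b + i\<close> are votes at \<open>i\<close> over the
    translate of \<open>G\<close> by \<open>b\<close>, which lies in \<open>G'\<close>. As
    \<open>G'\<close> exceeds \<open>G\<close> by at most an eighth of \<open>card G\<close>, no
    symbol has more than 3/4 + 1/8 of the votes at \<open>u\<close>, not even the symbol standing
    there, so at least an eighth of \<open>G\<close> disagrees with it. Summed over \<open>B\<close>
    this exceeds the bound of \<open>sum_disagreements\<close>.\<close>
  have one: "card G \<le> 8 * dis ((b + i) mod ?n)" if b: "b \<in> B" for b
  proof -
    define u where "u = (b + i) mod ?n"
    define c where "c = cnth S u"
    have cu: "cnth S (u + g) = cnth S (i + (g + b) mod ?n)" for g
    proof -
      have "(u + g) mod ?n = (i + (g + b) mod ?n) mod ?n"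
        unfolding u_def by (simp add: mod_add_left_eq mod_add_right_eq add_ac)
      then show ?thesis by (metis per)
    qed
    have "card {g\<in>G. cnth S (u + g) = c} \<le> card {g\<in>G'. cnth S (i + g) = c}"
    proof (rule card_inj_on_le[where f = "\<lambda>g. (g + b) mod ?n"])
      show "inj_on (\<lambda>g. (g + b) mod ?n) {g\<in>G. cnth S (u + g) = c}"
        using bij_betw_imp_inj_on[OF bij_betw_add_mod[OF n, of b]]
        by (rule inj_on_subset) (use near_periods_subset[of R S] in \<open>auto simp: G_def\<close>)
      show "(\<lambda>g. (g + b) mod ?n) ` {g\<in>G. cnth S (u + g) = c} \<subseteq> {g\<in>G'. cnth S (i + g) = c}"
      proof (rule image_subsetI)
        fix g assume "g \<in> {g\<in>G. cnth S (u + g) = c}"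
        then have g: "g \<in> G" "cnth S (u + g) = c" by auto
        have "(g + b) mod ?n \<in> near_periods (R\<^sub>0 + R) S"
          using near_periods_add[of g R S b R\<^sub>0] g(1) b by (simp add: G_def B_def)
        then show "(g + b) mod ?n \<in> {g\<in>G'. cnth S (i + g) = c}"
          using g(2) unfolding cu G'_def by (simp add: add.commute)
      qed
      show "finite {g\<in>G'. cnth S (i + g) = c}" using fin by simp
    qed
    also have "\<dots> \<le> card ({g\<in>G. cnth S (i + g) = c} \<union> (G' - G))"
      using fin by (intro card_mono) auto
    also have "\<dots> \<le> votes G S i c + card (G' - G)"
      unfolding votes_def by (rule card_Un_le)
    also have "card (G' - G) = card G' - card G" using fin GG by (intro card_Diff_subset)
    finally have "8 * card {g\<in>G. cnth S (u + g) = c} \<le> 7 * card G"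
      using low[of c] grow by (simp add: G_def[symmetric] G'_def[symmetric])
    moreover have "card {g\<in>G. cnth S (u + g) = c} + dis u = card G"
      unfolding dis_def c_def using fin by (subst card_Un_disjoint[symmetric]) (auto intro!: arg_cong[of _ _ card])
    ultimately show ?thesis by (simp add: u_def)
  qed
  have "card B * card G = (\<Sum>b\<in>B. card G)" by simp
  also have "\<dots> \<le> (\<Sum>b\<in>B. 8 * dis ((b + i) mod ?n))" by (intro sum_mono one)
  also have "\<dots> \<le> (\<Sum>b\<in>?I. 8 * dis ((b + i) mod ?n))"
    by (rule sum_mono2) (auto simp: B_def near_periods_def)
  also have "\<dots> = (\<Sum>u\<in>?I. 8 * dis u)" by (rule sum_shift_mod[OF n])
  also have "\<dots> = 8 * (\<Sum>u\<in>?I. dis u)" by (simp add: sum_distrib_left)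
  also have "\<dots> \<le> 8 * (card G * R)"
    using sum_disagreements[OF S, of R] by (simp add: dis_def G_def)
  finally have "card B * card G \<le> 8 * R * card G" by (simp add: algebra_simps)
  moreover have "card G > 0" using zero_in_near_periods[OF S, of R] fin by (auto simp: G_def card_gt_0_iff)
  ultimately show False using many by (simp add: B_def)
qed

definition denoise :: "nat \<Rightarrow> 'a list \<Rightarrow> 'a list" where
  "denoise R S = map (\<lambda>i. majority (near_periods R S) S (int i)) [0..<length S]"

lemma length_denoise [simp]: "length (denoise R S) = length S"
  by (simp add: denoise_def)

lemma majority_cong:
  assumes "\<And>g. cnth S (i + g) = cnth T (j + g)"
  shows "majority G S i = majority G T j"
  using assms[of 0] by (simp add: majority_def votes_def assms)

lemma cnth_denoise:
  assumes "S \<noteq> []"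
  shows "cnth (denoise R S) i = majority (near_periods R S) S i"
proof -
  let ?n = "int (length S)"
  have n: "?n > 0" using assms by simp
  have "nat (i mod ?n) < length S" using n by (simp add: nat_less_iff)
  then have "cnth (denoise R S) i = majority (near_periods R S) S (i mod ?n)"
    using n by (simp add: cnth_def denoise_def)
  also have "\<dots> = majority (near_periods R S) S i"
  proof (rule majority_cong)
    fix g
    have "(i mod ?n + g) mod ?n = (i + g) mod ?n" by (simp add: mod_add_left_eq)
    then show "cnth S (i mod ?n + g) = cnth S (i + g)" by (simp only: cnth_def)
  qed
  finally show ?thesis .
qed

text \<open>This lets each party denoise its own string without knowing \<open>m\<close>.\<close>

lemma denoise_cyc_pow: "denoise R (cyc_pow m S) = cyc_pow m (denoise R S)"
proof (cases "S = []")
  case False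
  then have ne: "cyc_pow m S \<noteq> []" "denoise R S \<noteq> []"
    by (metis length_0_conv length_cyc_pow, metis length_0_conv length_denoise)
  show ?thesis
  proof (rule list_eq_iff_cnth[THEN iffD2])
    show "\<forall>i\<in>{0..<int (length (denoise R (cyc_pow m S)))}.
      cnth (denoise R (cyc_pow m S)) i = cnth (cyc_pow m (denoise R S)) i"
      using False ne by (auto simp: cnth_denoise cnth_cyc_pow near_periods_cyc_pow add_ac intro!: majority_cong)
  qed simp
qed (simp add: denoise_def)

text \<open>Where a majority overrules the symbol of \<open>S\<close>, at least half of the
  near-periods disagree with that symbol; the total number of disagreements leaves room for at most
  \<open>2 * R\<close> such positions.\<close>

lemma Ham_denoise_le:
  assumes S: "S \<noteq> []" and maj: "\<And>i. \<exists>c. 2 * votes (near_periods R S) S i c > card (near_periods R S)"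
  shows "Ham S (denoise R S) \<le> 2 * R"
proof -
  let ?I = "{0..<int (length S)}"
  define G where "G = near_periods R S"
  define E where "E = mism S (denoise R S)"
  have fin: "finite G" "finite E" by (simp_all add: G_def E_def)
  have one: "card G \<le> 2 * card {g\<in>G. cnth S (i + g) \<noteq> cnth S i}" if i: "i \<in> E" for i
  proof -
    obtain c where c: "2 * votes G S i c > card G" using maj[of i] by (auto simp: G_def)
    have "cnth (denoise R S) i = c" using majority_eqI[OF fin(1) c] by (simp add: cnth_denoise[OF S] G_def)
    then have "c \<noteq> cnth S i" using i by (auto simp: E_def mism_def)
    then have "votes G S i c \<le> card {g\<in>G. cnth S (i + g) \<noteq> cnth S i}"
      unfolding votes_def using fin by (intro card_mono) auto
    then show ?thesis using c by simp
  qed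
  have "card E * card G = (\<Sum>i\<in>E. card G)" by simp
  also have "\<dots> \<le> (\<Sum>i\<in>E. 2 * card {g\<in>G. cnth S (i + g) \<noteq> cnth S i})" by (intro sum_mono one)
  also have "\<dots> \<le> (\<Sum>i\<in>?I. 2 * card {g\<in>G. cnth S (i + g) \<noteq> cnth S i})"
    by (rule sum_mono2) (auto simp: E_def mism_def)
  also have "\<dots> \<le> 2 * (card G * R)"
    using sum_disagreements[OF S, of R] by (simp add: sum_distrib_left[symmetric] G_def)
  finally have "card E * card G \<le> 2 * R * card G" by (simp add: algebra_simps)
  moreover have "card G > 0" using zero_in_near_periods[OF S, of R] fin by (auto simp: G_def card_gt_0_iff)
  ultimately show ?thesis by (simp add: E_def Ham_eq_card_mism)
qed

text \<open>The two strings vote with different sets of near-periods, but those of \<open>T\<close>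
  at the middle threshold \<open>R + R\<^sub>0\<close> lie between those of \<open>S\<close> at
  \<open>R\<close> and at \<open>R + 2 * R\<^sub>0\<close>, and slow growth makes these two nearly
  equal.\<close>

lemma denoise_robust:
  assumes S: "S \<noteq> []" and len: "length S = length T" and close: "Ham S T \<le> r" and R\<^sub>0: "2 * r \<le> R\<^sub>0" "R\<^sub>0 > 0"
    and grow: "8 * card (near_periods (R + 2 * R\<^sub>0) S) \<le> 9 * card (near_periods R S)"
    and many: "card (near_periods R\<^sub>0 S) > 8 * (R + R\<^sub>0)"
  shows "denoise (R + R\<^sub>0) S = denoise (R + R\<^sub>0) T"
    and "Ham S (denoise (R + R\<^sub>0) S) \<le> 2 * (R + R\<^sub>0)" and "Ham T (denoise (R + R\<^sub>0) T) \<le> 2 * (R + R\<^sub>0)"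
proof -
  define Gm where "Gm = near_periods R S"
  define G where "G = near_periods (R + R\<^sub>0) S"
  define Gp where "Gp = near_periods (R + 2 * R\<^sub>0) S"
  define H where "H = near_periods (R + R\<^sub>0) T"
  have fin: "finite Gm" "finite G" "finite Gp" "finite H" by (simp_all add: Gm_def G_def Gp_def H_def)
  have T: "T \<noteq> []" using S len by auto
  have sub: "Gm \<subseteq> G" "G \<subseteq> Gp" unfolding Gm_def G_def Gp_def by (intro near_periods_mono; simp)+
  have subH: "Gm \<subseteq> H" "H \<subseteq> Gp"
    unfolding Gm_def H_def Gp_def
    using near_periods_close[OF len close, of R "R + R\<^sub>0"]
      near_periods_close[of T S r "R + R\<^sub>0" "R + 2 * R\<^sub>0"] len close R\<^sub>0 by (simp_all add: Ham_comm)
  have grow': "8 * card Gp \<le> 9 * card Gm" using grow by (simp add: Gm_def Gp_def)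
  have c1: "card Gm \<le> card G" "card G \<le> card Gp" "card H \<le> card Gp"
    using sub subH fin by (auto intro: card_mono)
  have "card (near_periods R\<^sub>0 S) \<le> card G"
    unfolding G_def using finite_near_periods by (intro card_mono near_periods_mono) auto
  moreover have "16 * r \<le> 8 * (R + R\<^sub>0)" using R\<^sub>0(1) by simp
  ultimately have big: "card G > 16 * r" using many by linarith
  \<comment> \<open>Of 3/4 of the votes, at most an eighth of \<open>card Gm\<close> is lost to the
    change of voters and fewer than a sixteenth of \<open>card G\<close> to changed symbols. More
    than 9/16 of \<open>card Gm\<close> remains, and 9/16 of \<open>card Gm\<close> is at least half
    of \<open>card Gp\<close>, hence of \<open>card H\<close>.\<close>
  have maj: "2 * votes G S i c > card G \<and> 2 * votes H T i c > card H"
    if c: "4 * votes G S i c \<ge> 3 * card G" for i c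
  proof -
    let ?D = "{g\<in>G. cnth S (i + g) \<noteq> cnth T (i + g)}"
    have D: "card ?D \<le> r"
    proof -
      have n: "length S > 0" using S by simp
      have "card ?D \<le> card (mism S T)"
      proof (rule card_inj_on_le[where f = "\<lambda>g. (g + i) mod int (length S)"])
        show "inj_on (\<lambda>g. (g + i) mod int (length S)) ?D"
          using bij_betw_imp_inj_on[OF bij_betw_add_mod[OF n, of i]]
          by (rule inj_on_subset) (use near_periods_subset[of "R + R\<^sub>0" S] in \<open>auto simp: G_def\<close>)
        have "cnth U ((g + i) mod int (length S)) = cnth U (i + g)" if "length U = length S" for g and U :: "'a list"
          using that by (simp add: cnth_def add.commute)
        then show "(\<lambda>g. (g + i) mod int (length S)) ` ?D \<subseteq> mism S T"
          using n len by (auto simp: mism_def add.commute)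
      qed simp
      then show ?thesis using close len by (simp add: Ham_eq_card_mism)
    qed
    have "votes G S i c \<le> card ({g\<in>H. cnth T (i + g) = c} \<union> (Gp - Gm) \<union> ?D)"
      unfolding votes_def using fin sub subH by (intro card_mono) auto
    also have "\<dots> \<le> card ({g\<in>H. cnth T (i + g) = c} \<union> (Gp - Gm)) + card ?D" by (rule card_Un_le)
    also have "\<dots> \<le> votes H T i c + card (Gp - Gm) + r"
      unfolding votes_def using D card_Un_le[of "{g\<in>H. cnth T (i + g) = c}" "Gp - Gm"] by linarith
    also have "card (Gp - Gm) = card Gp - card Gm"
      using fin sub by (intro card_Diff_subset) auto
    finally have "votes G S i c + card Gm \<le> votes H T i c + card Gp + r" using c1 by linarith
    then show ?thesis using c c1 grow' big by linarith
  qed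
  have clear: "\<exists>c. 4 * votes G S i c \<ge> 3 * card G" for i
    unfolding G_def
  proof (rule clear_majority[OF S _ many])
    show "8 * card (near_periods (R + R\<^sub>0 + R\<^sub>0) S) \<le> 9 * card (near_periods (R + R\<^sub>0) S)"
      using grow' c1 by (simp add: G_def Gp_def mult_2 add.assoc)
  qed
  show "denoise (R + R\<^sub>0) S = denoise (R + R\<^sub>0) T"
  proof (rule list_eq_iff_cnth[THEN iffD2])
    show "\<forall>i\<in>{0..<int (length (denoise (R + R\<^sub>0) S))}.
      cnth (denoise (R + R\<^sub>0) S) i = cnth (denoise (R + R\<^sub>0) T) i"
    proof
      fix i
      obtain c where c: "4 * votes G S i c \<ge> 3 * card G" using clear by blast
      have "majority G S i = c" "majority H T i = c" using maj[OF c] fin by (auto intro: majority_eqI)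
      then show "cnth (denoise (R + R\<^sub>0) S) i = cnth (denoise (R + R\<^sub>0) T) i"
        by (simp add: cnth_denoise[OF S] cnth_denoise[OF T] G_def H_def)
    qed
  qed (simp add: len)
  show "Ham S (denoise (R + R\<^sub>0) S) \<le> 2 * (R + R\<^sub>0)"
    by (rule Ham_denoise_le[OF S]) (use maj clear in \<open>unfold G_def, blast\<close>)
  show "Ham T (denoise (R + R\<^sub>0) T) \<le> 2 * (R + R\<^sub>0)"
    by (rule Ham_denoise_le[OF T]) (use maj clear in \<open>unfold H_def, blast\<close>)
qed

text \<open>Six steps by more than 9/8 more than double the value, since 9^6 > 2 * 8^6; over
  \<open>6 * l\<close> steps the bound \<open>2 ^ l\<close> would be exceeded.\<close>

lemma slow_growth_step:
  fixes c :: "nat \<Rightarrow> nat"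
  assumes "c 0 \<ge> 1" "c (6 * l) \<le> 2 ^ l" "l \<ge> 1"
  shows "\<exists>j<6 * l. 8 * c (Suc j) \<le> 9 * c j"
proof (rule ccontr)
  assume "\<not> ?thesis"
  then have step: "9 * c j < 8 * c (Suc j)" if "j < 6 * l" for j using that by auto
  have "9 ^ j \<le> 8 ^ j * c j" if "j \<le> 6 * l" for j
    using that
  proof (induction j)
    case (Suc j)
    then have "9 ^ Suc j \<le> 8 ^ j * (9 * c j)" by simp
    also have "\<dots> \<le> 8 ^ j * (8 * c (Suc j))" using step[of j] Suc.prems by (intro mult_left_mono) auto
    finally show ?case by simp
  qed (use assms in simp)
  from this[of "6 * l"] have "(9 ^ 6) ^ l \<le> (8 ^ 6) ^ l * c (6 * l)" by (simp only: power_mult order_refl)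
  also have "\<dots> \<le> (8 ^ 6) ^ l * 2 ^ l" using assms(2) by (intro mult_left_mono) auto
  also have "\<dots> = (8 ^ 6 * 2) ^ l" by (simp only: power_mult_distrib)
  also have "\<dots> < (9 ^ 6) ^ l" using assms(3) by (intro power_strict_mono) auto
  finally show False by simp
qed

text \<open>Slow growth is sought along the thresholds \<open>(2 * j + 1) * R\<^sub>0\<close>,
  spaced by the window of \<open>denoise_robust\<close>. The denoising threshold
  \<open>(2 * j + 2) * R\<^sub>0\<close> is at most \<open>12 * l * R\<^sub>0\<close>, so 96 is 8 *
  12 and 24 is 2 * 12. The level depends on the string; \<open>acs_scale_denoised\<close> therefore
  offers all of them.\<close>

lemma denoise_exists_level:
  assumes n: "n > 0" "n \<le> 2 ^ l" "l \<ge> 1" and len: "length S = n" "length T = n"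
    and close: "Ham S (cyc_pow m T) \<le> r" and R\<^sub>0: "2 * r \<le> R\<^sub>0" "R\<^sub>0 > 0"
    and many: "card (near_periods R\<^sub>0 S) > 96 * l * R\<^sub>0"
  shows "\<exists>j<6 * l. denoise ((2 * j + 2) * R\<^sub>0) S = cyc_pow m (denoise ((2 * j + 2) * R\<^sub>0) T)
    \<and> Ham S (denoise ((2 * j + 2) * R\<^sub>0) S) \<le> 24 * l * R\<^sub>0 \<and> Ham T (denoise ((2 * j + 2) * R\<^sub>0) T) \<le> 24 * l * R\<^sub>0"
proof -
  have S: "S \<noteq> []" using n len by auto
  define c where "c j = card (near_periods ((2 * j + 1) * R\<^sub>0) S)" for j
  have "c 0 \<ge> 1" using zero_in_near_periods[OF S] by (simp add: c_def Suc_le_eq card_gt_0_iff) blast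
  moreover have "c (6 * l) \<le> 2 ^ l" unfolding c_def using card_near_periods_le[of _ S] n(2) len(1) le_trans by blast
  ultimately obtain j where j: "j < 6 * l" "8 * c (Suc j) \<le> 9 * c j" using slow_growth_step n(3) by blast
  let ?R = "(2 * j + 1) * R\<^sub>0" and ?R' = "(2 * j + 2) * R\<^sub>0"
  have R': "?R + R\<^sub>0 = ?R'" by (simp add: algebra_simps)
  have le: "?R' \<le> 12 * l * R\<^sub>0" using j(1) by (intro mult_right_mono) auto
  have grow: "8 * card (near_periods (?R + 2 * R\<^sub>0) S) \<le> 9 * card (near_periods ?R S)"
    using j(2) by (simp add: c_def algebra_simps)
  have many': "card (near_periods R\<^sub>0 S) > 8 * (?R + R\<^sub>0)" using many le unfolding R' by linarith
  have len': "length S = length (cyc_pow m T)" using len by simp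
  note rob = denoise_robust[OF S len' close R\<^sub>0 grow many', unfolded R' denoise_cyc_pow]
  have "Ham T (denoise ?R' T) = Ham (cyc_pow m T) (cyc_pow m (denoise ?R' T))"
    by (simp add: Ham_cyc_pow_cyc_pow)
  then show ?thesis using rob j(1) le by (intro exI[of _ j]) auto
qed

section \<open>Sketching the residual after denoising\<close>

lemma acs_comap:
  assumes "acs X' b ok \<delta> C \<phi>" "\<And>x. x \<in> X \<Longrightarrow> g x \<in> X'"
  shows "acs X b (\<lambda>x y. ok (g x) (g y)) \<delta> (\<lambda>x y. C (g x) (g y)) \<phi>"
proof -
  from assms(1) obtain P where P': "realizes P X' b ok \<delta> C \<phi>" unfolding acs_def by blast
  note P = realizesD[OF P']
  show ?thesis
    by (rule acsI[where P = P and V = "{..<2 ^ b :: nat}" and f = "\<lambda>w x. fst w (g x)" and dec = snd])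
       (use P assms(2) in \<open>simp_all add: answer_def[symmetric]\<close>)
qed

lemma acs_postprocess:
  assumes "acs X b ok \<delta> C \<phi>" "\<And>x y m v. x \<in> X \<Longrightarrow> y \<in> X \<Longrightarrow> ok x y m v \<Longrightarrow> ok' x y m (g v)"
  shows "acs X b ok' \<delta> C \<phi>"
proof -
  from assms(1) obtain P where P': "realizes P X b ok \<delta> C \<phi>" unfolding acs_def by blast
  note P = realizesD[OF P']
  let ?dec = "\<lambda>(w :: 'a sketcher) a c m. map_option g (snd w a c m)"
  show ?thesis
  proof (rule acsI[where P = P and V = "{..<2 ^ b :: nat}" and f = fst and dec = ?dec])
    fix x y m assume xy: "x \<in> X" "y \<in> X"
    have "pr P (\<lambda>w. \<exists>v. ?dec w (fst w x) (fst w y) m = Some v \<and> \<not> ok' x y m v)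
      \<le> pr P (\<lambda>w. \<exists>v. answer w x y m = Some v \<and> \<not> ok x y m v)"
      using assms(2)[OF xy] by (intro pr_mono) (auto simp: answer_def)
    also have "\<dots> \<le> \<delta>" by (rule P(2)[OF xy])
    finally show "pr P (\<lambda>w. \<exists>v. ?dec w (fst w x) (fst w y) m = Some v \<and> \<not> ok' x y m v) \<le> \<delta>" .
    show "pr P (\<lambda>w. ?dec w (fst w x) (fst w y) m = None) \<le> \<phi>" if "C x y m"
      using P(3)[OF xy that] by (simp add: answer_def)
  qed (use P(1) in auto)
qed

definition residual :: "nat \<Rightarrow> nat list \<Rightarrow> int \<Rightarrow> nat option" where
  "residual R S i = (if i \<in> mism S (denoise R S) then Some (cnth S i) else None)"

lemma dom_residual: "dom (residual R S) = mism S (denoise R S)"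
  by (auto simp: residual_def dom_def)

text \<open>Relative to the common denoised string, a residual position of either string counts as
  one mismatch. Where both are residual this counts 2 although the true contribution is 0 or 1; the
  weight is the difference.\<close>

definition wt_excess :: "nat \<Rightarrow> nat \<Rightarrow> real" where
  "wt_excess c d = (if c \<noteq> d then 1 else 0) - 2"

lemma Ham_eq_residuals:
  assumes S: "length S = n" and T: "length T = n" and n: "n > 0"
    and eq: "denoise R S = cyc_pow m (denoise R T)"
  shows "real (Ham S (cyc_pow m T)) = real (Ham S (denoise R S)) + real (Ham T (denoise R T))
    + wsum n wt_excess (residual R S) (residual R T) m"
proof -
  let ?I = "{0..<int n}" and ?\<pi> = "\<lambda>i. (i + m) mod int n"
  let ?u = "residual R S" and ?v = "residual R T"
  have ne: "S \<noteq> []" "T \<noteq> []" "denoise R T \<noteq> []" using S T n by (auto simp: length_0_conv[symmetric] simp del: length_0_conv)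
  let ?e1 = "\<lambda>i. if i \<in> dom ?u then 1 else (0::real)" and ?e2 = "\<lambda>i. if i \<in> dom ?v then 1 else (0::real)"
  let ?w = "\<lambda>i. wt_excess (the (?u i)) (the (?v (?\<pi> i)))"
  have dens: "cnth (denoise R S) i = cnth (denoise R T) (?\<pi> i)" for i
    unfolding eq using ne T cnth_mod[of "denoise R T" "i + m"] by (simp add: cnth_cyc_pow)
  have pt: "(if cnth S i \<noteq> cnth (cyc_pow m T) i then 1 else 0)
    = ?e1 i + ?e2 (?\<pi> i) + (if i \<in> dom ?u \<and> ?\<pi> i \<in> dom ?v then ?w i else 0)" if i: "i \<in> ?I" for i
  proof -
    have T': "cnth (cyc_pow m T) i = cnth T (?\<pi> i)"
      using ne T cnth_mod[of T "i + m"] by (simp add: cnth_cyc_pow)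
    have u: "i \<in> dom ?u \<longleftrightarrow> cnth S i \<noteq> cnth (denoise R S) i"
      using i S unfolding dom_residual by (simp add: mism_def)
    have v: "?\<pi> i \<in> dom ?v \<longleftrightarrow> cnth T (?\<pi> i) \<noteq> cnth (denoise R S) i"
      using n T unfolding dom_residual dens by (simp add: mism_def)
    have us: "i \<in> dom ?u \<Longrightarrow> the (?u i) = cnth S i" unfolding dom_residual by (simp add: residual_def)
    have vs: "?\<pi> i \<in> dom ?v \<Longrightarrow> the (?v (?\<pi> i)) = cnth T (?\<pi> i)" unfolding dom_residual by (simp add: residual_def)
    show ?thesis
      unfolding T' using u v us vs
      by (cases "i \<in> dom ?u"; cases "?\<pi> i \<in> dom ?v") (simp_all add: wt_excess_def)
  qed
  have cu: "(\<Sum>i\<in>?I. ?e1 i) = real (Ham S (denoise R S))"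
  proof -
    have "?I \<inter> dom ?u = mism S (denoise R S)" unfolding dom_residual by (auto simp: mism_def S)
    then show ?thesis by (simp add: sum.If_cases Ham_eq_card_mism S)
  qed
  have cv: "(\<Sum>i\<in>?I. ?e2 (?\<pi> i)) = real (Ham T (denoise R T))"
  proof -
    have "?I \<inter> dom ?v = mism T (denoise R T)" unfolding dom_residual by (auto simp: mism_def T)
    then have "(\<Sum>i\<in>?I. ?e2 i) = real (Ham T (denoise R T))" by (simp add: sum.If_cases Ham_eq_card_mism T)
    then show ?thesis using sum_shift_mod[OF n, of ?e2 m] by simp
  qed
  have cw: "(\<Sum>i\<in>?I. if i \<in> dom ?u \<and> ?\<pi> i \<in> dom ?v then ?w i else 0) = wsum n wt_excess ?u ?v m"
    unfolding wsum_def overlap_def by (rule sum.inter_filter[symmetric]) simp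
  have "real (Ham S (cyc_pow m T)) = (\<Sum>i\<in>?I. if cnth S i \<noteq> cnth (cyc_pow m T) i then 1 else 0)"
    using Ham_eq_sum[of S "cyc_pow m T"] S T by (auto intro!: sum.cong)
  also have "\<dots> = (\<Sum>i\<in>?I. ?e1 i + ?e2 (?\<pi> i) + (if i \<in> dom ?u \<and> ?\<pi> i \<in> dom ?v then ?w i else 0))"
    by (intro sum.cong refl pt)
  also have "\<dots> = (\<Sum>i\<in>?I. ?e1 i) + (\<Sum>i\<in>?I. ?e2 (?\<pi> i))
      + (\<Sum>i\<in>?I. if i \<in> dom ?u \<and> ?\<pi> i \<in> dom ?v then ?w i else 0)"
    by (simp only: sum.distrib)
  finally show ?thesis by (simp only: cu cv cw)
qed

text \<open>The numbers of residual positions are sent exactly and only the correction is sampled.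
  The equality test guards the answer: an estimate is formed only if the denoised strings appear to
  agree up to the shift, so a wrong level rarely does harm. The extra bit accounts for the message
  \<open>None\<close> of a string with more than \<open>N\<close> residual positions.\<close>

lemma acs_denoised:
  assumes n: "n > 0" "n + 1 \<le> 2 ^ l"
    and sp: "acs (sparse n \<sigma> N) b\<^sub>1 (\<lambda>u v m z. z \<in> {wsum n wt_excess u v m - \<tau>..wsum n wt_excess u v m + \<tau>}) \<delta>\<^sub>1
      (\<lambda>_ _ _. True) 0"
    and eqt: "acs (denoise R ` strings \<sigma> n) b\<^sub>2 (\<lambda>T\<^sub>1 T\<^sub>2 m v. T\<^sub>1 = cyc_pow m T\<^sub>2) \<delta>\<^sub>2 (\<lambda>T\<^sub>1 T\<^sub>2 m. T\<^sub>1 = cyc_pow m T\<^sub>2) 0"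
  shows "acs (strings \<sigma> n) (1 + b\<^sub>2 + l + b\<^sub>1) (\<lambda>S T m v. \<bar>v - real (Ham S (cyc_pow m T))\<bar> \<le> \<tau>) (\<delta>\<^sub>1 + \<delta>\<^sub>2)
    (\<lambda>S T m. denoise R S = cyc_pow m (denoise R T) \<and> Ham S (denoise R S) \<le> N \<and> Ham T (denoise R T) \<le> N) 0"
proof -
  let ?X = "strings \<sigma> n" and ?I = "\<lambda>u v m. {wsum n wt_excess u v m - \<tau>..wsum n wt_excess u v m + \<tau>}"
  from sp obtain P where P': "realizes P (sparse n \<sigma> N) b\<^sub>1 (\<lambda>u v m z. z \<in> ?I u v m) \<delta>\<^sub>1 (\<lambda>_ _ _. True) 0" unfolding acs_def by blast
  note P = realizesD[OF P']
  from eqt obtain Q where Q': "realizes Q (denoise R ` ?X) b\<^sub>2 (\<lambda>T\<^sub>1 T\<^sub>2 m v. T\<^sub>1 = cyc_pow m T\<^sub>2) \<delta>\<^sub>2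
    (\<lambda>T\<^sub>1 T\<^sub>2 m. T\<^sub>1 = cyc_pow m T\<^sub>2) 0" unfolding acs_def by blast
  note Q = realizesD[OF Q']
  define f where "f = (\<lambda>(w :: (int \<Rightarrow> nat option) sketcher, w' :: nat list sketcher) S.
    if Ham S (denoise R S) \<le> N then Some (fst w' (denoise R S), Ham S (denoise R S), fst w (residual R S)) else None)"
  define dec where "dec = (\<lambda>(w :: (int \<Rightarrow> nat option) sketcher, w' :: nat list sketcher)
      (p :: (nat \<times> nat \<times> nat) option) p' m.
    if p = None \<or> p' = None \<or> snd w' (fst (the p)) (fst (the p')) m = None then None
    else Some (real (fst (snd (the p))) + real (fst (snd (the p'))) + the (snd w (snd (snd (the p))) (snd (snd (the p'))) m)))"
  let ?V = "insert None (Some ` ({..<2 ^ b\<^sub>2} \<times> {..n} \<times> {..<2 ^ b\<^sub>1})) :: (nat \<times> nat \<times> nat) option set"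
  have res: "residual R S \<in> sparse n \<sigma> N" if "S \<in> ?X" "Ham S (denoise R S) \<le> N" for S
  proof -
    have len: "length S = n" using that by (simp add: strings_def)
    have "ran (residual R S) \<subseteq> {1..\<sigma>}"
      using cnth_strings[OF that(1) n(1)] by (auto simp: ran_def residual_def split: if_splits)
    moreover have "mism S (denoise R S) \<subseteq> {0..<int n}" by (auto simp: mism_def len)
    moreover have "card (mism S (denoise R S)) \<le> N" using that(2) by (simp add: Ham_eq_card_mism)
    ultimately show ?thesis unfolding sparse_def mem_Collect_eq dom_residual by blast
  qed
  show ?thesis
  proof (rule acsI[where P = "pair_pmf P Q" and V = ?V and f = f and dec = dec])
    show "finite ?V" by simp
    have "card ?V \<le> Suc (card ({..<2 ^ b\<^sub>2 :: nat} \<times> {..n} \<times> {..<2 ^ b\<^sub>1 :: nat}))"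
      by (simp add: card_insert_if card_image)
    also have "\<dots> = 1 + 2 ^ b\<^sub>2 * ((n + 1) * 2 ^ b\<^sub>1)" by (simp add: card_cartesian_product)
    also have "\<dots> \<le> 1 + 2 ^ b\<^sub>2 * (2 ^ l * 2 ^ b\<^sub>1)" using n by (intro add_left_mono mult_mono) auto
    also have "\<dots> = 1 + 2 ^ (b\<^sub>2 + l + b\<^sub>1)" by (simp add: power_add)
    also have "\<dots> \<le> 2 ^ (1 + b\<^sub>2 + l + b\<^sub>1)" by simp
    finally show "card ?V \<le> 2 ^ (1 + b\<^sub>2 + l + b\<^sub>1)" .
  next
    fix z S assume z: "z \<in> set_pmf (pair_pmf P Q)" and S: "S \<in> ?X"
    obtain w w' where zz: "z = (w, w')" "w \<in> set_pmf P" "w' \<in> set_pmf Q" using z by auto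
    have "Ham S (denoise R S) \<le> n" using Ham_le_length[of S "denoise R S"] S by (simp add: strings_def)
    then show "f z S \<in> ?V"
      using P(1)[OF zz(2) res[OF S]] Q(1)[OF zz(3) imageI[OF S]] by (simp add: f_def zz(1) image_iff)
  next
    fix S T m assume ST: "S \<in> ?X" "T \<in> ?X"
    let ?u = "residual R S" and ?v = "residual R T" and ?h = "real (Ham S (cyc_pow m T))"
    have len: "length S = n" "length T = n" using ST by (auto simp: strings_def)
    show "pr (pair_pmf P Q) (\<lambda>z. \<exists>v. dec z (f z S) (f z T) m = Some v \<and> \<not> \<bar>v - ?h\<bar> \<le> \<tau>) \<le> \<delta>\<^sub>1 + \<delta>\<^sub>2"
    proof (cases "Ham S (denoise R S) \<le> N \<and> Ham T (denoise R T) \<le> N")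
      case True
      define bad\<^sub>1 where "bad\<^sub>1 w \<longleftrightarrow> the (answer w ?u ?v m) \<notin> ?I ?u ?v m" for w
      define bad\<^sub>2 where "bad\<^sub>2 w \<longleftrightarrow> (\<exists>v. answer w (denoise R S) (denoise R T) m = Some v \<and> denoise R S \<noteq> cyc_pow m (denoise R T))" for w
      have uv: "?u \<in> sparse n \<sigma> N" "?v \<in> sparse n \<sigma> N" using res ST True by auto
      have b1: "pr P bad\<^sub>1 \<le> \<delta>\<^sub>1" unfolding bad\<^sub>1_def by (rule estimatorD[OF P' uv])
      have b2: "pr Q bad\<^sub>2 \<le> \<delta>\<^sub>2" unfolding bad\<^sub>2_def using Q(2)[of "denoise R S" "denoise R T" m] ST by simp
      have "pr (pair_pmf P Q) (\<lambda>z. \<exists>v. dec z (f z S) (f z T) m = Some v \<and> \<not> \<bar>v - ?h\<bar> \<le> \<tau>)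
        \<le> pr (pair_pmf P Q) (\<lambda>z. (case z of (w, w') \<Rightarrow> bad\<^sub>1 w) \<or> (case z of (w, w') \<Rightarrow> bad\<^sub>2 w'))"
      proof (rule pr_mono, rule ccontr)
        fix z assume *: "\<exists>v. dec z (f z S) (f z T) m = Some v \<and> \<not> \<bar>v - ?h\<bar> \<le> \<tau>"
          "\<not> ((case z of (w, w') \<Rightarrow> bad\<^sub>1 w) \<or> (case z of (w, w') \<Rightarrow> bad\<^sub>2 w'))"
        obtain w w' where z: "z = (w, w')" by (cases z)
        have d: "dec z (f z S) (f z T) m = (if answer w' (denoise R S) (denoise R T) m = None then None
          else Some (real (Ham S (denoise R S)) + real (Ham T (denoise R T)) + the (answer w ?u ?v m)))"
          using True by (simp add: dec_def f_def z answer_def)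
        then obtain v where v: "v = real (Ham S (denoise R S)) + real (Ham T (denoise R T)) + the (answer w ?u ?v m)"
          "answer w' (denoise R S) (denoise R T) m \<noteq> None" "\<not> \<bar>v - ?h\<bar> \<le> \<tau>"
          using *(1) by (auto split: if_splits)
        have "denoise R S = cyc_pow m (denoise R T)" using v(2) *(2) by (auto simp: bad\<^sub>2_def z)
        note h = Ham_eq_residuals[OF len n(1) this]
        have "the (answer w ?u ?v m) \<in> ?I ?u ?v m" using *(2) by (auto simp: bad\<^sub>1_def z)
        then show False using v(3) unfolding v(1) h atLeastAtMost_iff abs_le_iff by linarith
      qed
      also have "\<dots> \<le> pr (pair_pmf P Q) (\<lambda>z. case z of (w, w') \<Rightarrow> bad\<^sub>1 w) + pr (pair_pmf P Q) (\<lambda>z. case z of (w, w') \<Rightarrow> bad\<^sub>2 w')"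
        by (rule pr_disj)
      also have "\<dots> \<le> \<delta>\<^sub>1 + \<delta>\<^sub>2" unfolding pr_pair_fst pr_pair_snd using b1 b2 by simp
      finally show ?thesis .
    next
      case False
      \<comment> \<open>Nothing is answered here, and it remains to see that the error bounds are
        nonnegative. Each follows by applying its scheme to some input; for
        \<open>\<delta>\<^sub>1\<close> the empty partial word serves.\<close>
      have nn: "0 \<le> \<delta>\<^sub>2" using Q(2)[OF imageI[OF ST(1)] imageI[OF ST(1)], of 0] order_trans[OF pr_nonneg] by blast
      have "(\<lambda>_. None) \<in> sparse n \<sigma> N" by (simp add: sparse_def dom_def ran_def)
      then have "0 \<le> \<delta>\<^sub>1" using P(2) order_trans[OF pr_nonneg] by blast
      then show ?thesis using False nn by (subst pr_eq_0) (auto simp: dec_def f_def split_def)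
    qed
  next
    fix S T m assume ST: "S \<in> ?X" "T \<in> ?X"
      and C: "denoise R S = cyc_pow m (denoise R T) \<and> Ham S (denoise R S) \<le> N \<and> Ham T (denoise R T) \<le> N"
    have "pr (pair_pmf P Q) (\<lambda>z. dec z (f z S) (f z T) m = None)
      = pr (pair_pmf P Q) (\<lambda>(w, w'). answer w' (denoise R S) (denoise R T) m = None)"
      using C by (intro pr_cong) (auto simp: dec_def f_def answer_def split: if_splits)
    also have "\<dots> = pr Q (\<lambda>w'. answer w' (denoise R S) (denoise R T) m = None)" by (rule pr_pair_snd)
    also have "\<dots> \<le> 0" using Q(3)[of "denoise R S" "denoise R T" m] ST C by blast
    finally show "pr (pair_pmf P Q) (\<lambda>z. dec z (f z S) (f z T) m = None) \<le> 0" .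
  qed
qed

section \<open>All mismatch counts up to a given scale\<close>

lemma real_nat_ceiling_le: "0 \<le> a \<Longrightarrow> real (nat \<lceil>a\<rceil>) \<le> a + 1"
  by linarith

lemma mult_power2_Suc_le:
  fixes n :: nat
  assumes "n \<le> 2 ^ l"
  shows "n * 2 ^ b + 1 \<le> 2 ^ (l + b + 1)"
proof -
  have "n * 2 ^ b + 1 \<le> 2 ^ l * 2 ^ b + 2 ^ l * 2 ^ b" using assms by (intro add_mono) simp_all
  then show ?thesis by (simp add: power_add)
qed

text \<open>The choice R = 4 r l for \<open>pr_anchor\<close>: the power is at most exp(-l) <=
  2^(-l) <= 1/n.\<close>

lemma power_one_minus_le:
  assumes "r \<ge> 1" "0 < n" "n \<le> 2 ^ l"
  shows "(1 - 1 / (4 * real r)) ^ (4 * r * l + 1) \<le> 1 / real n"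
proof -
  let ?x = "1 / (4 * real r)"
  have x: "0 \<le> 1 - ?x" "1 - ?x \<le> 1" using assms(1) by (auto simp: field_simps)
  have "(1 - ?x) ^ (4 * r * l + 1) \<le> (1 - ?x) ^ (4 * r * l)" using x by (intro power_decreasing) auto
  also have "\<dots> \<le> (exp (- ?x)) ^ (4 * r * l)"
    using x exp_ge_add_one_self[of "- ?x"] by (intro power_mono) auto
  also have "\<dots> = exp (- 1) ^ l"
    using assms(1) by (simp add: exp_of_nat_mult[symmetric] field_simps)
  also have "\<dots> \<le> (1/2) ^ l"
  proof (rule power_mono)
    have "2 \<le> exp (1::real)" using exp_ge_add_one_self[of 1] by simp
    then show "exp (- 1) \<le> (1/2 :: real)" by (simp add: exp_minus field_simps)
  qed simp
  also have "\<dots> = 1 / 2 ^ l" by (simp add: power_one_over)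
  also have "\<dots> \<le> 1 / real n"
    using assms(2,3) by (intro divide_left_mono) (simp_all flip: of_nat_le_iff)
  finally show ?thesis .
qed

text \<open>The tolerance contains the maximum with \<open>r\<close> to match the denoised case,
  where the error is absolute. Since (57/64)^6 <= 1/2, repeating \<open>6 * \<mu>\<close> times
  brings abstention down to 2^(-\<mu>). The bound 384 r l^2 is 96 l (4 r l), beyond which
  \<open>denoise_exists_level\<close> applies.\<close>

lemma acs_scale_anchor:
  assumes n: "n > 0" "n \<le> 2 ^ l" "l \<ge> 1" and \<eta>: "0 < \<eta>" "\<eta> \<le> 1" and r: "r \<ge> 1" and \<mu>: "\<mu> = 16 * l"
  shows "\<exists>b. real b \<le> 4 * 10 ^ 8 * real l ^ 6 * sqrt r / \<eta>\<^sup>2 \<and>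
    acs (strings \<sigma> n) b
      (\<lambda>S T m v. \<bar>v - real (Ham S (cyc_pow m T))\<bar> \<le> \<eta> * max (real r) (real (Ham S (cyc_pow m T))))
      (real (6 * \<mu>) * (real n * (1/2) ^ \<mu>))
      (\<lambda>S T m. Ham S (cyc_pow m T) \<le> r \<and> card (near_periods (4 * r * l) S) \<le> 384 * r * l ^ 2) ((1/2) ^ \<mu>)"
proof -
  define x where "x = real l"
  define y where "y = sqrt r"
  define z where "z = 1 / \<eta>"
  have x: "x \<ge> 1" using n by (simp add: x_def)
  have y: "y \<ge> 1" using r by (simp add: y_def)
  have z: "z \<ge> 1" using \<eta> by (simp add: z_def)
  have z2: "1 \<le> z\<^sup>2" using z by simp
  define q where "q = nat \<lceil>32 * z\<^sup>2\<rceil>"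
  define b\<^sub>0 where "b\<^sub>0 = \<mu> * (q * (l + 2))"
  \<comment> \<open>\<open>acs_anchor\<close> requires \<open>t \<le> n\<close>, and a string of
    length \<open>n\<close> has at most \<open>n\<close> near-periods.\<close>
  define t where "t = min n (384 * r * l ^ 2)"
  define W where "W = nat \<lceil>64 * sqrt t\<rceil>"
  define b where "b = l + b\<^sub>0 + 1"
  have q: "32 / \<eta>\<^sup>2 \<le> real q" "real q \<le> 33 * z\<^sup>2"
  proof -
    show "32 / \<eta>\<^sup>2 \<le> real q" using real_nat_ceiling_ge[of "32 * z\<^sup>2"] by (simp add: q_def z_def power_divide)
    have "real q \<le> 32 * z\<^sup>2 + 1" unfolding q_def by (rule real_nat_ceiling_le) simp
    then show "real q \<le> 33 * z\<^sup>2" using z2 by linarith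
  qed
  have b0: "real b\<^sub>0 \<le> 1584 * x\<^sup>2 * z\<^sup>2"
  proof -
    have "real q * (x + 2) \<le> (33 * z\<^sup>2) * (3 * x)" using q(2) x by (intro mult_mono) auto
    then have "16 * x * (real q * (x + 2)) \<le> 16 * x * ((33 * z\<^sup>2) * (3 * x))"
      using x by (intro mult_left_mono) auto
    then show ?thesis by (simp add: b\<^sub>0_def \<mu> x_def power2_eq_square algebra_simps)
  qed
  have xz: "x \<le> x\<^sup>2 * z\<^sup>2" "1 \<le> x\<^sup>2 * z\<^sup>2"
  proof -
    have "x * 1 \<le> x\<^sup>2 * z\<^sup>2" using x z2 by (intro mult_mono) (auto simp: power2_eq_square)
    then show "x \<le> x\<^sup>2 * z\<^sup>2" by simp
    then show "1 \<le> x\<^sup>2 * z\<^sup>2" using x by linarith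
  qed
  have bb: "real b \<le> 1586 * (x\<^sup>2 * z\<^sup>2)" using b0 xz by (simp add: b_def x_def)
  have t: "1 \<le> t" "t \<le> n" using n r by (auto simp: t_def Suc_le_eq)
  have W: "64 * sqrt t \<le> real W" "real W \<le> 1281 * (x * y)"
  proof -
    show "64 * sqrt t \<le> real W" unfolding W_def by (rule real_nat_ceiling_ge)
    have "real t \<le> real (384 * r * l ^ 2)" unfolding of_nat_le_iff t_def by simp
    then have "real t \<le> 384 * real r * x\<^sup>2" by (simp add: x_def)
    also have "\<dots> \<le> (20 * (x * y))\<^sup>2" by (simp add: y_def power_mult_distrib)
    finally have "sqrt t \<le> 20 * (x * y)" using x y by (intro real_le_lsqrt) auto
    moreover have "real W \<le> 64 * sqrt t + 1" unfolding W_def by (rule real_nat_ceiling_le) simp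
    moreover have "1 * 1 \<le> x * y" using x y by (intro mult_mono) auto
    ultimately show "real W \<le> 1281 * (x * y)" by linarith
  qed
  have est: "acs (strings \<sigma> n) b\<^sub>0 (\<lambda>S T m v. v \<in> {(1 - \<eta>) * real (Ham S T)..(1 + \<eta>) * real (Ham S T)}) ((1/2) ^ \<mu>) (\<lambda>_ _ _. True) 0"
    unfolding b\<^sub>0_def by (rule acs_tug_of_war[OF n(1) \<eta>(1) q(1)]) (use n in simp)
  have nb: "n * 2 ^ b\<^sub>0 + 1 \<le> 2 ^ b" unfolding b_def by (rule mult_power2_Suc_le[OF n(2)])
  note rep = acs_repeat[OF acs_anchor[OF n(1) est r t W(1) power_one_minus_le[OF r n(1,2)] nb], of "6 * \<mu>"]
  show ?thesis
  proof (intro exI conjI)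
    show "acs (strings \<sigma> n) (6 * \<mu> * (2 * (b * W)))
      (\<lambda>S T m v. \<bar>v - real (Ham S (cyc_pow m T))\<bar> \<le> \<eta> * max (real r) (real (Ham S (cyc_pow m T))))
      (real (6 * \<mu>) * (real n * (1/2) ^ \<mu>))
      (\<lambda>S T m. Ham S (cyc_pow m T) \<le> r \<and> card (near_periods (4 * r * l) S) \<le> 384 * r * l ^ 2) ((1/2) ^ \<mu>)"
    proof (rule acs_mono[OF rep])
      have "(57/64 :: real) ^ (6 * \<mu>) = ((57/64) ^ 6) ^ \<mu>" by (rule power_mult)
      also have "\<dots> \<le> (1/2) ^ \<mu>" by (intro power_mono) (simp_all add: power_divide)
      finally show "(57/64 :: real) ^ (6 * \<mu>) \<le> (1/2) ^ \<mu>" .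
      show "\<bar>v - real (Ham S (cyc_pow m T))\<bar> \<le> \<eta> * max (real r) (real (Ham S (cyc_pow m T)))"
        if "v \<in> {(1 - \<eta>) * real (Ham S (cyc_pow m T))..(1 + \<eta>) * real (Ham S (cyc_pow m T))}" for S T m v
      proof -
        have "\<bar>v - real (Ham S (cyc_pow m T))\<bar> \<le> \<eta> * real (Ham S (cyc_pow m T))"
          using that unfolding abs_le_iff atLeastAtMost_iff left_diff_distrib distrib_right by linarith
        also have "\<dots> \<le> \<eta> * max (real r) (real (Ham S (cyc_pow m T)))" using \<eta> by (intro mult_left_mono) auto
        finally show ?thesis .
      qed
      show "Ham S (cyc_pow m T) \<le> r \<and> card (near_periods (4 * r * l) S) \<le> t"
        if "S \<in> strings \<sigma> n" "Ham S (cyc_pow m T) \<le> r \<and> card (near_periods (4 * r * l) S) \<le> 384 * r * l ^ 2" for S T m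
        using that card_near_periods_le[of "4 * r * l" S] by (simp add: t_def strings_def)
    qed simp_all
    have "real b * real W \<le> (1586 * (x\<^sup>2 * z\<^sup>2)) * (1281 * (x * y))"
      using bb W(2) by (intro mult_mono) auto
    then have "96 * x * (2 * (real b * real W)) \<le> 96 * x * (2 * ((1586 * (x\<^sup>2 * z\<^sup>2)) * (1281 * (x * y))))"
      using x by (intro mult_left_mono) auto
    also have "\<dots> = 390079872 * (x ^ 4 * y * z\<^sup>2)" by (simp add: power2_eq_square power4_eq_xxxx mult_ac)
    also have "\<dots> \<le> 4 * 10 ^ 8 * (x ^ 6 * y * z\<^sup>2)"
      using x y z by (intro mult_mono power_increasing) auto
    finally show "real (6 * \<mu> * (2 * (b * W))) \<le> 4 * 10 ^ 8 * real l ^ 6 * sqrt r / \<eta>\<^sup>2"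
      by (simp add: \<mu> x_def y_def z_def power_divide mult_ac)
  qed
qed

lemma wsum_excess_squared_le:
  assumes "u \<in> sparse n \<sigma> N"
  shows "wsum n (\<lambda>c d. (wt_excess c d)\<^sup>2) u v m \<le> 4 * real N"
proof -
  have u: "finite (dom u)" "card (dom u) \<le> N"
    using assms finite_subset[of "dom u" "{0..<int n}"] by (auto simp: sparse_def)
  have "wsum n (\<lambda>c d. (wt_excess c d)\<^sup>2) u v m \<le> (\<Sum>i\<in>overlap n u v m. 4)"
    unfolding wsum_def by (intro sum_mono) (simp add: wt_excess_def)
  also have "\<dots> \<le> 4 * real (card (dom u))"
    using card_mono[OF u(1), of "overlap n u v m"] by (auto simp: overlap_def)
  finally show ?thesis using u(2) by simp
qed

lemma acs_scale_denoised:
  assumes n: "n > 0" "n \<le> 2 ^ l" "l \<ge> 1" and \<eta>: "0 < \<eta>" "\<eta> \<le> 1" and r: "r \<ge> 1" and \<mu>: "\<mu> = 16 * l"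
  shows "\<exists>b. real b \<le> 24 * 10 ^ 8 * real l ^ 6 * sqrt r / \<eta>\<^sup>2 \<and>
    acs (strings (2 ^ \<mu>) n) b
      (\<lambda>S T m v. \<bar>v - real (Ham S (cyc_pow m T))\<bar> \<le> \<eta> * max (real r) (real (Ham S (cyc_pow m T))))
      (real (6 * l) * (2 * (1/2) ^ \<mu>))
      (\<lambda>S T m. Ham S (cyc_pow m T) \<le> r \<and> card (near_periods (4 * r * l) S) > 384 * r * l ^ 2) 0"
proof -
  define x where "x = real l"
  define y where "y = sqrt r"
  define z where "z = 1 / \<eta>"
  have x: "x \<ge> 1" using n by (simp add: x_def)
  have y: "y \<ge> 1" "y\<^sup>2 = real r" using r by (simp_all add: y_def)
  have z: "z \<ge> 1" using \<eta> by (simp add: z_def)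
  \<comment> \<open>This is \<open>24 * l * R\<^sub>0\<close> for
    \<open>R\<^sub>0 = 4 * r * l\<close>, the number of changed positions allowed by
    \<open>denoise_exists_level\<close>.\<close>
  define N where "N = 96 * r * l ^ 2"
  have N: "real N = 96 * y\<^sup>2 * x\<^sup>2" "N > 0" using r n by (simp_all add: N_def x_def y(2))
  \<comment> \<open>The squared weights sum to at most 4 N, and the rate solves 4 N/\<alpha>^2 =
    (\<eta> r)^2/32. If this is above 1, everything is kept and the variance is 0.\<close>
  define \<alpha> where "\<alpha> = min 1 (sqrt (128 * real N) / (\<eta> * real r))"
  have \<alpha>: "0 < \<alpha>" "\<alpha> \<le> 1" using N r \<eta> by (auto simp: \<alpha>_def)
  define W where "W = nat \<lceil>64 * \<alpha> * real N\<rceil> + 1"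
  have W: "W > 0" "64 * \<alpha> * real N \<le> real W"
    using real_nat_ceiling_ge[of "64 * \<alpha> * real N"] by (simp_all add: W_def)
  have mono: "1 \<le> x ^ 3 * y * z"
  proof -
    have "1 * 1 * 1 \<le> x ^ 3 * y * z" using x y z by (intro mult_mono) auto
    then show ?thesis by simp
  qed
  have WU: "real W \<le> 681986 * (x ^ 3 * y * z)"
  proof -
    have "sqrt (128 * real N) \<le> 111 * (x * y)"
      using x y by (intro real_le_lsqrt) (auto simp: N(1) power_mult_distrib)
    then have "\<alpha> * real N \<le> (111 * (x * y)) / (\<eta> * real r) * real N"
      using \<eta> r unfolding \<alpha>_def by (intro mult_right_mono min.coboundedI2 divide_right_mono) auto
    also have "\<dots> = 10656 * (x ^ 3 * y * z)"
    proof -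
      have "real r \<noteq> 0" using r by simp
      then show ?thesis using \<eta> unfolding N(1) y(2) by (simp add: z_def power3_eq_cube power2_eq_square)
    qed
    finally have "64 * \<alpha> * real N \<le> 681984 * (x ^ 3 * y * z)" by linarith
    moreover have "real W \<le> 64 * \<alpha> * real N + 2"
    proof -
      have "real (nat \<lceil>64 * \<alpha> * real N\<rceil>) \<le> 64 * \<alpha> * real N + 1"
        by (rule real_nat_ceiling_le) (use \<alpha> in simp)
      then show ?thesis unfolding W_def by simp
    qed
    ultimately show ?thesis using mono by linarith
  qed
  define b\<^sub>1 where "b\<^sub>1 = \<mu> * (2 * ((l + \<mu> + 1) * W))"
  have sp: "acs (sparse n (2 ^ \<mu>) N) b\<^sub>1
    (\<lambda>u v m z. z \<in> {wsum n wt_excess u v m - \<eta> * real r..wsum n wt_excess u v m + \<eta> * real r}) ((1/2) ^ \<mu>) (\<lambda>_ _ _. True) 0"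
    unfolding b\<^sub>1_def
  proof (rule acs_sparse[OF n(1) \<alpha> W order_refl mult_power2_Suc_le[OF n(2)], where \<tau> = "\<lambda>_ _ _. \<eta> * real r"])
    fix u v m assume u: "u \<in> sparse n (2 ^ \<mu>) N"
    show "0 \<le> \<eta> * real r" using \<eta> by simp
    show "wsum n (\<lambda>c d. (wt_excess c d)\<^sup>2) u v m * (1 / \<alpha>\<^sup>2 - 1) \<le> (\<eta> * real r)\<^sup>2 / 32"
    proof (cases "\<alpha> = 1")
      case False
      then have a: "\<alpha> = sqrt (128 * real N) / (\<eta> * real r)" by (auto simp: \<alpha>_def min_def split: if_splits)
      have "wsum n (\<lambda>c d. (wt_excess c d)\<^sup>2) u v m * (1 / \<alpha>\<^sup>2 - 1) \<le> 4 * real N * (1 / \<alpha>\<^sup>2 - 1)"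
        using \<alpha> wsum_excess_squared_le[OF u] by (intro mult_right_mono) (auto simp: power_le_one)
      also have "\<dots> \<le> 4 * real N * (1 / \<alpha>\<^sup>2)" by (intro mult_left_mono) auto
      also have "\<dots> = (\<eta> * real r)\<^sup>2 / 32" using N(2) by (simp add: a power_divide)
      finally show ?thesis .
    qed simp
  qed
  define B where "B = 1 + (\<mu> + (l + l)) + (l + 1) + b\<^sub>1"
  have level: "acs (strings (2 ^ \<mu>) n) B (\<lambda>S T m v. \<bar>v - real (Ham S (cyc_pow m T))\<bar> \<le> \<eta> * real r) (2 * (1/2) ^ \<mu>)
    (\<lambda>S T m. denoise R S = cyc_pow m (denoise R T) \<and> Ham S (denoise R S) \<le> N \<and> Ham T (denoise R T) \<le> N) 0" for R
  proof -
    have "acs (denoise R ` strings (2 ^ \<mu>) n) (\<mu> + (l + l)) (\<lambda>T\<^sub>1 T\<^sub>2 m v. T\<^sub>1 = cyc_pow m T\<^sub>2) ((1/2) ^ \<mu>)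
      (\<lambda>T\<^sub>1 T\<^sub>2 m. T\<^sub>1 = cyc_pow m T\<^sub>2) 0"
      using n by (intro acs_cyclic_equality finite_imageI finite_strings) (auto simp: length_strings)
    note eqt = this
    have n': "n + 1 \<le> 2 ^ (l + 1)" using n by simp
    have dbl: "(1/2) ^ \<mu> + (1/2) ^ \<mu> = 2 * (1/2 :: real) ^ \<mu>" by simp
    show ?thesis using acs_denoised[OF n(1) n' sp eqt] unfolding B_def dbl .
  qed
  note fam = acs_family[OF level, of "6 * l" "\<lambda>j. (2 * j + 2) * (4 * r * l)"]
  show ?thesis
  proof (intro exI conjI)
    show "acs (strings (2 ^ \<mu>) n) (6 * l * B)
      (\<lambda>S T m v. \<bar>v - real (Ham S (cyc_pow m T))\<bar> \<le> \<eta> * max (real r) (real (Ham S (cyc_pow m T))))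
      (real (6 * l) * (2 * (1/2) ^ \<mu>))
      (\<lambda>S T m. Ham S (cyc_pow m T) \<le> r \<and> card (near_periods (4 * r * l) S) > 384 * r * l ^ 2) 0"
    proof (rule acs_mono[OF fam])
      show "\<bar>v - real (Ham S (cyc_pow m T))\<bar> \<le> \<eta> * max (real r) (real (Ham S (cyc_pow m T)))"
        if "\<bar>v - real (Ham S (cyc_pow m T))\<bar> \<le> \<eta> * real r" for S T m v
      proof -
        have "\<eta> * real r \<le> \<eta> * max (real r) (real (Ham S (cyc_pow m T)))" using \<eta> by (intro mult_left_mono) auto
        then show ?thesis using that by linarith
      qed
      fix S T :: "nat list" and m
      assume ST: "S \<in> strings (2 ^ \<mu>) n" "T \<in> strings (2 ^ \<mu>) n"
        and C: "Ham S (cyc_pow m T) \<le> r \<and> card (near_periods (4 * r * l) S) > 384 * r * l ^ 2"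
      have len: "length S = n" "length T = n" using ST by (auto simp: strings_def)
      have "2 * r \<le> 4 * r * l" using n(3) by (cases l) auto
      moreover have "4 * r * l > 0" using r n(3) by auto
      moreover have "card (near_periods (4 * r * l) S) > 96 * l * (4 * r * l)"
        using C by (simp add: power2_eq_square mult_ac)
      ultimately obtain j where "j < 6 * l"
        "denoise ((2 * j + 2) * (4 * r * l)) S = cyc_pow m (denoise ((2 * j + 2) * (4 * r * l)) T)"
        "Ham S (denoise ((2 * j + 2) * (4 * r * l)) S) \<le> 24 * l * (4 * r * l)"
        "Ham T (denoise ((2 * j + 2) * (4 * r * l)) T) \<le> 24 * l * (4 * r * l)"
        using denoise_exists_level[OF n len, of m r "4 * r * l"] C by blast
      moreover have "24 * l * (4 * r * l) = N" by (simp add: N_def power2_eq_square mult_ac)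
      ultimately show "\<exists>j<6 * l. denoise ((2 * j + 2) * (4 * r * l)) S = cyc_pow m (denoise ((2 * j + 2) * (4 * r * l)) T)
        \<and> Ham S (denoise ((2 * j + 2) * (4 * r * l)) S) \<le> N \<and> Ham T (denoise ((2 * j + 2) * (4 * r * l)) T) \<le> N"
        by metis
    qed simp_all
    have "real (l + \<mu> + 1) * real W \<le> (18 * x) * (681986 * (x ^ 3 * y * z))"
      using WU x by (intro mult_mono) (auto simp: \<mu> x_def)
    then have "16 * x * (2 * (real (l + \<mu> + 1) * real W)) \<le> 16 * x * (2 * ((18 * x) * (681986 * (x ^ 3 * y * z))))"
      using x by (intro mult_left_mono) auto
    then have b1: "real b\<^sub>1 \<le> 392823936 * (x ^ 5 * y * z)"
      by (simp add: b\<^sub>1_def \<mu> x_def power_numeral_reduce algebra_simps)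
    have "x * 1 * 1 \<le> x ^ 5 * y * z" using x y z by (intro mult_mono self_le_power) auto
    then have "real B \<le> 392823957 * (x ^ 5 * y * z)" using b1 x by (simp add: B_def \<mu> x_def)
    then have "6 * x * real B \<le> 6 * x * (392823957 * (x ^ 5 * y * z))" using x by (intro mult_left_mono) auto
    also have "\<dots> = 2356943742 * (x ^ 6 * y * z)" by (simp add: power_numeral_reduce mult_ac)
    also have "\<dots> \<le> 24 * 10 ^ 8 * (x ^ 6 * y * z\<^sup>2)"
      using x y z by (intro mult_mono) (auto simp: power2_eq_square)
    finally show "real (6 * l * B) \<le> 24 * 10 ^ 8 * real l ^ 6 * sqrt r / \<eta>\<^sup>2"
      by (simp add: x_def y_def z_def power_divide mult_ac)
  qed
qed

lemma acs_scale:
  assumes n: "n > 0" "n \<le> 2 ^ l" "l \<ge> 1" and \<eta>: "0 < \<eta>" "\<eta> \<le> 1" and r: "r \<ge> 1" and \<mu>: "\<mu> = 16 * l"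
  shows "\<exists>b. real b \<le> 28 * 10 ^ 8 * real l ^ 6 * sqrt r / \<eta>\<^sup>2 \<and>
    acs (strings (2 ^ \<mu>) n) b
      (\<lambda>S T m v. \<bar>v - real (Ham S (cyc_pow m T))\<bar> \<le> \<eta> * max (real r) (real (Ham S (cyc_pow m T))))
      (real (6 * \<mu>) * (real n * (1/2) ^ \<mu>) + real (6 * l) * (2 * (1/2) ^ \<mu>))
      (\<lambda>S T m. Ham S (cyc_pow m T) \<le> r) ((1/2) ^ \<mu>)"
proof -
  obtain b\<^sub>1 where b1: "real b\<^sub>1 \<le> 4 * 10 ^ 8 * real l ^ 6 * sqrt r / \<eta>\<^sup>2"
    "acs (strings (2 ^ \<mu>) n) b\<^sub>1
      (\<lambda>S T m v. \<bar>v - real (Ham S (cyc_pow m T))\<bar> \<le> \<eta> * max (real r) (real (Ham S (cyc_pow m T))))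
      (real (6 * \<mu>) * (real n * (1/2) ^ \<mu>))
      (\<lambda>S T m. Ham S (cyc_pow m T) \<le> r \<and> card (near_periods (4 * r * l) S) \<le> 384 * r * l ^ 2) ((1/2) ^ \<mu>)"
    using acs_scale_anchor[OF n \<eta> r \<mu>] by blast
  obtain b\<^sub>2 where b2: "real b\<^sub>2 \<le> 24 * 10 ^ 8 * real l ^ 6 * sqrt r / \<eta>\<^sup>2"
    "acs (strings (2 ^ \<mu>) n) b\<^sub>2
      (\<lambda>S T m v. \<bar>v - real (Ham S (cyc_pow m T))\<bar> \<le> \<eta> * max (real r) (real (Ham S (cyc_pow m T))))
      (real (6 * l) * (2 * (1/2) ^ \<mu>))
      (\<lambda>S T m. Ham S (cyc_pow m T) \<le> r \<and> card (near_periods (4 * r * l) S) > 384 * r * l ^ 2) 0"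
    using acs_scale_denoised[OF n \<eta> r \<mu>] by blast
  show ?thesis
  proof (intro exI[of _ "b\<^sub>1 + b\<^sub>2"] conjI)
    show "real (b\<^sub>1 + b\<^sub>2) \<le> 28 * 10 ^ 8 * real l ^ 6 * sqrt r / \<eta>\<^sup>2" using b1(1) b2(1) by simp
    show "acs (strings (2 ^ \<mu>) n) (b\<^sub>1 + b\<^sub>2)
      (\<lambda>S T m v. \<bar>v - real (Ham S (cyc_pow m T))\<bar> \<le> \<eta> * max (real r) (real (Ham S (cyc_pow m T))))
      (real (6 * \<mu>) * (real n * (1/2) ^ \<mu>) + real (6 * l) * (2 * (1/2) ^ \<mu>))
      (\<lambda>S T m. Ham S (cyc_pow m T) \<le> r) ((1/2) ^ \<mu>)"
      by (rule acs_orelse[OF b1(2) b2(2), where \<psi> = 0]) (auto simp: not_less)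
  qed
qed

section \<open>From schemes to circular sketches\<close>

text \<open>At scale 2^(J+1) the error is relative if h > 2^J, since then 2^(J+1) <= 2 h; this is
  the factor 2 before \<eta>. If h <= 2^J, this scale may answer too coarsely, but the smaller
  scales then abstain only with probability 2^(-\<mu>), which is the \<psi> of
  \<open>acs_orelse\<close>.\<close>

lemma acs_chain:
  assumes n: "n > 0" "n \<le> 2 ^ l" "l \<ge> 1" and \<eta>: "0 < \<eta>" "\<eta> \<le> 1/4" and \<mu>: "\<mu> = 16 * l"
  shows "\<exists>b. real b \<le> (real J + 1) * (28 * 10 ^ 8 * real l ^ 6 * sqrt (2 ^ J) / \<eta>\<^sup>2) \<and>
    acs (strings (2 ^ \<mu>) n) b
      (\<lambda>S T m v. \<bar>v - real (Ham S (cyc_pow m T))\<bar> \<le> 2 * \<eta> * real (Ham S (cyc_pow m T)))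
      ((real J + 1) * (109 * real l * real n * (1/2) ^ \<mu>)) (\<lambda>S T m. Ham S (cyc_pow m T) \<le> 2 ^ J) ((1/2) ^ \<mu>)"
proof -
  let ?X = "strings (2 ^ \<mu>) n" and ?e = "(1/2 :: real) ^ \<mu>"
  let ?h = "\<lambda>S T m. Ham S (cyc_pow m T)"
  have \<eta>1: "\<eta> \<le> 1" using \<eta> by simp
  define \<delta> where "\<delta> = real (6 * \<mu>) * (real n * ?e) + real (6 * l) * (2 * ?e)"
  \<comment> \<open>The constant is 96 from the anchors, 12 from the denoised levels and 1 for
    \<psi>.\<close>
  have \<delta>: "\<delta> + ?e \<le> 109 * real l * real n * ?e"
  proof -
    have "1 * 1 \<le> real l * real n" using n by (intro mult_mono) auto
    moreover have "real l * 1 \<le> real l * real n" using n by (intro mult_left_mono) auto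
    ultimately have "96 * (real l * real n) + 12 * real l + 1 \<le> 109 * (real l * real n)" by linarith
    then have "(96 * (real l * real n) + 12 * real l + 1) * ?e \<le> 109 * (real l * real n) * ?e"
      by (intro mult_right_mono) auto
    then show ?thesis by (simp add: \<delta>_def \<mu> algebra_simps)
  qed
  have \<delta>': "\<delta> \<le> 109 * real l * real n * ?e" using \<delta> zero_le_power[of "1/2 :: real" \<mu>] by linarith
  show ?thesis
  proof (induction J)
    case 0
    obtain b where b: "real b \<le> 28 * 10 ^ 8 * real l ^ 6 * sqrt (real 1) / \<eta>\<^sup>2"
      "acs ?X b (\<lambda>S T m v. \<bar>v - real (?h S T m)\<bar> \<le> \<eta> * max (real 1) (real (?h S T m))) \<delta> (\<lambda>S T m. ?h S T m \<le> 1) ?e"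
      using acs_scale[OF n \<eta>(1) \<eta>1 _ \<mu>, of 1] unfolding \<delta>_def by auto
    \<comment> \<open>rounding small values to 0 makes the absolute error relative\<close>
    have "acs ?X b (\<lambda>S T m v. \<bar>v - real (?h S T m)\<bar> \<le> 2 * \<eta> * real (?h S T m)) \<delta> (\<lambda>S T m. ?h S T m \<le> 1) ?e"
    proof (rule acs_postprocess[OF b(2), where g = "\<lambda>v. if v < 1/2 then 0 else v"])
      fix S T m v assume v: "\<bar>v - real (?h S T m)\<bar> \<le> \<eta> * max (real 1) (real (?h S T m))"
      show "\<bar>(if v < 1/2 then 0 else v) - real (?h S T m)\<bar> \<le> 2 * \<eta> * real (?h S T m)"
      proof (cases "?h S T m = 0")
        case True
        then show ?thesis using v \<eta> by simp
      next
        case False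
        then have h: "real (?h S T m) \<ge> 1" by simp
        then have v': "\<bar>v - real (?h S T m)\<bar> \<le> \<eta> * real (?h S T m)" using v by simp
        have "\<eta> * real (?h S T m) \<le> 1/4 * real (?h S T m)" using \<eta> by (intro mult_right_mono) auto
        then have "\<not> v < 1/2" using v' h by linarith
        moreover have "\<eta> * real (?h S T m) \<le> 2 * \<eta> * real (?h S T m)" using \<eta> by simp
        ultimately show ?thesis using v' by simp
      qed
    qed
    then have "acs ?X b (\<lambda>S T m v. \<bar>v - real (?h S T m)\<bar> \<le> 2 * \<eta> * real (?h S T m))
      ((real 0 + 1) * (109 * real l * real n * ?e)) (\<lambda>S T m. ?h S T m \<le> 2 ^ 0) ?e"
      by (rule acs_mono) (use \<delta>' in auto)
    then show ?case using b(1) by (intro exI[of _ b]) simp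
  next
    case (Suc J)
    then obtain b where b: "real b \<le> (real J + 1) * (28 * 10 ^ 8 * real l ^ 6 * sqrt (2 ^ J) / \<eta>\<^sup>2)"
      "acs ?X b (\<lambda>S T m v. \<bar>v - real (?h S T m)\<bar> \<le> 2 * \<eta> * real (?h S T m))
        ((real J + 1) * (109 * real l * real n * ?e)) (\<lambda>S T m. ?h S T m \<le> 2 ^ J) ?e" by blast
    have "(1::nat) \<le> 2 ^ Suc J" by (rule one_le_power) simp
    then obtain b' where b': "real b' \<le> 28 * 10 ^ 8 * real l ^ 6 * sqrt (real (2 ^ Suc J)) / \<eta>\<^sup>2"
      "acs ?X b' (\<lambda>S T m v. \<bar>v - real (?h S T m)\<bar> \<le> \<eta> * max (real (2 ^ Suc J)) (real (?h S T m))) \<delta> (\<lambda>S T m. ?h S T m \<le> 2 ^ Suc J) ?e"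
      using acs_scale[OF n \<eta>(1) \<eta>1 _ \<mu>, of "2 ^ Suc J"] unfolding \<delta>_def by blast
    have "acs ?X (b + b') (\<lambda>S T m v. \<bar>v - real (?h S T m)\<bar> \<le> 2 * \<eta> * real (?h S T m))
      ((real J + 1) * (109 * real l * real n * ?e) + \<delta> + ?e) (\<lambda>S T m. ?h S T m \<le> 2 ^ Suc J) ?e"
    proof (rule acs_orelse[OF b(2) b'(2), where \<psi> = ?e])
      fix S T m v assume v: "\<bar>v - real (?h S T m)\<bar> \<le> \<eta> * max (real (2 ^ Suc J)) (real (?h S T m))"
      show "\<bar>v - real (?h S T m)\<bar> \<le> 2 * \<eta> * real (?h S T m) \<or> ?h S T m \<le> 2 ^ J \<and> ?e \<le> ?e"
      proof (cases "?h S T m \<le> 2 ^ J")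
        case False
        then have "2 ^ Suc J \<le> 2 * ?h S T m" by simp
        then have "real (2 ^ Suc J) \<le> real (2 * ?h S T m)" by (simp only: of_nat_le_iff)
        then have "max (real (2 ^ Suc J)) (real (?h S T m)) \<le> 2 * real (?h S T m)" by simp
        then have "\<eta> * max (real (2 ^ Suc J)) (real (?h S T m)) \<le> \<eta> * (2 * real (?h S T m))"
          using \<eta> by (intro mult_left_mono) auto
        then show ?thesis using v by simp
      qed simp
    qed auto
    then have "acs ?X (b + b') (\<lambda>S T m v. \<bar>v - real (?h S T m)\<bar> \<le> 2 * \<eta> * real (?h S T m))
      ((real (Suc J) + 1) * (109 * real l * real n * ?e)) (\<lambda>S T m. ?h S T m \<le> 2 ^ Suc J) ?e"
      by (rule acs_mono) (use \<delta> in \<open>auto simp: distrib_right\<close>)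
    moreover have "real (b + b') \<le> (real (Suc J) + 1) * (28 * 10 ^ 8 * real l ^ 6 * sqrt (2 ^ Suc J) / \<eta>\<^sup>2)"
    proof -
      define K where "K = 28 * 10 ^ 8 * real l ^ 6 * sqrt (2 ^ Suc J) / \<eta>\<^sup>2"
      have "(real J + 1) * (28 * 10 ^ 8 * real l ^ 6 * sqrt (2 ^ J) / \<eta>\<^sup>2) \<le> (real J + 1) * K"
        unfolding K_def by (intro mult_left_mono divide_right_mono) auto
      moreover have "real b' \<le> K" using b'(1) by (simp add: K_def)
      ultimately have "real (b + b') \<le> (real J + 1) * K + K" using b(1) by simp
      also have "\<dots> = (real (Suc J) + 1) * K" by (simp add: distrib_right)
      finally show ?thesis by (simp only: K_def)
    qed
    ultimately show ?case by blast
  qed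
qed

text \<open>A whole string is a partial word with \<open>n\<close> entries. The weight is 0 or 1, so
  the squared weights sum to the distance h, and \<alpha>^2 = 32/(\<eta>^2 r) gives variance at most
  \<eta>^2 h r/32, which is at most (\<eta> max(r, h))^2/32.\<close>

lemma acs_full_sampling:
  assumes n: "n > 0" "n \<le> 2 ^ l" "l \<ge> 1" and \<eta>: "0 < \<eta>" and r: "r \<ge> 1" and \<mu>: "\<mu> = 16 * l"
  shows "\<exists>b. real b \<le> 576 * (real l)\<^sup>2 * (384 * (real n / (\<eta> * sqrt r)) + 2) \<and>
    acs (strings (2 ^ \<mu>) n) b
      (\<lambda>S T m v. \<bar>v - real (Ham S (cyc_pow m T))\<bar> \<le> \<eta> * max (real r) (real (Ham S (cyc_pow m T))))
      ((1/2) ^ \<mu>) (\<lambda>_ _ _. True) 0"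
proof -
  let ?I = "{0..<int n}" and ?X = "strings (2 ^ \<mu>) n"
  define g where "g S i = (if i \<in> ?I then Some (cnth S i) else None)" for S :: "nat list" and i
  define wt where "wt c d = (if c \<noteq> d then 1 else 0 :: real)" for c d :: nat
  define \<alpha> where "\<alpha> = min 1 (sqrt 32 / (\<eta> * sqrt r))"
  have \<alpha>: "0 < \<alpha>" "\<alpha> \<le> 1" using \<eta> r by (auto simp: \<alpha>_def)
  define W where "W = nat \<lceil>64 * \<alpha> * real n\<rceil> + 1"
  have W: "W > 0" "64 * \<alpha> * real n \<le> real W"
    using real_nat_ceiling_ge[of "64 * \<alpha> * real n"] by (simp_all add: W_def)
  have dom: "dom (g S) = ?I" for S by (auto simp: g_def dom_def)
  have gX: "g ` ?X \<subseteq> sparse n (2 ^ \<mu>) n"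
  proof
    fix u assume "u \<in> g ` ?X"
    then obtain S where S: "S \<in> ?X" "u = g S" by blast
    have "ran u \<subseteq> {1..2 ^ \<mu>}"
      using cnth_strings[OF S(1) n(1)] unfolding S(2) ran_def g_def by (auto split: if_splits)
    then show "u \<in> sparse n (2 ^ \<mu>) n" unfolding sparse_def mem_Collect_eq S(2) dom by simp
  qed
  have ws: "wsum n wt (g S) (g T) m = real (Ham S (cyc_pow m T))" if ST: "S \<in> ?X" "T \<in> ?X" for S T m
  proof -
    have len: "length S = n" "length T = n" and ne: "T \<noteq> []" using ST n by (auto simp: strings_def)
    have "overlap n (g S) (g T) m = ?I" unfolding overlap_def dom using n by auto
    then have "wsum n wt (g S) (g T) m = (\<Sum>i\<in>?I. wt (cnth S i) (cnth T ((i + m) mod int n)))"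
      unfolding wsum_def using n(1) by (intro sum.cong) (auto simp: g_def)
    also have "\<dots> = (\<Sum>i\<in>?I. if cnth S i \<noteq> cnth (cyc_pow m T) i then 1 else 0)"
      using cnth_mod[of T] len by (intro sum.cong) (simp_all add: wt_def cnth_cyc_pow[OF ne])
    also have "\<dots> = real (Ham S (cyc_pow m T))"
      using Ham_eq_sum[of S "cyc_pow m T"] len by (auto intro!: sum.cong)
    finally show ?thesis .
  qed
  have wt2: "(wt c d)\<^sup>2 = wt c d" for c d by (simp add: wt_def)
  define \<tau> where "\<tau> u v m = \<eta> * max (real r) (wsum n wt u v m)" for u v m
  have sp: "acs (g ` ?X) (\<mu> * (2 * ((l + \<mu> + 1) * W)))
    (\<lambda>u v m z. z \<in> {wsum n wt u v m - \<tau> u v m..wsum n wt u v m + \<tau> u v m}) ((1/2) ^ \<mu>) (\<lambda>_ _ _. True) 0"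
  proof (rule acs_sparse[OF n(1) \<alpha> W gX mult_power2_Suc_le[OF n(2)]])
    fix u v m
    show "0 \<le> \<tau> u v m" using \<eta> by (simp add: \<tau>_def max_def)
    have w0: "0 \<le> wsum n wt u v m" unfolding wsum_def by (intro sum_nonneg) (simp add: wt_def)
    show "wsum n (\<lambda>c d. (wt c d)\<^sup>2) u v m * (1 / \<alpha>\<^sup>2 - 1) \<le> (\<tau> u v m)\<^sup>2 / 32"
    proof (cases "\<alpha> = 1")
      case False
      then have a: "\<alpha> = sqrt 32 / (\<eta> * sqrt r)" by (auto simp: \<alpha>_def min_def split: if_splits)
      let ?M = "max (real r) (wsum n wt u v m)"
      have "wsum n wt u v m * (1 / \<alpha>\<^sup>2 - 1) \<le> wsum n wt u v m * (1 / \<alpha>\<^sup>2)"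
        using w0 by (intro mult_left_mono) auto
      also have "\<dots> = \<eta>\<^sup>2 * (wsum n wt u v m * real r) / 32" by (simp add: a power_divide power_mult_distrib)
      also have "\<dots> \<le> \<eta>\<^sup>2 * (?M * ?M) / 32"
        using w0 by (intro divide_right_mono mult_left_mono mult_mono) auto
      finally show ?thesis unfolding wt2 by (simp add: \<tau>_def power2_eq_square mult_ac)
    qed simp
  qed
  have "acs ?X (\<mu> * (2 * ((l + \<mu> + 1) * W)))
    (\<lambda>S T m v. \<bar>v - real (Ham S (cyc_pow m T))\<bar> \<le> \<eta> * max (real r) (real (Ham S (cyc_pow m T))))
    ((1/2) ^ \<mu>) (\<lambda>_ _ _. True) 0"
  proof (rule acs_mono[OF acs_comap[OF sp, of ?X g]])
    fix S T m v assume ST: "S \<in> ?X" "T \<in> ?X"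
      and v: "v \<in> {wsum n wt (g S) (g T) m - \<tau> (g S) (g T) m..wsum n wt (g S) (g T) m + \<tau> (g S) (g T) m}"
    show "\<bar>v - real (Ham S (cyc_pow m T))\<bar> \<le> \<eta> * max (real r) (real (Ham S (cyc_pow m T)))"
      using v unfolding \<tau>_def ws[OF ST] atLeastAtMost_iff abs_le_iff by linarith
  qed auto
  moreover have "real (\<mu> * (2 * ((l + \<mu> + 1) * W))) \<le> 576 * (real l)\<^sup>2 * (384 * (real n / (\<eta> * sqrt r)) + 2)"
  proof -
    have "real (nat \<lceil>64 * \<alpha> * real n\<rceil>) \<le> 64 * \<alpha> * real n + 1"
      by (rule real_nat_ceiling_le) (use \<alpha> in simp)
    moreover have "\<alpha> * real n \<le> (6 / (\<eta> * sqrt r)) * real n"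
      using \<eta> unfolding \<alpha>_def
      by (intro mult_right_mono min.coboundedI2 divide_right_mono real_le_lsqrt) auto
    ultimately have W': "real W \<le> 384 * (real n / (\<eta> * sqrt r)) + 2" by (simp add: W_def)
    have "real (l + \<mu> + 1) \<le> 18 * real l" using n by (simp add: \<mu>)
    then have "real (l + \<mu> + 1) * real W \<le> (18 * real l) * (384 * (real n / (\<eta> * sqrt r)) + 2)"
      using W' by (intro mult_mono) auto
    then have "32 * real l * (real (l + \<mu> + 1) * real W) \<le> 32 * real l * ((18 * real l) * (384 * (real n / (\<eta> * sqrt r)) + 2))"
      by (intro mult_left_mono) auto
    then show ?thesis by (simp add: \<mu> power2_eq_square algebra_simps)
  qed
  ultimately show ?thesis by blast
qed

text \<open>Serves the case \<epsilon> n < 1, where the desired bound sqrt(\<epsilon>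
  n)/\<epsilon>^2 already exceeds n.\<close>

lemma acs_store_everything:
  "acs (strings (2 ^ \<mu>) n) (\<mu> * n) (\<lambda>S T m v. v = real (Ham S (cyc_pow m T))) 0 (\<lambda>_ _ _. True) 0"
proof (rule acsI[where P = "return_pmf ()" and V = "strings (2 ^ \<mu>) n" and f = "\<lambda>_ S. S"
      and dec = "\<lambda>_ S T m. Some (real (Ham S (cyc_pow m T)))"])
  have "card (strings (2 ^ \<mu>) n) = card {S. set S \<subseteq> {1..2 ^ \<mu> :: nat} \<and> length S = n}"
    unfolding strings_def by (simp add: conj_commute)
  also have "\<dots> = 2 ^ (\<mu> * n)" by (subst card_lists_length_eq) (simp_all add: power_mult)
  finally show "card (strings (2 ^ \<mu>) n) \<le> 2 ^ (\<mu> * n)" by simp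
qed simp_all

section \<open>Hashing the alphabet and passing to bit strings\<close>

lemma map_cyc_pow: "map F (cyc_pow m S) = cyc_pow m (map F S)"
  by (simp add: cyc_pow_conv_rotate rotate_map)

lemma Ham_map:
  assumes "length S = length T" "\<And>i. i \<in> mism S T \<Longrightarrow> F (cnth S i) \<noteq> F (cnth T i)"
  shows "Ham (map F S) (map F T) = Ham S T"
proof -
  have "cnth (map F U) i = F (cnth U i)" if "i \<in> {0..<int (length U)}" for i U
    using that by (simp add: cnth_def nat_less_iff)
  then have "mism (map F S) (map F T) = mism S T"
    using assms by (auto simp: mism_def)
  then show ?thesis using assms(1) by (simp add: Ham_eq_card_mism)
qed

text \<open>Hashing the symbols to \<open>2 ^ \<mu>\<close> values frees the size from \<sigma>;
  only collisions at the at most \<open>n\<close> mismatches do harm. The relative error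
  \<epsilon>/2 leaves room for the strict inequality required when h > k.\<close>

lemma acs_imp_ACS:
  assumes n: "n > 0" and k: "1 \<le> k" and \<epsilon>: "0 < \<epsilon>" "\<epsilon> < 1"
    and scheme: "acs (strings (2 ^ \<mu>) n) b (\<lambda>S T m v. \<bar>v - real (Ham S (cyc_pow m T))\<bar> \<le> \<epsilon> / 2 * real (Ham S (cyc_pow m T)))
      \<delta> (\<lambda>S T m. Ham S (cyc_pow m T) \<le> k) \<phi>"
    and err: "real n * (1/2) ^ \<mu> + \<delta> + \<phi> \<le> 1 / real n" and \<phi>: "\<phi> \<ge> 0" and size: "real b \<le> s"
  shows "\<exists>(M :: sketch_space measure) sk dec. is_ACS 1 n \<epsilon> k (strings \<sigma> n) M sk dec \<and> has_size 1 n (strings \<sigma> n) M sk s"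
proof -
  let ?X = "strings \<sigma> n" and ?Y = "strings (2 ^ \<mu>) n"
  from scheme obtain P where P': "realizes P ?Y b (\<lambda>S T m v. \<bar>v - real (Ham S (cyc_pow m T))\<bar> \<le> \<epsilon> / 2 * real (Ham S (cyc_pow m T)))
    \<delta> (\<lambda>S T m. Ham S (cyc_pow m T) \<le> k) \<phi>" unfolding acs_def by blast
  note P = realizesD[OF P']
  let ?V = "{1..2 ^ \<mu> :: nat}"
  define H where "H = Pi_pmf {1..\<sigma>} 1 (\<lambda>_. pmf_of_set ?V)"
  have V: "finite ?V" "?V \<noteq> {}" by auto
  have "card {xs :: bool list. length xs = b} = 2 ^ b"
    using card_lists_length_eq[of "UNIV :: bool set" b] by simp
  then have "card {..<2 ^ b :: nat} = card {xs :: bool list. length xs = b}" by simp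
  then obtain e where e: "bij_betw e {..<2 ^ b :: nat} {xs :: bool list. length xs = b}"
    using finite_same_card_bij[of "{..<2 ^ b :: nat}" "{xs :: bool list. length xs = b}"]
      finite_lists_length_eq[of "UNIV :: bool set" b] by auto
  define e' where "e' = inv_into {..<2 ^ b} e"
  \<comment> \<open>Abstention is decoded as \<open>k\<close>: with high probability it occurs only
    for h > k, and then \<open>k\<close> exceeds (1 - \<epsilon>) k.\<close>
  define g :: "(nat \<Rightarrow> nat) \<times> nat list sketcher \<Rightarrow> sketch_space" where
    "g z = (\<lambda>S. e (fst (snd z) (map (fst z) S)),
      \<lambda>x y m. case snd (snd z) (e' x) (e' y) m of Some v \<Rightarrow> v | None \<Rightarrow> real k)" for z
  let ?\<Omega> = "pair_pmf H P"
  let ?M = "measure_pmf (map_pmf g ?\<Omega>)"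
  have mapX: "map F S \<in> ?Y" if "F \<in> set_pmf H" "S \<in> ?X" for F S
  proof -
    have "F a \<in> ?V" if "a \<in> {1..\<sigma>}" for a
      using \<open>F \<in> set_pmf H\<close> that set_pmf_of_set[OF V(2,1)] by (auto simp: H_def set_Pi_pmf PiE_dflt_def)
    then show ?thesis using that(2) by (auto simp: strings_def)
  qed
  have whp: "whp 1 n ?M Q" if "pr ?\<Omega> (\<lambda>z. \<not> Q (g z)) \<le> 1 / real n" for Q
  proof -
    have "pr ?\<Omega> (\<lambda>z. Q (g z)) \<ge> 1 - 1 / real n" using that unfolding pr_not by simp
    then show ?thesis using n unfolding whp_def by (simp add: powr_minus_divide vimage_def)
  qed
  have enc: "e (fst w S) \<in> {xs. length xs = b}" "e' (e (fst w S)) = fst w S"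
    if "w \<in> set_pmf P" "S \<in> ?Y" for w S
  proof -
    have m: "fst w S \<in> {..<2 ^ b}" using P(1)[OF that] by simp
    show "e (fst w S) \<in> {xs. length xs = b}" by (rule bij_betw_apply[OF e m])
    show "e' (e (fst w S)) = fst w S" unfolding e'_def by (rule bij_betw_inv_into_left[OF e m])
  qed
  have "is_ACS 1 n \<epsilon> k ?X ?M fst snd"
    unfolding is_ACS_def Let_def
  proof (intro conjI ballI allI)
    show "randomized_pair ?M ?X fst snd"
      unfolding randomized_pair_def by (simp add: measure_pmf.prob_space_axioms)
  next
    fix S T and m :: int assume ST: "S \<in> ?X" "T \<in> ?X"
    define h where "h = Ham S (cyc_pow m T)"
    have len: "length S = n" "length T = n" using ST by (auto simp: strings_def)
    define coll where "coll F \<longleftrightarrow> (\<exists>i\<in>mism S (cyc_pow m T). F (cnth S i) = F (cnth (cyc_pow m T) i))" for F :: "nat \<Rightarrow> nat"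
    define wrong where "wrong F w \<longleftrightarrow> (\<exists>v. answer w (map F S) (map F T) m = Some v \<and>
        \<not> \<bar>v - real (Ham (map F S) (cyc_pow m (map F T)))\<bar> \<le> \<epsilon> / 2 * real (Ham (map F S) (cyc_pow m (map F T))))"
      for F :: "nat \<Rightarrow> nat" and w
    define none where "none F w \<longleftrightarrow> Ham (map F S) (cyc_pow m (map F T)) \<le> k \<and> answer w (map F S) (map F T) m = None"
      for F :: "nat \<Rightarrow> nat" and w
    have c: "pr H coll \<le> real n * (1/2) ^ \<mu>"
    proof -
      have "pr H coll \<le> (\<Sum>i\<in>mism S (cyc_pow m T). pr H (\<lambda>F. F (cnth S i) = F (cnth (cyc_pow m T) i)))"
        unfolding coll_def by (rule pr_Bex) simp
      also have "\<dots> \<le> (\<Sum>i\<in>mism S (cyc_pow m T). (1/2) ^ \<mu>)"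
      proof (rule sum_mono)
        fix i assume "i \<in> mism S (cyc_pow m T)"
        then have "cnth S i \<noteq> cnth (cyc_pow m T) i" by (simp add: mism_def)
        then have "pr H (\<lambda>F. F (cnth S i) = F (cnth (cyc_pow m T) i)) \<le> 1 / real (card ?V)"
          unfolding H_def using cnth_strings[OF ST(1) n] cnth_strings[of "cyc_pow m T" \<sigma> n] ST(2) n V
          by (intro pr_random_function_collision) auto
        then show "pr H (\<lambda>F. F (cnth S i) = F (cnth (cyc_pow m T) i)) \<le> (1/2) ^ \<mu>"
          by (simp add: power_one_over)
      qed
      also have "\<dots> = real (Ham S (cyc_pow m T)) * (1/2) ^ \<mu>" by (simp add: Ham_eq_card_mism len)
      also have "\<dots> \<le> real n * (1/2) ^ \<mu>"
        using Ham_le_length[of S "cyc_pow m T"] len by (intro mult_right_mono) auto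
      finally show ?thesis .
    qed
    have w: "pr ?\<Omega> (\<lambda>(F, w). wrong F w) \<le> \<delta>"
      unfolding wrong_def by (rule pr_pair_le, rule P(2)) (use mapX ST in auto)
    have nn: "pr ?\<Omega> (\<lambda>(F, w). none F w) \<le> \<phi>"
    proof (rule pr_pair_le)
      fix F assume F: "F \<in> set_pmf H"
      show "pr P (none F) \<le> \<phi>"
        using P(3)[OF mapX[OF F ST(1)] mapX[OF F ST(2)], of m] \<phi>
        by (cases "Ham (map F S) (cyc_pow m (map F T)) \<le> k") (auto simp: none_def)
    qed
    show "whp 1 n ?M (\<lambda>\<omega>. if Ham S (cyc_pow m T) \<le> k
      then snd \<omega> (fst \<omega> S) (fst \<omega> T) m \<in> {(1 - \<epsilon>) * real (Ham S (cyc_pow m T))..(1 + \<epsilon>) * real (Ham S (cyc_pow m T))}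
      else snd \<omega> (fst \<omega> S) (fst \<omega> T) m > (1 - \<epsilon>) * real k)"
      unfolding h_def[symmetric]
    proof (rule whp)
      let ?Q = "\<lambda>\<omega>. if h \<le> k
        then snd \<omega> (fst \<omega> S) (fst \<omega> T) m \<in> {(1 - \<epsilon>) * real h..(1 + \<epsilon>) * real h}
        else snd \<omega> (fst \<omega> S) (fst \<omega> T) m > (1 - \<epsilon>) * real k"
      have "pr ?\<Omega> (\<lambda>z. \<not> ?Q (g z)) \<le> pr ?\<Omega> (\<lambda>z. (case z of (F, w) \<Rightarrow> coll F) \<or>
        (case z of (F, w) \<Rightarrow> wrong F w) \<or> (case z of (F, w) \<Rightarrow> none F w))"
      proof (rule pr_mono, rule ccontr)
        fix z assume z: "z \<in> set_pmf ?\<Omega>" and nQ: "\<not> ?Q (g z)"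
          and good: "\<not> ((case z of (F, w) \<Rightarrow> coll F) \<or> (case z of (F, w) \<Rightarrow> wrong F w) \<or> (case z of (F, w) \<Rightarrow> none F w))"
        obtain F w where zz: "z = (F, w)" by (cases z)
        have Fw: "F \<in> set_pmf H" "w \<in> set_pmf P" using z by (auto simp: zz)
        have g: "\<not> coll F" "\<not> wrong F w" "\<not> none F w" using good by (auto simp: zz)
        have hh: "Ham (map F S) (cyc_pow m (map F T)) = h"
          unfolding h_def map_cyc_pow[symmetric] using g(1) len by (intro Ham_map) (auto simp: coll_def)
        have val: "snd (g z) (fst (g z) S) (fst (g z) T) m
          = (case answer w (map F S) (map F T) m of Some v \<Rightarrow> v | None \<Rightarrow> real k)"
          using enc(2)[OF Fw(2) mapX[OF Fw(1) ST(1)]] enc(2)[OF Fw(2) mapX[OF Fw(1) ST(2)]]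
          by (simp add: g_def zz answer_def)
        show False
        proof (cases "answer w (map F S) (map F T) m")
          case None
          then have "h > k" using g(3) by (simp add: none_def hh)
          moreover have "(1 - \<epsilon>) * real k < real k" using \<epsilon> k by (simp add: algebra_simps)
          ultimately show False using nQ unfolding val None by simp
        next
          case (Some v)
          then have v: "\<bar>v - real h\<bar> \<le> \<epsilon> / 2 * real h" using g(2) by (simp add: wrong_def hh)
          have eh: "\<epsilon> / 2 * real h \<le> \<epsilon> * real h" using \<epsilon> by (intro mult_right_mono) auto
          show False
          proof (cases "h \<le> k")
            case True
            have "v \<in> {(1 - \<epsilon>) * real h..(1 + \<epsilon>) * real h}"
              using v eh unfolding abs_le_iff atLeastAtMost_iff left_diff_distrib distrib_right by linarith
            then show False using nQ True unfolding val Some by simp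
          next
            case False
            have "(1 - \<epsilon>) * real k < (1 - \<epsilon> / 2) * real k" using \<epsilon> k by (intro mult_strict_right_mono) auto
            also have "\<dots> \<le> (1 - \<epsilon> / 2) * real h" using \<epsilon> False by (intro mult_left_mono) auto
            also have "\<dots> \<le> v" using v unfolding abs_le_iff left_diff_distrib by linarith
            finally show False using nQ False unfolding val Some by simp
          qed
        qed
      qed
      also have "\<dots> \<le> pr ?\<Omega> (\<lambda>z. case z of (F, w) \<Rightarrow> coll F)
        + (pr ?\<Omega> (\<lambda>z. case z of (F, w) \<Rightarrow> wrong F w) + pr ?\<Omega> (\<lambda>z. case z of (F, w) \<Rightarrow> none F w))"
        by (rule order_trans[OF pr_disj add_left_mono[OF pr_disj]])
      also have "\<dots> \<le> 1 / real n" unfolding pr_pair_fst using c w nn err by linarith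
      finally show "pr ?\<Omega> (\<lambda>z. \<not> ?Q (g z)) \<le> 1 / real n" .
    qed
  qed
  moreover have "has_size 1 n ?X ?M fst s"
    unfolding has_size_def
  proof (intro ballI whp)
    fix S assume S: "S \<in> ?X"
    have "length (fst (g z) S) = b" if "z \<in> set_pmf ?\<Omega>" for z
      using that enc(1)[of "snd z" "map (fst z) S"] mapX[OF _ S] by (auto simp: g_def)
    then have "pr ?\<Omega> (\<lambda>z. \<not> real (length (fst (g z) S)) \<le> s) = 0" using size by (intro pr_eq_0) simp
    then show "pr ?\<Omega> (\<lambda>z. \<not> real (length (fst (g z) S)) \<le> s) \<le> 1 / real n" by simp
  qed
  ultimately show ?thesis by blast
qed

text \<open>For x = 2^l the whole sum is at most 113 x^3/x^16, and 113 <= 2^12 <= x^12 leaves 1/x <=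
  1/n. This is the origin of \<mu> = 16 l.\<close>

lemma total_error_le:
  assumes "n > 0" "n \<le> 2 ^ l" "l \<ge> 1"
  shows "real n * (1/2) ^ (16 * l) + ((real l + 1) * (109 * real l * real n * (1/2) ^ (16 * l)) + 2 * (1/2) ^ (16 * l))
    + (1/2) ^ (16 * l) \<le> 1 / real n"
proof -
  define x :: real where "x = 2 ^ l"
  have x2: "x \<ge> 2" using power_increasing[OF assms(3), of "2::real"] by (simp add: x_def)
  have "real n \<le> real (2 ^ l)" unfolding of_nat_le_iff by (rule assms(2))
  then have nx: "1 \<le> real n" "real n \<le> x" using assms(1) by (simp_all add: x_def)
  have "l < 2 ^ l" by (rule less_exp)
  then have "real (l + 1) \<le> real (2 ^ l)" unfolding of_nat_le_iff by (simp add: Suc_le_eq)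
  then have lx: "real l + 1 \<le> x" by (simp add: x_def)
  have e: "(1/2 :: real) ^ (16 * l) = 1 / x ^ 16"
    by (simp add: x_def power_one_over power_mult[symmetric] mult.commute)
  have "(real l + 1) * (real l * real n) \<le> x * (x * x)"
    using lx nx by (intro mult_mono) auto
  moreover have "x \<le> x * (x * x)" "1 \<le> x * (x * x)"
  proof -
    have "1 * 1 \<le> x * x" using x2 by (intro mult_mono) auto
    then have "x * 1 \<le> x * (x * x)" using x2 by (intro mult_left_mono) auto
    then show "x \<le> x * (x * x)" "1 \<le> x * (x * x)" using x2 by linarith+
  qed
  ultimately have "real n + 109 * ((real l + 1) * (real l * real n)) + 3 \<le> 113 * (x * (x * x))"
    using nx by linarith
  also have "\<dots> \<le> x ^ 15"
  proof -
    have "(113::real) \<le> 2 ^ 12" by simp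
    also have "\<dots> \<le> x ^ 12" using x2 by (intro power_mono) auto
    finally have "113 * (x * (x * x)) \<le> x ^ 12 * (x * (x * x))" using x2 by (intro mult_right_mono) auto
    then show ?thesis by (simp add: power_numeral_reduce)
  qed
  finally have "(real n + 109 * ((real l + 1) * (real l * real n)) + 3) * (1 / x ^ 16) \<le> x ^ 15 * (1 / x ^ 16)"
    using x2 by (intro mult_right_mono) auto
  also have "\<dots> = 1 / x" using x2 by (simp add: field_simps power_numeral_reduce)
  also have "\<dots> \<le> 1 / real n" using nx x2 by (intro divide_left_mono) auto
  finally show ?thesis unfolding e by (simp add: algebra_simps add_divide_distrib)
qed

text \<open>The second bound is the first with \<open>k\<close> replaced by \<epsilon> n, the scale
  at which sampling raw positions takes over.\<close>

lemma sketch_size_eq: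
  assumes "0 < \<epsilon>"
  shows "min (\<epsilon> powr (-2) * sqrt (real k)) (\<epsilon> powr (-3/2) * sqrt (real n))
    = min (sqrt (real k)) (sqrt (\<epsilon> * real n)) / \<epsilon>\<^sup>2"
proof -
  have p2: "\<epsilon> powr (-2) = 1 / \<epsilon>\<^sup>2" using assms by (simp add: powr_minus_divide)
  have "\<epsilon> powr (-3/2) = \<epsilon> powr (1/2) * \<epsilon> powr (-2)" by (simp add: powr_add[symmetric])
  also have "\<dots> = sqrt \<epsilon> / \<epsilon>\<^sup>2" using assms by (simp add: p2 powr_half_sqrt)
  finally have p3: "\<epsilon> powr (-3/2) = sqrt \<epsilon> / \<epsilon>\<^sup>2" .
  have "min (sqrt (real k) / \<epsilon>\<^sup>2) (sqrt (\<epsilon> * real n) / \<epsilon>\<^sup>2) = min (sqrt (real k)) (sqrt (\<epsilon> * real n)) / \<epsilon>\<^sup>2"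
    using assms by (simp add: min_divide_distrib_right)
  then show ?thesis unfolding p2 p3 by (simp add: real_sqrt_mult)
qed

lemma power2_bracket:
  assumes "1 \<le> a" "a \<le> 2 ^ l"
  obtains J where "J \<le> l" "a \<le> 2 ^ J" "(2::real) ^ J \<le> 2 * a"
proof -
  define J where "J = (LEAST j. a \<le> 2 ^ j)"
  have J: "a \<le> 2 ^ J" unfolding J_def by (rule LeastI[of "\<lambda>j. a \<le> 2 ^ j", OF assms(2)])
  have Jl: "J \<le> l" unfolding J_def by (rule Least_le[of "\<lambda>j. a \<le> 2 ^ j", OF assms(2)])
  have "(2::real) ^ J \<le> 2 * a"
  proof (cases J)
    case (Suc j)
    then have "\<not> a \<le> 2 ^ j" using not_less_Least[of j "\<lambda>j. a \<le> 2 ^ j"] by (simp add: J_def)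
    then show ?thesis by (simp add: Suc)
  qed (use assms in simp)
  with J Jl that show ?thesis by blast
qed

lemma acs_exists:
  assumes n: "n > 0" "n \<le> 2 ^ l" "l \<ge> 1" and k: "1 \<le> k" "k \<le> n" and \<epsilon>: "0 < \<epsilon>" "\<epsilon> < 1"
    and \<mu>: "\<mu> = 16 * l"
  shows "\<exists>b. real b \<le> 2 * 10 ^ 11 * real l ^ 7 * (min (sqrt (real k)) (sqrt (\<epsilon> * real n)) / \<epsilon>\<^sup>2) \<and>
    acs (strings (2 ^ \<mu>) n) b
      (\<lambda>S T m v. \<bar>v - real (Ham S (cyc_pow m T))\<bar> \<le> \<epsilon> / 2 * real (Ham S (cyc_pow m T)))
      ((real l + 1) * (109 * real l * real n * (1/2) ^ \<mu>) + 2 * (1/2) ^ \<mu>) (\<lambda>S T m. Ham S (cyc_pow m T) \<le> k) ((1/2) ^ \<mu>)"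
proof -
  let ?X = "strings (2 ^ \<mu>) n" and ?h = "\<lambda>S T m. Ham S (cyc_pow m T)"
  \<comment> \<open>\<open>acs_chain\<close> loses a factor 2, and \<open>acs_imp_ACS\<close> asks
    for relative error \<epsilon>/2.\<close>
  define \<eta> where "\<eta> = \<epsilon> / 4"
  define x where "x = real l"
  have x: "x \<ge> 1" using n by (simp add: x_def)
  have \<eta>: "0 < \<eta>" "\<eta> \<le> 1/4" "2 * \<eta> = \<epsilon> / 2" using \<epsilon> by (auto simp: \<eta>_def)
  have e0: "(0::real) \<le> (1/2) ^ \<mu>" by simp
  let ?\<Delta> = "109 * real l * real n * (1/2) ^ \<mu>"
  have \<Delta>: "0 \<le> ?\<Delta>" by simp
  have "real n \<le> real (2 ^ l)" unfolding of_nat_le_iff by (rule n(2))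
  then have n2: "real n \<le> 2 ^ l" by simp
  have chain: "\<exists>J b. a \<le> 2 ^ J \<and> real b \<le> 1344 * 10 ^ 8 * x ^ 7 * (sqrt a / \<epsilon>\<^sup>2) \<and>
    acs ?X b (\<lambda>S T m v. \<bar>v - real (?h S T m)\<bar> \<le> \<epsilon> / 2 * real (?h S T m)) ((real l + 1) * ?\<Delta>)
      (\<lambda>S T m. ?h S T m \<le> 2 ^ J) ((1/2) ^ \<mu>)" if a: "1 \<le> a" "a \<le> real n" for a
  proof -
    obtain J where J: "J \<le> l" "a \<le> 2 ^ J" "(2::real) ^ J \<le> 2 * a"
      using power2_bracket[of a l] a n2 by (metis order_trans)
    obtain b where b: "real b \<le> (real J + 1) * (28 * 10 ^ 8 * real l ^ 6 * sqrt (2 ^ J) / \<eta>\<^sup>2)"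
      "acs ?X b (\<lambda>S T m v. \<bar>v - real (?h S T m)\<bar> \<le> 2 * \<eta> * real (?h S T m)) ((real J + 1) * ?\<Delta>)
        (\<lambda>S T m. ?h S T m \<le> 2 ^ J) ((1/2) ^ \<mu>)"
      using acs_chain[OF n \<eta>(1,2) \<mu>, of J] by blast
    have "acs ?X b (\<lambda>S T m v. \<bar>v - real (?h S T m)\<bar> \<le> \<epsilon> / 2 * real (?h S T m)) ((real l + 1) * ?\<Delta>)
        (\<lambda>S T m. ?h S T m \<le> 2 ^ J) ((1/2) ^ \<mu>)"
    proof (rule acs_mono[OF b(2)])
      show "(real J + 1) * ?\<Delta> \<le> (real l + 1) * ?\<Delta>" using J(1) \<Delta> by (intro mult_right_mono) auto
    qed (use \<eta>(3) in simp_all)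
    moreover have "real b \<le> 1344 * 10 ^ 8 * x ^ 7 * (sqrt a / \<epsilon>\<^sup>2)"
    proof -
      have "sqrt (2 ^ J) \<le> sqrt (2 * a)" using J(3) by simp
      also have "\<dots> \<le> 3/2 * sqrt a"
        using a by (intro real_le_lsqrt) (auto simp: power_mult_distrib power_divide)
      finally have s: "sqrt (2 ^ J) \<le> 3/2 * sqrt a" .
      have "(real J + 1) * (28 * 10 ^ 8 * x ^ 6 * sqrt (2 ^ J) / \<eta>\<^sup>2)
        \<le> (2 * x) * (28 * 10 ^ 8 * x ^ 6 * (3/2 * sqrt a) / \<eta>\<^sup>2)"
        using J(1) x s by (intro mult_mono divide_right_mono mult_left_mono) (auto simp: x_def)
      also have "\<dots> = 1344 * 10 ^ 8 * x ^ 7 * (sqrt a / \<epsilon>\<^sup>2)"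
        by (simp add: \<eta>_def power_divide power_numeral_reduce mult_ac)
      finally show ?thesis using b(1) by (simp add: x_def)
    qed
    ultimately show ?thesis using J(2) by blast
  qed
  let ?s = "sqrt (\<epsilon> * real n) / \<epsilon>\<^sup>2"
  \<comment> \<open>In the second case the chain covers distances up to about \<epsilon> n and raw
    sampling the larger ones; with the crossover at \<epsilon> n both cost \<epsilon>^(-2)
    sqrt(\<epsilon> n) up to logarithmic factors. In the third case there is no scale to start from
    and the string is sent as it is, since n \<epsilon>^2 <= \<epsilon> n <= sqrt(\<epsilon>
    n).\<close>
  consider "real k \<le> \<epsilon> * real n" | "real k > \<epsilon> * real n" "1 \<le> \<epsilon> * real n" | "real k > \<epsilon> * real n" "\<epsilon> * real n < 1"
    by linarith
  then show ?thesis
  proof cases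
    case 1
    have "1 \<le> real k" "real k \<le> real n" using k by auto
    then obtain J b where b: "real k \<le> 2 ^ J" "real b \<le> 1344 * 10 ^ 8 * x ^ 7 * (sqrt (real k) / \<epsilon>\<^sup>2)"
      "acs ?X b (\<lambda>S T m v. \<bar>v - real (?h S T m)\<bar> \<le> \<epsilon> / 2 * real (?h S T m)) ((real l + 1) * ?\<Delta>)
      (\<lambda>S T m. ?h S T m \<le> 2 ^ J) ((1/2) ^ \<mu>)"
      using chain by blast
    have "real k \<le> real (2 ^ J)" using b(1) by simp
    then have kJ: "k \<le> 2 ^ J" unfolding of_nat_le_iff .
    have "acs ?X b (\<lambda>S T m v. \<bar>v - real (?h S T m)\<bar> \<le> \<epsilon> / 2 * real (?h S T m)) ((real l + 1) * ?\<Delta> + 2 * (1/2) ^ \<mu>)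
      (\<lambda>S T m. ?h S T m \<le> k) ((1/2) ^ \<mu>)"
      by (rule acs_mono[OF b(3)]) (use kJ e0 in auto)
    moreover have "min (sqrt (real k)) (sqrt (\<epsilon> * real n)) = sqrt (real k)" using 1 by simp
    moreover have "1344 * 10 ^ 8 * x ^ 7 * (sqrt (real k) / \<epsilon>\<^sup>2) \<le> 2 * 10 ^ 11 * x ^ 7 * (sqrt (real k) / \<epsilon>\<^sup>2)"
      using x by (intro mult_right_mono) auto
    ultimately show ?thesis using b(2) by (intro exI[of _ b]) (simp add: x_def)
  next
    case 2
    have "\<epsilon> * real n \<le> real n" using \<epsilon> by (simp add: mult_left_le_one_le)
    then obtain J b where b: "\<epsilon> * real n \<le> 2 ^ J" "real b \<le> 1344 * 10 ^ 8 * x ^ 7 * ?s"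
      "acs ?X b (\<lambda>S T m v. \<bar>v - real (?h S T m)\<bar> \<le> \<epsilon> / 2 * real (?h S T m)) ((real l + 1) * ?\<Delta>)
      (\<lambda>S T m. ?h S T m \<le> 2 ^ J) ((1/2) ^ \<mu>)"
      using chain[of "\<epsilon> * real n"] 2(2) by blast
    have "(1::nat) \<le> 2 ^ J" by (rule one_le_power) simp
    then obtain b' where b': "real b' \<le> 576 * (real l)\<^sup>2 * (384 * (real n / (\<eta> * sqrt (real (2 ^ J)))) + 2)"
      "acs ?X b' (\<lambda>S T m v. \<bar>v - real (?h S T m)\<bar> \<le> \<eta> * max (real (2 ^ J)) (real (?h S T m)))
        ((1/2) ^ \<mu>) (\<lambda>_ _ _. True) 0"
      using acs_full_sampling[OF n \<eta>(1) _ \<mu>, of "2 ^ J"] by blast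
    have comb: "acs ?X (b + b') (\<lambda>S T m v. \<bar>v - real (?h S T m)\<bar> \<le> \<epsilon> / 2 * real (?h S T m))
      ((real l + 1) * ?\<Delta> + 2 * (1/2) ^ \<mu>) (\<lambda>S T m. ?h S T m \<le> k) ((1/2) ^ \<mu>)"
    proof (rule acs_orelse[OF b(3) b'(2), where \<psi> = "(1/2) ^ \<mu>"])
      fix S T m v assume v: "\<bar>v - real (?h S T m)\<bar> \<le> \<eta> * max (real (2 ^ J)) (real (?h S T m))"
      show "\<bar>v - real (?h S T m)\<bar> \<le> \<epsilon> / 2 * real (?h S T m) \<or> ?h S T m \<le> 2 ^ J \<and> (1/2 :: real) ^ \<mu> \<le> (1/2) ^ \<mu>"
      proof (cases "?h S T m \<le> 2 ^ J")
        case False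
        then have "real (2 ^ J) \<le> real (?h S T m)" unfolding of_nat_le_iff by simp
        then have "\<eta> * max (real (2 ^ J)) (real (?h S T m)) = \<eta> * real (?h S T m)" by simp
        moreover have "\<eta> * real (?h S T m) \<le> \<epsilon> / 2 * real (?h S T m)" using \<epsilon> by (intro mult_right_mono) (auto simp: \<eta>_def)
        ultimately show ?thesis using v by linarith
      qed simp
    qed (use e0 in auto)
    define y where "y = \<epsilon> * real n"
    have y: "1 \<le> y" using 2(2) by (simp add: y_def)
    have s1: "1 \<le> ?s"
    proof -
      have "\<epsilon>\<^sup>2 \<le> 1" using \<epsilon> by (simp add: power_le_one)
      also have "1 \<le> sqrt y" using y by simp
      finally show ?thesis using \<epsilon> by (simp add: y_def)
    qed
    have "real n / (\<eta> * sqrt (real (2 ^ J))) \<le> real n / (\<eta> * sqrt y)"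
      using \<eta> y b(1) by (intro divide_left_mono mult_left_mono) (auto simp: y_def)
    also have "\<dots> = 4 * ((y / sqrt y) / \<epsilon>\<^sup>2)" using \<epsilon> by (simp add: \<eta>_def y_def power2_eq_square mult_ac)
    also have "\<dots> = 4 * ?s" using y by (simp add: real_div_sqrt y_def)
    finally have "384 * (real n / (\<eta> * sqrt (real (2 ^ J)))) + 2 \<le> 1538 * ?s" using s1 by linarith
    then have "576 * x\<^sup>2 * (384 * (real n / (\<eta> * sqrt (real (2 ^ J)))) + 2) \<le> 576 * x\<^sup>2 * (1538 * ?s)"
      by (intro mult_left_mono) auto
    also have "\<dots> = 885888 * (x\<^sup>2 * ?s)" by simp
    also have "\<dots> \<le> 885888 * (x ^ 7 * ?s)"
      using x s1 by (intro mult_left_mono mult_right_mono power_increasing) auto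
    finally have "real b' \<le> 885888 * (x ^ 7 * ?s)" using b'(1) by (simp add: x_def)
    moreover have "0 \<le> x ^ 7 * ?s" using x s1 by (intro mult_nonneg_nonneg zero_le_power) linarith+
    ultimately have "real (b + b') \<le> 2 * 10 ^ 11 * x ^ 7 * ?s" using b(2) by simp
    moreover have "min (sqrt (real k)) (sqrt (\<epsilon> * real n)) = sqrt (\<epsilon> * real n)" using 2(1) by simp
    ultimately show ?thesis using comb by (intro exI[of _ "b + b'"]) (simp add: x_def)
  next
    case 3
    have "acs ?X (\<mu> * n) (\<lambda>S T m v. \<bar>v - real (?h S T m)\<bar> \<le> \<epsilon> / 2 * real (?h S T m)) ((real l + 1) * ?\<Delta> + 2 * (1/2) ^ \<mu>)
      (\<lambda>S T m. ?h S T m \<le> k) ((1/2) ^ \<mu>)"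
      by (rule acs_mono[OF acs_store_everything]) (use \<epsilon> \<Delta> in auto)
    moreover have "real (\<mu> * n) \<le> 2 * 10 ^ 11 * real l ^ 7 * (min (sqrt (real k)) (sqrt (\<epsilon> * real n)) / \<epsilon>\<^sup>2)"
    proof -
      define y where "y = \<epsilon> * real n"
      have y: "0 < y" "y < 1" using 3(2) \<epsilon> n by (auto simp: y_def)
      have "y\<^sup>2 \<le> y" using y by (simp add: power2_eq_square mult_left_le)
      then have "y \<le> sqrt y" using y by (intro real_le_rsqrt)
      moreover have "\<epsilon> * y \<le> y" using \<epsilon> y by (simp add: mult_left_le_one_le)
      ultimately have "real n * \<epsilon>\<^sup>2 \<le> sqrt y" by (simp add: y_def power2_eq_square mult_ac)
      then have "real n \<le> sqrt y / \<epsilon>\<^sup>2" using \<epsilon> by (simp add: field_simps)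
      then have "16 * x * real n \<le> 2 * 10 ^ 11 * x ^ 7 * (sqrt y / \<epsilon>\<^sup>2)"
        using x \<epsilon> by (intro mult_mono self_le_power) auto
      moreover have "min (sqrt (real k)) (sqrt (\<epsilon> * real n)) = sqrt y" using 3(1) by (simp add: y_def)
      ultimately show ?thesis by (simp add: \<mu> x_def)
    qed
    ultimately show ?thesis by blast
  qed
qed

theorem theorem2:
  shows "\<exists>(c::real) (C::real) (d::nat). c > 0 \<and> C > 0 \<and>
    (\<forall>(\<sigma>::nat) (n::nat) (k::nat) (\<epsilon>::real).
      1 \<le> k \<and> k \<le> n \<and> 0 < \<epsilon> \<and> \<epsilon> < 1 \<longrightarrow>
      (\<exists>(M :: sketch_space measure) sk dec.
         is_ACS c n \<epsilon> k (strings \<sigma> n) M sk dec \<and>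
         has_size c n (strings \<sigma> n) M sk
           (C * (1 + log 2 (real n)) ^ d *
             min (\<epsilon> powr (-2) * sqrt (real k)) (\<epsilon> powr (-3/2) * sqrt (real n)))))"
\<comment> \<open>The exponent 7 is six logarithmic factors per scale and one for the number of
  scales; \<open>2 * 10 ^ 11\<close> dominates the sum of 1344 * 10^8 and 885888 from
  \<open>acs_exists\<close>.\<close>
proof (rule exI[of _ 1], rule exI[of _ "2 * 10 ^ 11"], rule exI[of _ 7], intro conjI allI impI)
  fix \<sigma> n k :: nat and \<epsilon> :: real
  assume asm: "1 \<le> k \<and> k \<le> n \<and> 0 < \<epsilon> \<and> \<epsilon> < 1"
  let ?s = "2 * 10 ^ 11 * (1 + log 2 (real n)) ^ 7 *
    min (\<epsilon> powr (-2) * sqrt (real k)) (\<epsilon> powr (-3/2) * sqrt (real n))"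
  show "\<exists>(M :: sketch_space measure) sk dec. is_ACS 1 n \<epsilon> k (strings \<sigma> n) M sk dec \<and>
    has_size 1 n (strings \<sigma> n) M sk ?s"
  proof (cases "n = 1")
    \<comment> \<open>For \<open>n = 1\<close>, \<open>whp\<close> only demands probability at least
      1 - 1 = 0. The case is separated because the scheme needs \<open>l \<ge> 1\<close>.\<close>
    case True
    let ?M = "measure_pmf (return_pmf undefined) :: sketch_space measure"
    have whp: "whp 1 n ?M Q" for Q unfolding whp_def using True by simp
    have "is_ACS 1 n \<epsilon> k (strings \<sigma> n) ?M fst snd"
      unfolding is_ACS_def Let_def randomized_pair_def using whp
      by (simp add: measure_pmf.prob_space_axioms)
    moreover have "has_size 1 n (strings \<sigma> n) ?M fst ?s" unfolding has_size_def using whp by blast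
    ultimately show ?thesis by blast
  next
    case False
    then have n: "n \<ge> 2" "n > 0" using asm by auto
    define l where "l = nat \<lceil>log 2 (real n)\<rceil>"
    have lg: "log 2 (real n) \<ge> 1" using n by (simp add: le_log_iff)
    have l: "l \<ge> 1" "real l \<le> 1 + log 2 (real n)" using lg unfolding l_def by linarith+
    have "real n = 2 powr (log 2 (real n))" using n by simp
    also have "\<dots> \<le> 2 powr (real l)" unfolding l_def by (intro powr_mono real_nat_ceiling_ge) simp
    also have "\<dots> = real (2 ^ l)" by (simp add: powr_realpow)
    finally have nl: "n \<le> 2 ^ l" unfolding of_nat_le_iff .
    obtain b where b: "real b \<le> 2 * 10 ^ 11 * real l ^ 7 * (min (sqrt (real k)) (sqrt (\<epsilon> * real n)) / \<epsilon>\<^sup>2)"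
      "acs (strings (2 ^ (16 * l)) n) b
        (\<lambda>S T m v. \<bar>v - real (Ham S (cyc_pow m T))\<bar> \<le> \<epsilon> / 2 * real (Ham S (cyc_pow m T)))
        ((real l + 1) * (109 * real l * real n * (1/2) ^ (16 * l)) + 2 * (1/2) ^ (16 * l))
        (\<lambda>S T m. Ham S (cyc_pow m T) \<le> k) ((1/2) ^ (16 * l))"
      using acs_exists[OF n(2) nl l(1), of k \<epsilon> "16 * l"] asm by auto
    have "real l ^ 7 \<le> (1 + log 2 (real n)) ^ 7" using l by (intro power_mono) auto
    then have "2 * 10 ^ 11 * real l ^ 7 * (min (sqrt (real k)) (sqrt (\<epsilon> * real n)) / \<epsilon>\<^sup>2)
      \<le> 2 * 10 ^ 11 * (1 + log 2 (real n)) ^ 7 * (min (sqrt (real k)) (sqrt (\<epsilon> * real n)) / \<epsilon>\<^sup>2)"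
      using asm by (intro mult_right_mono mult_left_mono) auto
    moreover have "0 < \<epsilon>" using asm by simp
    ultimately have "real b \<le> ?s" unfolding sketch_size_eq[OF \<open>0 < \<epsilon>\<close>] using b(1) by linarith
    then show ?thesis
      by (intro acs_imp_ACS[OF n(2) _ _ _ b(2) total_error_le[OF n(2) nl l(1)]]) (use asm in auto)
  qed
qed simp_all

end
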